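(* Let $\beta=\frac1{100\sqrt n\log n}$, $\gamma=\log^4 n$, $\rho=\log^{-20}n$, and $\alpha_1=\frac{\rho}{n^{1/2}},\ \alpha_2=\frac{\gamma\rho^2}{n},\ \alpha_3=\frac{\gamma^3\rho^3}{n^{3/2}},\ \alpha_4=\frac{\gamma^6\rho^4}{n^2}$. Then with probability $1-O(n^{-4})$ over $G\sim\mathbb G(n,\tfrac12)$, \[ H'_{22}\succeq H_{12}^TH_{11}^{-1}H_{12}. \]
   Context: $G\sim\mathbb G(n,\tfrac12)$ on vertex set $[n]$. For $i\neq j$ let $A_{ij}=1$ if $\{i,j\}\in E(G)$ and $A_{ij}=-1$ otherwise; $A_{ii}=0$; $\mathcal G_{ij}\in\{0,1\}$ is the edge indicator. Set $\alpha_0=1$. $N=N(G,\underline\alpha)$ has rows and columns indexed by subsets of $[n]$ of size at most $2$, $N_{A,B}=\alpha_{|A\cup B|}\prod_{i\in A\setminus B,\ j\in B\setminus A}\mathcal G_{ij}$; $\mathcal A_{A,B}=\alpha_{|A|}\alpha_{|B|}$. For $a,b\in\{1,2\}$, $H_{ab}$ is the submatrix of $N-\mathcal A$ with rows indexed by $a$-element subsets and columns by $b$-element subsets; $H_{11}^{-1}$ is the inverse of $H_{11}$. $\mathbb E$ is expectation over $G$. $Q(A,B)=H_{22}(A,B)-\mathbb E[H_{22}](A,B)$ if $A\cap B=\emptyset$ and $0$ otherwise; $K=H_{22}-\mathbb E[H_{22}]-Q$. $a_i\in\mathbb R^{\binom n2}$, $a_i(\{k,\ell\})=A_{ik}A_{i\ell}$;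 $D_i=\mathrm{diag}(a_i)$; $J$ is the all-ones $\binom n2\times\binom n2$ matrix. $H'_{22}=H_{22}+\beta\sum_{i\in[n]}D_i\big(H_{22}+\tfrac1{16}\alpha_2^2J-K\big)D_i$. *)

theory Defs
  imports "HOL-Probability.Probability" "HOL-Library.Landau_Symbols"
begin

text \<open>A matrix with rows indexed by a finite set \<open>R\<close> and columns indexed by a finite set \<open>C\<close>
  is a function of two arguments of which only the values on \<open>R \<times> C\<close> are significant.
  The operations below take the relevant index set as an explicit argument.\<close>

type_synonym 'a rmat = "'a \<Rightarrow> 'a \<Rightarrow> real"

definition mat_prod :: "'a set \<Rightarrow> 'a rmat \<Rightarrow> 'a rmat \<Rightarrow> 'a rmat" where
  "mat_prod S X Y = (\<lambda>A B. \<Sum>C\<in>S. X A C * Y C B)"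

definition mat_transpose :: "'a rmat \<Rightarrow> 'a rmat" where
  "mat_transpose X = (\<lambda>A B. X B A)"

definition mat_diag :: "('a \<Rightarrow> real) \<Rightarrow> 'a rmat" where
  "mat_diag v = (\<lambda>A B. if A = B then v A else 0)"

definition submat :: "'a set \<Rightarrow> 'a set \<Rightarrow> 'a rmat \<Rightarrow> 'a rmat" where
  "submat R C X = (\<lambda>A B. if A \<in> R \<and> B \<in> C then X A B else 0)"

definition is_inverse_on :: "'a set \<Rightarrow> 'a rmat \<Rightarrow> 'a rmat \<Rightarrow> bool" where
  "is_inverse_on S X W \<longleftrightarrow>
     (\<forall>A\<in>S. \<forall>B\<in>S. mat_prod S X W A B = (if A = B then 1 else 0)
                   \<and> mat_prod S W X A B = (if A = B then 1 else 0))"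

definition invertible_on :: "'a set \<Rightarrow> 'a rmat \<Rightarrow> bool" where
  "invertible_on S X \<longleftrightarrow> (\<exists>W. is_inverse_on S X W)"

text \<open>The entries of the inverse on \<open>S \<times> S\<close> are uniquely determined if \<open>invertible_on S X\<close>;
  otherwise the value is unspecified.\<close>

definition inv_on :: "'a set \<Rightarrow> 'a rmat \<Rightarrow> 'a rmat" where
  "inv_on S X = (SOME W. is_inverse_on S X W)"

definition psd_on :: "'a set \<Rightarrow> 'a rmat \<Rightarrow> bool" where
  "psd_on S X \<longleftrightarrow>
     (\<forall>A\<in>S. \<forall>B\<in>S. X A B = X B A) \<and>
     (\<forall>v :: 'a \<Rightarrow> real. 0 \<le> (\<Sum>A\<in>S. \<Sum>B\<in>S. v A * X A B * v B))"

definition loewner_ge_on :: "'a set \<Rightarrow> 'a rmat \<Rightarrow> 'a rmat \<Rightarrow> bool" where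
  "loewner_ge_on S X Y \<longleftrightarrow> psd_on S (\<lambda>A B. X A B - Y A B)"

definition ksubsets :: "nat \<Rightarrow> nat \<Rightarrow> nat set set" where
  "ksubsets n k = {A. A \<subseteq> {1..n} \<and> card A = k}"

text \<open>A graph on \<open>{1..n}\<close> is represented by its edge set, a subset of \<open>ksubsets n 2\<close>.\<close>

definition gnp :: "nat \<Rightarrow> real \<Rightarrow> nat set set pmf" where
  "gnp n p = map_pmf (\<lambda>f. {e \<in> ksubsets n 2. f e})
               (Pi_pmf (ksubsets n 2) False (\<lambda>_. bernoulli_pmf p))"

definition edge_ind :: "nat set set \<Rightarrow> nat \<Rightarrow> nat \<Rightarrow> real" where
  "edge_ind G i j = (if {i, j} \<in> G then 1 else 0)"

definition edge_sign :: "nat set set \<Rightarrow> nat \<Rightarrow> nat \<Rightarrow> real" where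
  "edge_sign G i j = (if i = j then 0 else if {i, j} \<in> G then 1 else - 1)"

definition Nmat :: "(nat \<Rightarrow> real) \<Rightarrow> nat set set \<Rightarrow> nat set rmat" where
  "Nmat \<alpha> G = (\<lambda>A B. \<alpha> (card (A \<union> B)) * (\<Prod>i\<in>A - B. \<Prod>j\<in>B - A. edge_ind G i j))"

definition Amat :: "(nat \<Rightarrow> real) \<Rightarrow> nat set rmat" where
  "Amat \<alpha> = (\<lambda>A B. \<alpha> (card A) * \<alpha> (card B))"

definition Hmat :: "nat \<Rightarrow> (nat \<Rightarrow> real) \<Rightarrow> nat \<Rightarrow> nat \<Rightarrow> nat set set \<Rightarrow> nat set rmat" where
  "Hmat n \<alpha> a b G =
     submat (ksubsets n a) (ksubsets n b) (\<lambda>A B. Nmat \<alpha> G A B - Amat \<alpha> A B)"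

definition EH22 :: "nat \<Rightarrow> (nat \<Rightarrow> real) \<Rightarrow> nat set rmat" where
  "EH22 n \<alpha> = (\<lambda>A B. measure_pmf.expectation (gnp n (1/2)) (\<lambda>G. Hmat n \<alpha> 2 2 G A B))"

definition Qmat :: "nat \<Rightarrow> (nat \<Rightarrow> real) \<Rightarrow> nat set set \<Rightarrow> nat set rmat" where
  "Qmat n \<alpha> G =
     (\<lambda>A B. if A \<inter> B = {} then Hmat n \<alpha> 2 2 G A B - EH22 n \<alpha> A B else 0)"

definition Kmat :: "nat \<Rightarrow> (nat \<Rightarrow> real) \<Rightarrow> nat set set \<Rightarrow> nat set rmat" where
  "Kmat n \<alpha> G = (\<lambda>A B. Hmat n \<alpha> 2 2 G A B - EH22 n \<alpha> A B - Qmat n \<alpha> G A B)"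

text \<open>For \<open>S = {k, l}\<close> with \<open>k \<noteq> l\<close> the product below is \<open>A\<^sub>i\<^sub>k A\<^sub>i\<^sub>l\<close>.\<close>

definition avec :: "nat set set \<Rightarrow> nat \<Rightarrow> nat set \<Rightarrow> real" where
  "avec G i S = (\<Prod>k\<in>S. edge_sign G i k)"

definition Dmat :: "nat set set \<Rightarrow> nat \<Rightarrow> nat set rmat" where
  "Dmat G i = mat_diag (avec G i)"

definition Jmat :: "nat set rmat" where
  "Jmat = (\<lambda>A B. 1)"

definition H22' :: "nat \<Rightarrow> (nat \<Rightarrow> real) \<Rightarrow> real \<Rightarrow> nat set set \<Rightarrow> nat set rmat" where
  "H22' n \<alpha> \<beta> G =
     (let P = ksubsets n 2;
          M = (\<lambda>A B. Hmat n \<alpha> 2 2 G A B + 1/16 * (\<alpha> 2)\<^sup>2 * Jmat A B - Kmat n \<alpha> G A B)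
      in (\<lambda>A B. Hmat n \<alpha> 2 2 G A B
            + \<beta> * (\<Sum>i\<in>{1..n}. mat_prod P (mat_prod P (Dmat G i) M) (Dmat G i) A B)))"

end

theory Submission
  imports Defs "Jordan_Normal_Form.Determinant" "HOL-Real_Asymp.Real_Asymp"
begin

text \<open>Write \<open>L = ln n\<close>. Since \<open>D\<^sub>i\<^sup>2\<close> is the identity off the pairs containing \<open>i\<close>, the sum over \<open>i\<close>
  contributes about \<open>\<beta> n \<alpha>\<^sub>2\<close> times the identity, which is of order \<open>L\<^sup>-\<^sup>3\<^sup>7 / sqrt n\<close>. This dominates every
  error term; only the all-ones direction needs in addition the term \<open>\<alpha>\<^sub>4 J / 16\<close> of the mean of
  \<open>H\<^sub>2\<^sub>2\<close>. The disjoint entries are expanded into the characters of the subgraphs of the 4-cycle. With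
  \<open>A\<close> the sign matrix, all their forms except one are bounded through its operator norm, which is
  \<open>O(sqrt n L)\<close> by a union bound over a grid. The exception is the full 4-cycle summed over the
  conjugations by \<open>D\<^sub>x\<close>: for each fixed vertex \<open>i\<close> it is an \<open>n\<close> by \<open>n\<^sup>2\<close> matrix whose Gram matrix has
  off-diagonal entries that are quadratic chaoses in the row \<open>i\<close> of \<open>A\<close>, hence of size \<open>n\<^sup>2\<close> up to
  logarithms. All probability estimates are instances of one exponential supermartingale bound.\<close>

section \<open>Concentration of adapted sums\<close>

text \<open>In \<open>H\<^sub>2\<^sub>2\<close> alone the identity has coefficient of order
  \<alpha>2, about \<open>1 / n\<close>, while the bounds for entries sharing a vertex
  (\<open>n * \<alpha> 3\<close>) and for the 4-cycle (\<open>n powr (3/2) * \<alpha> 4\<close>)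
  have order \<open>1 / sqrt n\<close> up to logarithms. This is why the conjugations are needed.
  They raise the identity but also add up the errors: with prefactor \<beta> \<alpha>4, each
  character form summed over the n conjugations may have norm about \<open>n\<^sup>2\<close> up to
  logarithms. Treating the 4-cycle separately for each conjugation gives
  \<open>n powr (5/2)\<close>, so cancellation between conjugations has to be used. Likewise an
  entrywise error of size \<alpha>3 at overlapping pairs would cost order 1 after conjugation; with
  K removed, only the mean of these entries is left, and its form is nonnegative. The exponents 0,
  1, 3, 6 of \<gamma> in \<alpha>1, ..., \<alpha>4 give
  \<open>\<alpha>\<^sub>1\<^sup>2 = \<alpha>\<^sub>2 / \<gamma>\<close>, \<open>\<alpha>\<^sub>1
  \<alpha>\<^sub>2 = \<alpha>\<^sub>3 / \<gamma>\<^sup>2\<close>, \<open>\<alpha>\<^sub>3\<^sup>2 =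
  \<alpha>\<^sub>2 \<alpha>\<^sub>4 / \<gamma>\<close> and \<open>\<alpha>\<^sub>2\<^sup>2 =
  \<alpha>\<^sub>4 / \<gamma>\<^sup>4\<close>. So the comparisons along the all-ones directions,
  where the powers of n balance exactly, are won by powers of the logarithm.\<close>

definition esign :: "nat set set \<Rightarrow> nat set \<Rightarrow> real" where
  "esign G e = (if e \<in> G then 1 else - 1)"

lemma sum_Pow_split:
  fixes F :: "'a set \<Rightarrow> real"
  assumes "finite E" "e \<in> E"
  shows "(\<Sum>G\<in>Pow E. F G) = (\<Sum>G\<in>Pow (E - {e}). F G + F (insert e G))"
proof -
  have E: "Pow E = Pow (E - {e}) \<union> insert e ` Pow (E - {e})"
    using Pow_insert[of e "E - {e}"] assms(2) by (simp add: insert_absorb)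
  have inj: "inj_on (insert e) (Pow (E - {e}))"
    by (auto simp: inj_on_def)
  have "(\<Sum>G\<in>Pow E. F G) = (\<Sum>G\<in>Pow (E - {e}). F G) + (\<Sum>G\<in>insert e ` Pow (E - {e}). F G)"
    unfolding E using assms(1) by (intro sum.union_disjoint) auto
  also have "(\<Sum>G\<in>insert e ` Pow (E - {e}). F G) = (\<Sum>G\<in>Pow (E - {e}). F (insert e G))"
    using inj by (simp add: sum.reindex)
  finally show ?thesis by (simp add: sum.distrib)
qed

text \<open>The power series are compared termwise, since \<open>2 ^ k * fact k\<close> is at most
  \<open>fact (2 * k)\<close>. This is the subgaussian estimate for one random sign.\<close>

lemma cosh_le_exp: "exp x + exp (- x) \<le> 2 * exp (x\<^sup>2 / 2)" for x :: real
proof -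
  have "(\<lambda>k. if even (2 * k) then x ^ (2 * k) /\<^sub>R fact (2 * k) else 0) sums cosh x"
    by (subst sums_mono_reindex[where g = "\<lambda>k. 2 * k"])
      (auto simp: strict_mono_def cosh_converges)
  hence s1: "(\<lambda>k. x ^ (2*k) / fact (2*k)) sums cosh x"
    by (simp add: field_simps)
  have s2: "(\<lambda>k. (x\<^sup>2/2) ^ k / fact k) sums exp (x\<^sup>2/2)"
    using exp_converges[of "x\<^sup>2/2"] by (simp add: field_simps)
  have f: "2 ^ k * fact k \<le> (fact (2*k) :: real)" for k
  proof (induction k)
    case (Suc k)
    have "2 ^ Suc k * fact (Suc k) = (2 * (real k + 1)) * (2 ^ k * fact k)"
      by simp
    also have "\<dots> \<le> (2 * (real k + 1)) * fact (2 * k)"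
      by (intro mult_left_mono Suc.IH) auto
    also have "\<dots> \<le> (2 * real k + 1) * ((2 * (real k + 1)) * fact (2 * k))"
      using mult_right_mono[of 1 "2 * real k + 1" "(2 * (real k + 1)) * fact (2 * k)"] by simp
    also have "\<dots> = fact (2 * Suc k)"
      by (simp add: algebra_simps)
    finally show ?case .
  qed simp
  have "cosh x \<le> exp (x\<^sup>2/2)"
  proof (rule sums_le[OF _ s1 s2])
    fix k
    have "x ^ (2*k) / fact (2*k) \<le> x ^ (2*k) / (2 ^ k * fact k)"
      by (intro divide_left_mono f) (auto simp: zero_le_even_power)
    also have "\<dots> = (x\<^sup>2/2) ^ k / fact k"
      by (simp add: power_mult power_divide)
    finally show "x ^ (2*k) / fact (2*k) \<le> (x\<^sup>2/2) ^ k / fact k" .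
  qed
  thus ?thesis by (simp add: cosh_def)
qed

text \<open>The list reveals the edges from last to first, so \<open>y e\<close> may depend on the edges behind
  \<open>e\<close> in the list and on those outside it; the sum is then an exponential supermartingale.\<close>

lemma adapted_exp_sum_le:
  fixes y :: "nat set \<Rightarrow> nat set set \<Rightarrow> real"
  assumes "finite E" "set es \<subseteq> E" "distinct es"
    and "sorted_wrt (\<lambda>e e'. \<forall>G. y e' (insert e G) = y e' G) es"
    and "\<And>e G. e \<in> set es \<Longrightarrow> y e (insert e G) = y e G"
  shows "(\<Sum>G\<in>Pow E. exp (c * (\<Sum>e\<leftarrow>es. esign G e * y e G) - c\<^sup>2 / 2 * (\<Sum>e\<leftarrow>es. (y e G)\<^sup>2)))
           \<le> 2 ^ card E"
  using assms(2-)
proof (induction es)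
  case Nil
  show ?case using assms(1) by (simp add: card_Pow)
next
  case (Cons e es)
  define R where "R = (\<lambda>G. exp (c * (\<Sum>e\<leftarrow>es. esign G e * y e G) - c\<^sup>2 / 2 * (\<Sum>e\<leftarrow>es. (y e G)\<^sup>2)))"
  define F where "F = (\<lambda>G. R G * exp (c * (esign G e * y e G) - c\<^sup>2 / 2 * (y e G)\<^sup>2))"
  have e: "e \<in> E" "e \<notin> set es" using Cons.prems by auto
  have ins: "y f (insert e G) = y f G" if "f \<in> set (e # es)" for f G
    using Cons.prems(3) Cons.prems(4) that by auto
  have R: "R (insert e G) = R G" for G
  proof -
    have "map (\<lambda>f. esign (insert e G) f * y f (insert e G)) es = map (\<lambda>f. esign G f * y f G) es"
      "map (\<lambda>f. (y f (insert e G))\<^sup>2) es = map (\<lambda>f. (y f G)\<^sup>2) es"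
      using ins e(2) by (auto simp: esign_def)
    thus ?thesis unfolding R_def by metis
  qed
  have "(\<Sum>G\<in>Pow E. exp (c * (\<Sum>e\<leftarrow>e # es. esign G e * y e G) - c\<^sup>2 / 2 * (\<Sum>e\<leftarrow>e # es. (y e G)\<^sup>2)))
      = (\<Sum>G\<in>Pow E. F G)"
    unfolding F_def R_def by (intro sum.cong refl) (simp add: exp_add[symmetric] algebra_simps)
  also have "\<dots> = (\<Sum>G\<in>Pow (E - {e}). F G + F (insert e G))"
    by (rule sum_Pow_split) (use assms(1) e in auto)
  \<comment> \<open>Neither \<open>R\<close> nor \<open>y e\<close> sees the edge \<open>e\<close>,
    so averaging over it leaves a hyperbolic cosine, which the quadratic compensator
    absorbs.\<close>
  also have "\<dots> \<le> (\<Sum>G\<in>Pow (E - {e}). R G + R (insert e G))"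
  proof (rule sum_mono)
    fix G assume "G \<in> Pow (E - {e})"
    hence s: "esign G e = -1" "esign (insert e G) e = 1" by (auto simp: esign_def)
    have "F G + F (insert e G) = R G * ((exp (c * y e G) + exp (- (c * y e G))) * exp (- (c\<^sup>2 / 2 * (y e G)\<^sup>2)))"
      unfolding F_def R ins[of e, simplified] s
      by (simp add: distrib_right distrib_left exp_add[symmetric] exp_diff exp_minus field_simps)
    also have "\<dots> \<le> R G * (2 * exp ((c * y e G)\<^sup>2 / 2) * exp (- (c\<^sup>2 / 2 * (y e G)\<^sup>2)))"
      by (intro mult_left_mono mult_right_mono cosh_le_exp) (auto simp: R_def)
    also have "\<dots> = R G + R (insert e G)"
      unfolding R by (simp add: mult_exp_exp power_mult_distrib)
    finally show "F G + F (insert e G) \<le> R G + R (insert e G)" .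
  qed
  also have "\<dots> = (\<Sum>G\<in>Pow E. R G)"
    by (rule sum_Pow_split[symmetric]) (use assms(1) e in auto)
  also have "\<dots> \<le> 2 ^ card E"
    unfolding R_def using Cons.prems by (intro Cons.IH) auto
  finally show ?case .
qed

lemma adapted_upper_tail:
  fixes y :: "nat set \<Rightarrow> nat set set \<Rightarrow> real"
  assumes "finite E" "set es \<subseteq> E" "distinct es"
    and "sorted_wrt (\<lambda>e e'. \<forall>G. y e' (insert e G) = y e' G) es"
    and "\<And>e G. e \<in> set es \<Longrightarrow> y e (insert e G) = y e G"
    and "V > 0" "t \<ge> 0"
  shows "measure_pmf.prob (pmf_of_set (Pow E))
           {G. (\<Sum>e\<leftarrow>es. (y e G)\<^sup>2) \<le> V \<and> (\<Sum>e\<leftarrow>es. esign G e * y e G) > t * sqrt V}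
         \<le> exp (- (t\<^sup>2 / 2))"
proof -
  let ?X = "{G. (\<Sum>e\<leftarrow>es. (y e G)\<^sup>2) \<le> V \<and> (\<Sum>e\<leftarrow>es. esign G e * y e G) > t * sqrt V}"
  define c where "c = t / sqrt V"
  have c: "c \<ge> 0" "c * (t * sqrt V) = t\<^sup>2" "c\<^sup>2 * V = t\<^sup>2"
    using assms(6,7) by (auto simp: c_def power2_eq_square power_divide)
  let ?f = "\<lambda>G. exp (c * (\<Sum>e\<leftarrow>es. esign G e * y e G) - c\<^sup>2 / 2 * (\<Sum>e\<leftarrow>es. (y e G)\<^sup>2))"
  have "real (card (Pow E \<inter> ?X)) * exp (t\<^sup>2 / 2) = (\<Sum>G\<in>Pow E \<inter> ?X. exp (t\<^sup>2 / 2))"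
    by simp
  also have "\<dots> \<le> (\<Sum>G\<in>Pow E \<inter> ?X. ?f G)"
  proof (intro sum_mono)
    fix G assume "G \<in> Pow E \<inter> ?X"
    hence v: "(\<Sum>e\<leftarrow>es. (y e G)\<^sup>2) \<le> V" and s: "t * sqrt V < (\<Sum>e\<leftarrow>es. esign G e * y e G)"
      by auto
    have "c * (t * sqrt V) \<le> c * (\<Sum>e\<leftarrow>es. esign G e * y e G)"
      using s c by (intro mult_left_mono) auto
    moreover have "c\<^sup>2 / 2 * (\<Sum>e\<leftarrow>es. (y e G)\<^sup>2) \<le> c\<^sup>2 / 2 * V"
      using v by (intro mult_left_mono) auto
    ultimately show "exp (t\<^sup>2 / 2) \<le> ?f G"
      unfolding exp_le_cancel_iff using c by linarith
  qed
  also have "\<dots> \<le> (\<Sum>G\<in>Pow E. ?f G)"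
    using assms(1) by (intro sum_mono2) auto
  also have "\<dots> \<le> 2 ^ card E"
    by (rule adapted_exp_sum_le) (use assms in auto)
  finally have "real (card (Pow E \<inter> ?X)) / 2 ^ card E \<le> exp (- (t\<^sup>2 / 2))"
    by (simp add: exp_minus field_simps)
  thus ?thesis
    using assms(1) by (subst measure_pmf_of_set) (auto simp: card_Pow)
qed

lemma adapted_tail:
  fixes y :: "nat set \<Rightarrow> nat set set \<Rightarrow> real"
  assumes "finite E" "set es \<subseteq> E" "distinct es"
    and "sorted_wrt (\<lambda>e e'. \<forall>G. y e' (insert e G) = y e' G) es"
    and "\<And>e G. e \<in> set es \<Longrightarrow> y e (insert e G) = y e G"
    and "V > 0" "t \<ge> 0"
  shows "measure_pmf.prob (pmf_of_set (Pow E))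
           {G. (\<Sum>e\<leftarrow>es. (y e G)\<^sup>2) \<le> V \<and> \<bar>\<Sum>e\<leftarrow>es. esign G e * y e G\<bar> > t * sqrt V}
         \<le> 2 * exp (- (t\<^sup>2 / 2))" (is "measure_pmf.prob ?p ?X \<le> _")
proof -
  let ?U = "\<lambda>y. {G. (\<Sum>e\<leftarrow>es. (y e G)\<^sup>2) \<le> V \<and> (\<Sum>e\<leftarrow>es. esign G e * y e G) > t * sqrt V}"
  have neg: "(\<Sum>e\<leftarrow>es. - (esign G e * y e G)) = - (\<Sum>e\<leftarrow>es. esign G e * y e G)" for G
    by (induction es) auto
  have "measure_pmf.prob ?p ?X \<le> measure_pmf.prob ?p (?U y \<union> ?U (\<lambda>e G. - y e G))"
    by (intro measure_pmf.finite_measure_mono) (auto simp: neg)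
  also have "\<dots> \<le> measure_pmf.prob ?p (?U y) + measure_pmf.prob ?p (?U (\<lambda>e G. - y e G))"
    by (rule measure_Un_le) auto
  also have "\<dots> \<le> exp (- (t\<^sup>2 / 2)) + exp (- (t\<^sup>2 / 2))"
    by (intro add_mono adapted_upper_tail) (use assms in auto)
  finally show ?thesis by simp
qed

section \<open>Edges as independent signs; sums along one row of the sign matrix\<close>

lemma ksubsets_2_iff: "{i, j} \<in> ksubsets n 2 \<longleftrightarrow> i \<noteq> j \<and> i \<in> {1..n} \<and> j \<in> {1..n}"
  by (cases "i = j") (auto simp: ksubsets_def)

lemma finite_ksubsets [simp]: "finite (ksubsets n k)"
  by (rule finite_subset[of _ "Pow {1..n}"]) (auto simp: ksubsets_def)

lemma edge_sign_esign: "i \<noteq> j \<Longrightarrow> edge_sign G i j = esign G {i, j}"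
  by (simp add: edge_sign_def esign_def)

lemma edge_sign_insert: "{i, j} \<noteq> e \<Longrightarrow> edge_sign (insert e G) i j = edge_sign G i j"
  by (simp add: edge_sign_def)

abbreviation graph_prob :: "nat \<Rightarrow> nat set set set \<Rightarrow> real" where
  "graph_prob n \<equiv> measure_pmf.prob (pmf_of_set (Pow (ksubsets n 2)))"

text \<open>The edges at \<open>p\<close> are listed by decreasing other endpoint, hence revealed by
  increasing one. The coefficient of \<open>{p, k}\<close> may therefore depend on
  \<open>{p, x}\<close> for \<open>x < k\<close> and on all edges avoiding \<open>p\<close>, which
  covers both layers of a quadratic chaos in the row.\<close>

lemma row_tail:
  fixes y :: "nat \<Rightarrow> nat set set \<Rightarrow> real"
  assumes p: "p \<in> {1..n}"
    and y: "\<And>k x G. k \<in> {1..n} - {p} \<Longrightarrow> x \<in> {1..n} - {p} \<Longrightarrow> k \<le> x \<Longrightarrow> y k (insert {p, x} G) = y k G"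
    and "V > 0" "t \<ge> 0"
  shows "graph_prob n
           {G. (\<Sum>k\<in>{1..n} - {p}. (y k G)\<^sup>2) \<le> V \<and>
               \<bar>\<Sum>k\<in>{1..n} - {p}. edge_sign G p k * y k G\<bar> > t * sqrt V}
         \<le> 2 * exp (- (t\<^sup>2 / 2))"
proof -
  define ks where "ks = rev (sorted_list_of_set ({1..n} - {p}))"
  define es where "es = map (\<lambda>k. {p, k}) ks"
  define z where "z = (\<lambda>e. y (the_elem (e - {p})))"
  have ks: "set ks = {1..n} - {p}" "distinct ks" "sorted_wrt (\<lambda>a b. b \<le> a) ks"
    by (auto simp: ks_def sorted_wrt_rev)
  have z: "z {p, k} = y k" if "k \<noteq> p" for k
  proof -
    have "{p, k} - {p} = {k}" using that by auto
    thus ?thesis by (simp add: z_def)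
  qed
  have inj: "inj_on (\<lambda>k. {p, k}) ({1..n} - {p})"
    by (auto simp: inj_on_def doubleton_eq_iff)
  have tr: "(\<Sum>e\<leftarrow>es. g e) = (\<Sum>k\<in>{1..n} - {p}. g {p, k})" for g :: "_ \<Rightarrow> real"
    unfolding es_def map_map o_def using ks(2) by (simp add: sum_list_distinct_conv_sum_set ks(1))
  have "graph_prob n
           {G. (\<Sum>e\<leftarrow>es. (z e G)\<^sup>2) \<le> V \<and> \<bar>\<Sum>e\<leftarrow>es. esign G e * z e G\<bar> > t * sqrt V}
         \<le> 2 * exp (- (t\<^sup>2 / 2))"
  proof (rule adapted_tail[where y = z])
    show "set es \<subseteq> ksubsets n 2"
      unfolding es_def set_map ks(1) image_subset_iff ksubsets_2_iff using p by simp
    show "distinct es"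
      unfolding es_def distinct_map ks(1) using ks(2) inj by simp
    show "sorted_wrt (\<lambda>e e'. \<forall>G. z e' (insert e G) = z e' G) es"
      unfolding es_def sorted_wrt_map
    proof (rule sorted_wrt_mono_rel[OF _ ks(3)], rule allI)
      fix x k G assume "x \<in> set ks" "k \<in> set ks" "k \<le> x"
      thus "z {p, k} (insert {p, x} G) = z {p, k} G"
        unfolding ks(1) using y[of k x G] z[of k] by simp
    qed
    show "z e (insert e G) = z e G" if e: "e \<in> set es" for e G
    proof -
      obtain k where "k \<in> {1..n} - {p}" "e = {p, k}"
        using e unfolding es_def set_map ks(1) by blast
      thus ?thesis using y[of k k G] z[of k] by simp
    qed
  qed (use assms(3,4) in simp_all)
  also have "{G. (\<Sum>e\<leftarrow>es. (z e G)\<^sup>2) \<le> V \<and> \<bar>\<Sum>e\<leftarrow>es. esign G e * z e G\<bar> > t * sqrt V} = 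
    {G. (\<Sum>k\<in>{1..n} - {p}. (y k G)\<^sup>2) \<le> V \<and>
               \<bar>\<Sum>k\<in>{1..n} - {p}. edge_sign G p k * y k G\<bar> > t * sqrt V}"
  proof -
    have "(\<Sum>k\<in>{1..n} - {p}. (z {p, k} G)\<^sup>2) = (\<Sum>k\<in>{1..n} - {p}. (y k G)\<^sup>2)"
      "(\<Sum>k\<in>{1..n} - {p}. esign G {p, k} * z {p, k} G) = (\<Sum>k\<in>{1..n} - {p}. edge_sign G p k * y k G)" for G
      by (intro sum.cong refl; simp add: z edge_sign_esign)+
    thus ?thesis unfolding tr by simp
  qed
  finally show ?thesis .
qed

lemma gnp_half: "gnp n (1/2) = pmf_of_set (Pow (ksubsets n 2))"
  unfolding gnp_def by (rule pmf_of_set_Pow_conv_bernoulli) simp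

section \<open>Forms indexed by quadruples of vertices\<close>

lemma sum_swap_pairs:
  fixes f :: "'a \<Rightarrow> 'b \<Rightarrow> 'c \<Rightarrow> 'd \<Rightarrow> real"
  shows "(\<Sum>a\<in>A. \<Sum>b\<in>B. \<Sum>c\<in>C. \<Sum>d\<in>D. f a b c d) = (\<Sum>c\<in>C. \<Sum>d\<in>D. \<Sum>a\<in>A. \<Sum>b\<in>B. f a b c d)"
proof -
  have "(\<Sum>a\<in>A. \<Sum>b\<in>B. \<Sum>c\<in>C. \<Sum>d\<in>D. f a b c d) = (\<Sum>a\<in>A. \<Sum>c\<in>C. \<Sum>b\<in>B. \<Sum>d\<in>D. f a b c d)"
    by (rule sum.cong[OF refl], rule sum.swap)
  also have "\<dots> = (\<Sum>c\<in>C. \<Sum>a\<in>A. \<Sum>b\<in>B. \<Sum>d\<in>D. f a b c d)"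
    by (rule sum.swap)
  also have "\<dots> = (\<Sum>c\<in>C. \<Sum>a\<in>A. \<Sum>d\<in>D. \<Sum>b\<in>B. f a b c d)"
    by (rule sum.cong[OF refl], rule sum.cong[OF refl], rule sum.swap)
  also have "\<dots> = (\<Sum>c\<in>C. \<Sum>d\<in>D. \<Sum>a\<in>A. \<Sum>b\<in>B. f a b c d)"
    by (rule sum.cong[OF refl], rule sum.swap)
  finally show ?thesis .
qed

text \<open>A vector on pairs enters as a symmetric \<open>u\<close> with zero diagonal. Each pair
  is then counted twice on either side, so the form is four times the one over unordered pairs; in
  return all sums become products of matrices indexed by vertices.\<close>

definition quad :: "nat set \<Rightarrow> (nat \<Rightarrow> nat \<Rightarrow> real) \<Rightarrow> (nat \<Rightarrow> nat \<Rightarrow> nat \<Rightarrow> nat \<Rightarrow> real) \<Rightarrow> real" where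
  "quad V u f = (\<Sum>i\<in>V. \<Sum>j\<in>V. \<Sum>k\<in>V. \<Sum>l\<in>V. u i j * u k l * f i j k l)"

definition frob2 :: "nat set \<Rightarrow> (nat \<Rightarrow> nat \<Rightarrow> real) \<Rightarrow> real" where
  "frob2 V u = (\<Sum>i\<in>V. \<Sum>j\<in>V. (u i j)\<^sup>2)"

lemma frob2_nonneg [simp]: "0 \<le> frob2 V u"
  unfolding frob2_def by (intro sum_nonneg) auto

lemma abs_sum_mult_le: "\<bar>\<Sum>i\<in>I. x i * y i\<bar> \<le> sqrt (\<Sum>i\<in>I. (x i)\<^sup>2) * sqrt (\<Sum>i\<in>I. (y i)\<^sup>2)" for x y :: "'a \<Rightarrow> real"
proof -
  have "(\<Sum>i\<in>I. x i * y i)\<^sup>2 \<le> (\<Sum>i\<in>I. (x i)\<^sup>2) * (\<Sum>i\<in>I. (y i)\<^sup>2)"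
    by (rule Cauchy_Schwarz_ineq_sum)
  from real_sqrt_le_mono[OF this] show ?thesis by (simp add: real_sqrt_mult)
qed

lemma abs_sum2_mult_le: "\<bar>\<Sum>i\<in>V. \<Sum>j\<in>V. x i j * y i j\<bar> \<le> sqrt (frob2 V x) * sqrt (frob2 V y)"
  using abs_sum_mult_le[of "\<lambda>(i, j). x i j" "\<lambda>(i, j). y i j" "V \<times> V"]
  by (simp add: frob2_def sum.cartesian_product case_prod_unfold)

lemma sum_sqrt_le:
  fixes f :: "'a \<Rightarrow> real"
  assumes "\<And>i. i \<in> I \<Longrightarrow> 0 \<le> f i"
  shows "(\<Sum>i\<in>I. sqrt (f i)) \<le> sqrt (card I) * sqrt (\<Sum>i\<in>I. f i)"
proof -
  have "(\<Sum>i\<in>I. sqrt (f i)) \<le> \<bar>\<Sum>i\<in>I. 1 * sqrt (f i)\<bar>" by simp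
  also have "\<dots> \<le> sqrt (\<Sum>i\<in>I. 1\<^sup>2) * sqrt (\<Sum>i\<in>I. (sqrt (f i))\<^sup>2)"
    by (rule abs_sum_mult_le)
  also have "(\<Sum>i\<in>I. (sqrt (f i))\<^sup>2) = (\<Sum>i\<in>I. f i)"
    using assms by (intro sum.cong) auto
  finally show ?thesis by simp
qed

lemma sum_row_sq_le:
  fixes u :: "'a \<Rightarrow> real"
  shows "(\<Sum>j\<in>J. u j)\<^sup>2 \<le> card J * (\<Sum>j\<in>J. (u j)\<^sup>2)"
  using Cauchy_Schwarz_ineq_sum[of "\<lambda>_. 1" u J] by simp

section \<open>Symmetries of the quartic form and its expansion into characters\<close>

lemma quad_add: "quad V u (\<lambda>i j k l. f i j k l + g i j k l) = quad V u f + quad V u g"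
  by (simp add: quad_def distrib_left sum.distrib)

lemma quad_cmult: "quad V u (\<lambda>i j k l. c * f i j k l) = c * quad V u f"
  by (simp add: quad_def sum_distrib_left algebra_simps)

lemma quad_swap_left:
  assumes "\<And>i j. u i j = u j i"
  shows "quad V u (\<lambda>i j k l. f j i k l) = quad V u f"
  unfolding quad_def by (subst sum.swap) (use assms in simp)

lemma quad_swap_right:
  assumes "\<And>i j. u i j = u j i"
  shows "quad V u (\<lambda>i j k l. f i j l k) = quad V u f"
proof -
  have "(\<Sum>k\<in>V. \<Sum>l\<in>V. u i j * u k l * f i j l k) = (\<Sum>k\<in>V. \<Sum>l\<in>V. u i j * u k l * f i j k l)" for i j
    by (subst sum.swap) (use assms in simp)
  thus ?thesis unfolding quad_def by simp
qed

lemma quad_swap_pairs: "quad V u (\<lambda>i j k l. f k l i j) = quad V u f"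
  unfolding quad_def by (subst sum_swap_pairs) (simp add: mult.commute)

text \<open>The four factors are the edges of the 4-cycle between \<open>{i, j}\<close> and
  \<open>{k, l}\<close>. Its 16 subgraphs fall into orbits of sizes 1, 4, 4, 2, 4, 1 (empty, edge,
  star, matching, path, cycle) under the exchanges of \<open>i\<close> with \<open>j\<close>, of
  \<open>k\<close> with \<open>l\<close> and of the two pairs, all of which preserve the
  form.\<close>

lemma quad_expand:
  assumes u: "\<And>i j. u i j = u j i" and a: "\<And>i j. a i j = a j i"
  shows "quad V u (\<lambda>i j k l. (1 + a i k) * (1 + a i l) * (1 + a j k) * (1 + a j l)) =
    quad V u (\<lambda>i j k l. 1) + 4 * quad V u (\<lambda>i j k l. a i k)
    + 4 * quad V u (\<lambda>i j k l. a i k * a i l) + 2 * quad V u (\<lambda>i j k l. a i k * a j l)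
    + 4 * quad V u (\<lambda>i j k l. a i k * a i l * a j k)
    + quad V u (\<lambda>i j k l. a i k * a i l * a j k * a j l)"
proof -
  note sl = quad_swap_left[of u V, OF u] and sr = quad_swap_right[of u V, OF u] and sp = quad_swap_pairs[of V u]
  have 1: "quad V u (\<lambda>i j k l. a i l) = quad V u (\<lambda>i j k l. a i k)"
    using sr[of "\<lambda>i j k l. a i k"] by simp
  have 2: "quad V u (\<lambda>i j k l. a j k) = quad V u (\<lambda>i j k l. a i k)"
    using sl[of "\<lambda>i j k l. a i k"] by simp
  have 3: "quad V u (\<lambda>i j k l. a j l) = quad V u (\<lambda>i j k l. a i k)"
    using sl[of "\<lambda>i j k l. a i l"] 1 by simp
  have 4: "quad V u (\<lambda>i j k l. a j k * a j l) = quad V u (\<lambda>i j k l. a i k * a i l)"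
    using sl[of "\<lambda>i j k l. a i k * a i l"] by simp
  have 5: "quad V u (\<lambda>i j k l. a i k * a j k) = quad V u (\<lambda>i j k l. a i k * a i l)"
    using sp[of "\<lambda>i j k l. a i k * a i l"] by (simp add: a mult.commute)
  have 6: "quad V u (\<lambda>i j k l. a i l * a j l) = quad V u (\<lambda>i j k l. a i k * a i l)"
    using sr[of "\<lambda>i j k l. a i k * a j k"] 5 by simp
  have 7: "quad V u (\<lambda>i j k l. a i l * a j k) = quad V u (\<lambda>i j k l. a i k * a j l)"
    using sr[of "\<lambda>i j k l. a i k * a j l"] by simp
  have 8: "quad V u (\<lambda>i j k l. a i k * a i l * a j l) = quad V u (\<lambda>i j k l. a i k * a i l * a j k)"
    using sr[of "\<lambda>i j k l. a i k * a i l * a j k"] by (simp add: ac_simps)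
  have 9: "quad V u (\<lambda>i j k l. a i k * a j k * a j l) = quad V u (\<lambda>i j k l. a i k * a i l * a j k)"
    using sl[of "\<lambda>i j k l. a i k * a i l * a j k"] by (simp add: ac_simps)
  have 10: "quad V u (\<lambda>i j k l. a i l * a j k * a j l) = quad V u (\<lambda>i j k l. a i k * a i l * a j k)"
    using sl[of "\<lambda>i j k l. a i k * a i l * a j l"] 8 by (simp add: ac_simps)
  have e: "(\<lambda>i j k l. (1 + a i k) * (1 + a i l) * (1 + a j k) * (1 + a j l)) =
    (\<lambda>i j k l. 1 + (a i k + (a i l + (a j k + (a j l + (a i k * a i l + (a j k * a j l + (a i k * a j k
     + (a i l * a j l + (a i k * a j l + (a i l * a j k + (a i k * a i l * a j k + (a i k * a i l * a j l
     + (a i k * a j k * a j l + (a i l * a j k * a j l + a i k * a i l * a j k * a j l)))))))))))))))"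
    by (intro ext) (simp add: algebra_simps)
  show ?thesis unfolding e quad_add 1 2 3 4 5 6 7 8 9 10 by simp
qed

lemma quad_one: "quad V u (\<lambda>i j k l. 1) = (\<Sum>i\<in>V. \<Sum>j\<in>V. u i j)\<^sup>2"
  unfolding power2_eq_square quad_def by (simp add: sum_distrib_left sum_distrib_right) (simp only: mult.commute)

section \<open>Character forms bounded by the operator norm\<close>

locale op_bounded =
  fixes V :: "nat set" and a :: "nat \<Rightarrow> nat \<Rightarrow> real" and lam :: real
  assumes fin [simp]: "finite V"
    and sym: "a i j = a j i"
    and abs_le: "\<bar>a i j\<bar> \<le> 1"
    and lam_nonneg: "0 \<le> lam"
    and op: "(\<Sum>i\<in>V. (\<Sum>j\<in>V. a i j * y j)\<^sup>2) \<le> lam\<^sup>2 * (\<Sum>j\<in>V. (y j)\<^sup>2)"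
begin

lemma sq_le_1: "(a i j)\<^sup>2 \<le> 1"
  using abs_le[of i j] by (simp add: abs_square_le_1)

lemma op_bilin: "\<bar>\<Sum>i\<in>V. \<Sum>j\<in>V. x i * a i j * y j\<bar> \<le> lam * (sqrt (\<Sum>i\<in>V. (x i)\<^sup>2) * sqrt (\<Sum>j\<in>V. (y j)\<^sup>2))"
proof -
  have "(\<Sum>i\<in>V. \<Sum>j\<in>V. x i * a i j * y j) = (\<Sum>i\<in>V. x i * (\<Sum>j\<in>V. a i j * y j))"
    by (simp add: sum_distrib_left mult.assoc)
  also have "\<bar>\<dots>\<bar> \<le> sqrt (\<Sum>i\<in>V. (x i)\<^sup>2) * sqrt (\<Sum>i\<in>V. (\<Sum>j\<in>V. a i j * y j)\<^sup>2)"
    by (rule abs_sum_mult_le)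
  also have "\<dots> \<le> sqrt (\<Sum>i\<in>V. (x i)\<^sup>2) * sqrt (lam\<^sup>2 * (\<Sum>j\<in>V. (y j)\<^sup>2))"
    by (intro mult_left_mono real_sqrt_le_mono op) (auto intro: sum_nonneg)
  finally show ?thesis using lam_nonneg by (simp add: real_sqrt_mult mult_ac)
qed

lemma frob2_mult_right: "frob2 V (\<lambda>i k. \<Sum>j\<in>V. u i j * a j k) \<le> lam\<^sup>2 * frob2 V u"
proof -
  have "frob2 V (\<lambda>i k. \<Sum>j\<in>V. u i j * a j k) = (\<Sum>i\<in>V. \<Sum>k\<in>V. (\<Sum>j\<in>V. a k j * u i j)\<^sup>2)"
    unfolding frob2_def by (subst sym) (simp add: mult.commute)
  also have "\<dots> \<le> (\<Sum>i\<in>V. lam\<^sup>2 * (\<Sum>j\<in>V. (u i j)\<^sup>2))"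
    by (intro sum_mono op)
  finally show ?thesis by (simp add: frob2_def sum_distrib_left)
qed

lemma frob2_transpose: "frob2 V (\<lambda>i j. u j i) = frob2 V u"
  unfolding frob2_def by (rule sum.swap)

lemma frob2_conj: "frob2 V (\<lambda>i j. \<Sum>k\<in>V. \<Sum>l\<in>V. a i k * u k l * a l j) \<le> lam ^ 4 * frob2 V u"
proof -
  define w where "w = (\<lambda>i k. \<Sum>j\<in>V. u j i * a j k)"
  have "(\<Sum>k\<in>V. \<Sum>l\<in>V. a i k * u k l * a l j) = (\<Sum>l\<in>V. w l i * a l j)" for i j
    unfolding w_def by (subst sum.swap) (simp add: sum_distrib_right sum_distrib_left sym[of i] mult_ac)
  hence "frob2 V (\<lambda>i j. \<Sum>k\<in>V. \<Sum>l\<in>V. a i k * u k l * a l j) = frob2 V (\<lambda>i j. \<Sum>l\<in>V. w l i * a l j)"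
    by simp
  also have "\<dots> \<le> lam\<^sup>2 * frob2 V (\<lambda>i l. w l i)"
    by (rule frob2_mult_right)
  also have "frob2 V (\<lambda>i l. w l i) = frob2 V w" by (rule frob2_transpose)
  also have "frob2 V w \<le> lam\<^sup>2 * frob2 V (\<lambda>i j. u j i)"
    unfolding w_def by (rule frob2_mult_right)
  also have "frob2 V (\<lambda>i j. u j i) = frob2 V u" by (rule frob2_transpose)
  also have "lam\<^sup>2 * (lam\<^sup>2 * frob2 V u) = lam ^ 4 * frob2 V u" by (simp add: power4_eq_xxxx power2_eq_square)
  finally show ?thesis by (simp add: mult_left_mono)
qed

text \<open>The inner sum is a diagonal entry of the matrix product \<open>a u a\<close>, and
  dropping the off-diagonal entries only decreases the Frobenius norm.\<close>

lemma diag_conj: "(\<Sum>i\<in>V. (\<Sum>k\<in>V. \<Sum>l\<in>V. a i k * a i l * u k l)\<^sup>2) \<le> lam ^ 4 * frob2 V u"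
proof -
  let ?c = "\<lambda>i j. \<Sum>k\<in>V. \<Sum>l\<in>V. a i k * u k l * a l j"
  have "(\<Sum>i\<in>V. (\<Sum>k\<in>V. \<Sum>l\<in>V. a i k * a i l * u k l)\<^sup>2) = (\<Sum>i\<in>V. (?c i i)\<^sup>2)"
    by (intro sum.cong refl) (simp add: sym mult_ac)
  also have "\<dots> \<le> (\<Sum>i\<in>V. \<Sum>j\<in>V. (?c i j)\<^sup>2)"
    by (intro sum_mono member_le_sum) auto
  also have "\<dots> \<le> lam ^ 4 * frob2 V u"
    using frob2_conj unfolding frob2_def .
  finally show ?thesis .
qed

lemma sqrt_diag_conj: "sqrt (\<Sum>i\<in>V. (\<Sum>k\<in>V. \<Sum>l\<in>V. a i k * a i l * u k l)\<^sup>2) \<le> lam\<^sup>2 * sqrt (frob2 V u)"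
proof -
  have "sqrt (\<Sum>i\<in>V. (\<Sum>k\<in>V. \<Sum>l\<in>V. a i k * a i l * u k l)\<^sup>2) \<le> sqrt ((lam\<^sup>2)\<^sup>2 * frob2 V u)"
    using diag_conj[of u] by (intro real_sqrt_le_mono) simp
  also have "\<dots> = lam\<^sup>2 * sqrt (frob2 V u)"
    unfolding real_sqrt_mult by (subst real_sqrt_abs) simp
  finally show ?thesis .
qed

text \<open>The row sums stay in the bound instead of being estimated by
  \<open>card V * frob2 V u\<close>, because they admit a much better estimate once summed over the
  sign conjugations.\<close>

lemma quad_edge: "\<bar>quad V u (\<lambda>i j k l. a i k)\<bar> \<le> lam * (\<Sum>i\<in>V. (\<Sum>j\<in>V. u i j)\<^sup>2)"
proof -
  let ?r = "\<lambda>i. \<Sum>j\<in>V. u i j"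
  have "quad V u (\<lambda>i j k l. a i k) = (\<Sum>i\<in>V. \<Sum>k\<in>V. ?r i * a i k * ?r k)"
    unfolding quad_def
  proof (rule sum.cong[OF refl])
    fix i
    have "(\<Sum>j\<in>V. \<Sum>k\<in>V. \<Sum>l\<in>V. u i j * u k l * a i k) = (\<Sum>k\<in>V. \<Sum>j\<in>V. \<Sum>l\<in>V. u i j * u k l * a i k)"
      by (rule sum.swap)
    also have "\<dots> = (\<Sum>k\<in>V. ?r i * a i k * ?r k)"
      by (simp add: sum_distrib_left sum_distrib_right mult_ac)
    finally show "(\<Sum>j\<in>V. \<Sum>k\<in>V. \<Sum>l\<in>V. u i j * u k l * a i k) = (\<Sum>k\<in>V. ?r i * a i k * ?r k)" .
  qed
  also have "\<bar>\<dots>\<bar> \<le> lam * (sqrt (\<Sum>i\<in>V. (?r i)\<^sup>2) * sqrt (\<Sum>i\<in>V. (?r i)\<^sup>2))"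
    by (rule op_bilin)
  finally show ?thesis by (simp add: sum_nonneg)
qed

lemma quad_star: "\<bar>quad V u (\<lambda>i j k l. a i k * a i l)\<bar>
    \<le> sqrt (\<Sum>i\<in>V. (\<Sum>j\<in>V. u i j)\<^sup>2) * (lam\<^sup>2 * sqrt (frob2 V u))"
proof -
  let ?d = "\<lambda>i. \<Sum>k\<in>V. \<Sum>l\<in>V. a i k * a i l * u k l"
  have "quad V u (\<lambda>i j k l. a i k * a i l) = (\<Sum>i\<in>V. (\<Sum>j\<in>V. u i j) * ?d i)"
    unfolding quad_def by (simp add: sum_distrib_right) (simp add: sum_distrib_left mult_ac)
  also have "\<bar>\<dots>\<bar> \<le> sqrt (\<Sum>i\<in>V. (\<Sum>j\<in>V. u i j)\<^sup>2) * sqrt (\<Sum>i\<in>V. (?d i)\<^sup>2)"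
    by (rule abs_sum_mult_le)
  also have "\<dots> \<le> sqrt (\<Sum>i\<in>V. (\<Sum>j\<in>V. u i j)\<^sup>2) * (lam\<^sup>2 * sqrt (frob2 V u))"
    by (intro mult_left_mono sqrt_diag_conj) (auto intro: sum_nonneg)
  finally show ?thesis .
qed

lemma quad_matching: "\<bar>quad V u (\<lambda>i j k l. a i k * a j l)\<bar> \<le> lam\<^sup>2 * frob2 V u"
proof -
  let ?c = "\<lambda>i j. \<Sum>k\<in>V. \<Sum>l\<in>V. a i k * u k l * a l j"
  have "quad V u (\<lambda>i j k l. a i k * a j l) = (\<Sum>i\<in>V. \<Sum>j\<in>V. u i j * ?c i j)"
    unfolding quad_def by (simp add: sum_distrib_left sym mult_ac)
  also have "\<bar>\<dots>\<bar> \<le> sqrt (frob2 V u) * sqrt (frob2 V ?c)"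
    by (rule abs_sum2_mult_le)
  also have "\<dots> \<le> sqrt (frob2 V u) * sqrt ((lam\<^sup>2)\<^sup>2 * frob2 V u)"
    using frob2_conj[of u] by (intro mult_left_mono real_sqrt_le_mono) auto
  also have "\<dots> = lam\<^sup>2 * (sqrt (frob2 V u) * sqrt (frob2 V u))"
    unfolding real_sqrt_mult by (subst real_sqrt_abs) simp
  finally show ?thesis by simp
qed

text \<open>Summing out \<open>j\<close> and \<open>l\<close> gives the entries
  \<open>(i, k)\<close> and \<open>(k, i)\<close> of \<open>u a\<close>. The remaining sign
  \<open>a i k\<close> acts entrywise and cannot increase the Frobenius norm.\<close>

lemma quad_path: "\<bar>quad V u (\<lambda>i j k l. a i k * a i l * a j k)\<bar> \<le> lam\<^sup>2 * frob2 V u"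
proof -
  let ?c = "\<lambda>i k. \<Sum>j\<in>V. u i j * a j k"
  have "quad V u (\<lambda>i j k l. a i k * a i l * a j k) = (\<Sum>i\<in>V. \<Sum>k\<in>V. (a i k * ?c i k) * ?c k i)"
    unfolding quad_def
  proof (rule sum.cong[OF refl])
    fix i
    have "(\<Sum>j\<in>V. \<Sum>k\<in>V. \<Sum>l\<in>V. u i j * u k l * (a i k * a i l * a j k))
      = (\<Sum>k\<in>V. \<Sum>j\<in>V. \<Sum>l\<in>V. u i j * u k l * (a i k * a i l * a j k))"
      by (rule sum.swap)
    also have "\<dots> = (\<Sum>k\<in>V. (a i k * ?c i k) * ?c k i)"
      by (simp add: sum_distrib_left sum_distrib_right sym mult_ac)
    finally show "(\<Sum>j\<in>V. \<Sum>k\<in>V. \<Sum>l\<in>V. u i j * u k l * (a i k * a i l * a j k)) = (\<Sum>k\<in>V. (a i k * ?c i k) * ?c k i)" .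
  qed
  also have "\<bar>\<dots>\<bar> \<le> sqrt (frob2 V (\<lambda>i k. a i k * ?c i k)) * sqrt (frob2 V (\<lambda>i k. ?c k i))"
    by (rule abs_sum2_mult_le)
  also have "\<dots> \<le> sqrt (lam\<^sup>2 * frob2 V u) * sqrt (lam\<^sup>2 * frob2 V u)"
  proof (intro mult_mono real_sqrt_le_mono)
    have "frob2 V (\<lambda>i k. a i k * ?c i k) \<le> frob2 V ?c"
      unfolding frob2_def by (intro sum_mono) (simp add: power_mult_distrib mult_left_le_one_le sq_le_1)
    also have "\<dots> \<le> lam\<^sup>2 * frob2 V u" by (rule frob2_mult_right)
    finally show "frob2 V (\<lambda>i k. a i k * ?c i k) \<le> lam\<^sup>2 * frob2 V u" .
    show "frob2 V (\<lambda>i k. ?c k i) \<le> lam\<^sup>2 * frob2 V u"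
      unfolding frob2_transpose[of ?c] by (rule frob2_mult_right)
  qed auto
  finally show ?thesis using lam_nonneg by simp
qed

lemma frob2_sandwich: "frob2 V (\<lambda>i j. a x i * u i j * a x j) \<le> frob2 V u"
proof -
  have "(a x i * u i j * a x j)\<^sup>2 \<le> (u i j)\<^sup>2" for i j
  proof -
    have "(a x i)\<^sup>2 * (a x j)\<^sup>2 \<le> 1" by (intro mult_le_one sq_le_1) auto
    thus ?thesis using mult_left_le_one_le[of "(u i j)\<^sup>2" "(a x i)\<^sup>2 * (a x j)\<^sup>2"]
      by (simp add: power_mult_distrib mult_ac)
  qed
  thus ?thesis unfolding frob2_def by (intro sum_mono)
qed

text \<open>For fixed \<open>i\<close> the signs at \<open>i\<close> are absorbed into
  \<open>u\<close>, and what is left is a star at \<open>j\<close>, that is, a diagonal of a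
  conjugate. Adding up the rows costs \<open>sqrt (card V)\<close>: affordable for the unconjugated
  block, but too much if repeated for every conjugation.\<close>

lemma quad_cycle: "\<bar>quad V u (\<lambda>i j k l. a i k * a i l * a j k * a j l)\<bar> \<le> sqrt (card V) * lam\<^sup>2 * frob2 V u"
proof -
  let ?U = "\<lambda>x i j. a x i * u i j * a x j"
  let ?d = "\<lambda>i j. \<Sum>k\<in>V. \<Sum>l\<in>V. a j k * a j l * ?U i k l"
  have "quad V u (\<lambda>i j k l. a i k * a i l * a j k * a j l) = (\<Sum>i\<in>V. \<Sum>j\<in>V. u i j * ?d i j)"
    unfolding quad_def by (simp add: sum_distrib_left mult_ac)
  also have "\<bar>\<dots>\<bar> \<le> (\<Sum>i\<in>V. \<bar>\<Sum>j\<in>V. u i j * ?d i j\<bar>)" by (rule sum_abs)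
  also have "\<dots> \<le> (\<Sum>i\<in>V. sqrt (\<Sum>j\<in>V. (u i j)\<^sup>2) * (lam\<^sup>2 * sqrt (frob2 V u)))"
  proof (rule sum_mono)
    fix i
    have "\<bar>\<Sum>j\<in>V. u i j * ?d i j\<bar> \<le> sqrt (\<Sum>j\<in>V. (u i j)\<^sup>2) * sqrt (\<Sum>j\<in>V. (?d i j)\<^sup>2)"
      by (rule abs_sum_mult_le)
    also have "\<dots> \<le> sqrt (\<Sum>j\<in>V. (u i j)\<^sup>2) * (lam\<^sup>2 * sqrt (frob2 V (?U i)))"
      by (intro mult_left_mono sqrt_diag_conj) (auto intro: sum_nonneg)
    also have "\<dots> \<le> sqrt (\<Sum>j\<in>V. (u i j)\<^sup>2) * (lam\<^sup>2 * sqrt (frob2 V u))"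
      by (intro mult_left_mono real_sqrt_le_mono frob2_sandwich) (auto intro: sum_nonneg)
    finally show "\<bar>\<Sum>j\<in>V. u i j * ?d i j\<bar> \<le> sqrt (\<Sum>j\<in>V. (u i j)\<^sup>2) * (lam\<^sup>2 * sqrt (frob2 V u))" .
  qed
  also have "\<dots> = (\<Sum>i\<in>V. sqrt (\<Sum>j\<in>V. (u i j)\<^sup>2)) * (lam\<^sup>2 * sqrt (frob2 V u))"
    by (simp add: sum_distrib_right)
  also have "\<dots> \<le> (sqrt (card V) * sqrt (frob2 V u)) * (lam\<^sup>2 * sqrt (frob2 V u))"
    unfolding frob2_def by (intro mult_right_mono sum_sqrt_le) (auto intro!: sum_nonneg mult_nonneg_nonneg)
  also have "\<dots> = sqrt (card V) * lam\<^sup>2 * (sqrt (frob2 V u) * sqrt (frob2 V u))" by simp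
  finally show ?thesis by simp
qed

section \<open>Row sums, and the forms summed over all sign conjugations\<close>

lemma sum_rows_sq_le: "(\<Sum>i\<in>V. (\<Sum>j\<in>V. u i j)\<^sup>2) \<le> card V * frob2 V u"
  unfolding frob2_def sum_distrib_left[of _ _ V] using sum_row_sq_le
  by (intro sum_mono) (simp add: sum_distrib_left[symmetric])

text \<open>The row sum conjugated by \<open>x\<close> is \<open>a x i\<close> times the entry
  \<open>(i, x)\<close> of \<open>u a\<close>, so all conjugations together are controlled by one
  Frobenius norm. Bounding each \<open>x\<close> separately would give
  \<open>(card V)\<^sup>2\<close> in place of \<open>lam\<^sup>2\<close>.\<close>

lemma sum_sandwich_rows_sq_le:
  "(\<Sum>x\<in>V. \<Sum>i\<in>V. (\<Sum>j\<in>V. a x i * u i j * a x j)\<^sup>2) \<le> lam\<^sup>2 * frob2 V u"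
proof -
  let ?c = "\<lambda>i x. \<Sum>j\<in>V. u i j * a j x"
  have "(\<Sum>x\<in>V. \<Sum>i\<in>V. (\<Sum>j\<in>V. a x i * u i j * a x j)\<^sup>2) = (\<Sum>x\<in>V. \<Sum>i\<in>V. (a x i)\<^sup>2 * (?c i x)\<^sup>2)"
    by (simp add: sum_distrib_left power_mult_distrib[symmetric] sym mult_ac)
  also have "\<dots> \<le> (\<Sum>x\<in>V. \<Sum>i\<in>V. (?c i x)\<^sup>2)"
    by (intro sum_mono mult_left_le_one_le sq_le_1) auto
  also have "\<dots> = frob2 V ?c" unfolding frob2_def by (rule sum.swap)
  also have "\<dots> \<le> lam\<^sup>2 * frob2 V u" by (rule frob2_mult_right)
  finally show ?thesis .
qed

lemma sum_quad_edge:
  "\<bar>\<Sum>x\<in>V. quad V (\<lambda>i j. a x i * u i j * a x j) (\<lambda>i j k l. a i k)\<bar> \<le> lam ^ 3 * frob2 V u"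
proof -
  have "\<bar>\<Sum>x\<in>V. quad V (\<lambda>i j. a x i * u i j * a x j) (\<lambda>i j k l. a i k)\<bar>
    \<le> (\<Sum>x\<in>V. lam * (\<Sum>i\<in>V. (\<Sum>j\<in>V. a x i * u i j * a x j)\<^sup>2))"
    by (rule order.trans[OF sum_abs]) (intro sum_mono quad_edge)
  also have "\<dots> \<le> lam * (lam\<^sup>2 * frob2 V u)"
    unfolding sum_distrib_left[symmetric] by (intro mult_left_mono sum_sandwich_rows_sq_le lam_nonneg)
  finally show ?thesis by (simp add: power3_eq_cube power2_eq_square)
qed

text \<open>Cauchy-Schwarz over \<open>x\<close> preserves the gain for row sums: the square roots
  of \<open>?R\<close> add up to \<open>sqrt (card V) * lam\<close>, in place of
  \<open>card V * sqrt (card V)\<close>, times the Frobenius norm.\<close>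

lemma sum_quad_star:
  "\<bar>\<Sum>x\<in>V. quad V (\<lambda>i j. a x i * u i j * a x j) (\<lambda>i j k l. a i k * a i l)\<bar> \<le> sqrt (card V) * lam ^ 3 * frob2 V u"
proof -
  let ?R = "\<lambda>x. \<Sum>i\<in>V. (\<Sum>j\<in>V. a x i * u i j * a x j)\<^sup>2"
  have "\<bar>\<Sum>x\<in>V. quad V (\<lambda>i j. a x i * u i j * a x j) (\<lambda>i j k l. a i k * a i l)\<bar>
    \<le> (\<Sum>x\<in>V. sqrt (?R x) * (lam\<^sup>2 * sqrt (frob2 V u)))"
    by (rule order.trans[OF sum_abs], rule sum_mono, rule order.trans[OF quad_star])
      (intro mult_left_mono real_sqrt_le_mono frob2_sandwich; auto intro: sum_nonneg)
  also have "\<dots> = (\<Sum>x\<in>V. sqrt (?R x)) * (lam\<^sup>2 * sqrt (frob2 V u))"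
    by (simp add: sum_distrib_right)
  also have "\<dots> \<le> (sqrt (card V) * sqrt (\<Sum>x\<in>V. ?R x)) * (lam\<^sup>2 * sqrt (frob2 V u))"
    by (intro mult_right_mono sum_sqrt_le) (auto intro!: sum_nonneg mult_nonneg_nonneg)
  also have "\<dots> \<le> (sqrt (card V) * sqrt (lam\<^sup>2 * frob2 V u)) * (lam\<^sup>2 * sqrt (frob2 V u))"
    by (intro mult_right_mono mult_left_mono real_sqrt_le_mono sum_sandwich_rows_sq_le) auto
  also have "\<dots> = sqrt (card V) * lam ^ 3 * (sqrt (frob2 V u) * sqrt (frob2 V u))"
    unfolding real_sqrt_mult real_sqrt_abs using lam_nonneg
    by (simp add: power3_eq_cube power2_eq_square)
  finally show ?thesis by simp
qed

text \<open>No cancellation between different \<open>x\<close> is needed here, nor for paths: with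
  \<open>lam\<close> about \<open>sqrt n\<close>, \<open>card V\<close> copies of
  \<open>lam\<^sup>2\<close> are already of the admissible order \<open>n\<^sup>2\<close>.\<close>

lemma sum_quad_matching:
  "\<bar>\<Sum>x\<in>V. quad V (\<lambda>i j. a x i * u i j * a x j) (\<lambda>i j k l. a i k * a j l)\<bar> \<le> card V * lam\<^sup>2 * frob2 V u"
proof -
  have "\<bar>\<Sum>x\<in>V. quad V (\<lambda>i j. a x i * u i j * a x j) (\<lambda>i j k l. a i k * a j l)\<bar> \<le> (\<Sum>x\<in>V. lam\<^sup>2 * frob2 V u)"
    by (rule order.trans[OF sum_abs], rule sum_mono, rule order.trans[OF quad_matching])
      (intro mult_left_mono frob2_sandwich; simp)
  thus ?thesis by (simp add: mult.assoc)
qed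

lemma sum_quad_path:
  "\<bar>\<Sum>x\<in>V. quad V (\<lambda>i j. a x i * u i j * a x j) (\<lambda>i j k l. a i k * a i l * a j k)\<bar> \<le> card V * lam\<^sup>2 * frob2 V u"
proof -
  have "\<bar>\<Sum>x\<in>V. quad V (\<lambda>i j. a x i * u i j * a x j) (\<lambda>i j k l. a i k * a i l * a j k)\<bar> \<le> (\<Sum>x\<in>V. lam\<^sup>2 * frob2 V u)"
    by (rule order.trans[OF sum_abs], rule sum_mono, rule order.trans[OF quad_path])
      (intro mult_left_mono frob2_sandwich; simp)
  thus ?thesis by (simp add: mult.assoc)
qed

end

section \<open>The 4-cycle term averaged over sign conjugations\<close>

text \<open>\<open>gramB n a i j j' x x'\<close> is the coefficient of \<open>a x i * a x' i\<close> in the inner product of the rows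
  \<open>j\<close> and \<open>j'\<close> of the 4-cycle matrix with vertex \<open>i\<close> fixed; \<open>gramY\<close> is the coefficient of \<open>a i x'\<close> in
  the resulting chaos once the signs \<open>a i x\<close> with \<open>x < x'\<close> are revealed.\<close>

definition gramB :: "nat \<Rightarrow> (nat \<Rightarrow> nat \<Rightarrow> real) \<Rightarrow> nat \<Rightarrow> nat \<Rightarrow> nat \<Rightarrow> nat \<Rightarrow> nat \<Rightarrow> real" where
  "gramB n a i j j' x x' = a x j * a x' j' *
     ((\<Sum>k\<in>{1..n} - {i}. a x k * a x' k * a j k * a j' k)\<^sup>2
      - (\<Sum>k\<in>{1..n} - {i}. (a x k * a x' k * a j k * a j' k)\<^sup>2))"

text \<open>The two orders of a pair are merged so that each \<open>x < x'\<close> occurs once.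
  Degenerate patterns are set to zero because the others involve no edge at \<open>i\<close>:
  relative to the row \<open>i\<close> of signs these coefficients are constants.\<close>

definition gramC :: "nat \<Rightarrow> (nat \<Rightarrow> nat \<Rightarrow> real) \<Rightarrow> nat \<Rightarrow> nat \<Rightarrow> nat \<Rightarrow> nat \<Rightarrow> nat \<Rightarrow> real" where
  "gramC n a i j j' x x' =
     (if distinct [i, j, j', x, x'] then gramB n a i j j' x x' + gramB n a i j j' x' x else 0)"

definition gramY :: "nat \<Rightarrow> (nat \<Rightarrow> nat \<Rightarrow> real) \<Rightarrow> nat \<Rightarrow> nat \<Rightarrow> nat \<Rightarrow> nat \<Rightarrow> real" where
  "gramY n a i j j' x' = (\<Sum>x\<in>{1..n} - {i}. a i x * (if x < x' then gramC n a i j j' x x' else 0))"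

text \<open>Size of \<open>gramB\<close> at admissible indices: the 2 pays for up to two vertices
  deleted from a codegree sum, the \<open>n\<close> for the subtracted diagonal.\<close>

definition gram_bound :: "nat \<Rightarrow> real \<Rightarrow> real" where
  "gram_bound n L = (sqrt n * L + 2)\<^sup>2 + n"

lemma sum_sq_minus_sum_diag:
  fixes t :: "'a \<Rightarrow> real"
  assumes "finite S"
  shows "(\<Sum>k\<in>S. \<Sum>l\<in>S. if k = l then 0 else t k * t l) = (\<Sum>k\<in>S. t k)\<^sup>2 - (\<Sum>k\<in>S. (t k)\<^sup>2)"
proof -
  have "(\<Sum>k\<in>S. t k)\<^sup>2 = (\<Sum>k\<in>S. \<Sum>l\<in>S. t k * t l)"
    by (simp add: power2_eq_square sum_product)
  also have "\<dots> = (\<Sum>k\<in>S. \<Sum>l\<in>S. (if k = l then 0 else t k * t l) + (if k = l then (t k)\<^sup>2 else 0))"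
    by (intro sum.cong refl) (simp add: power2_eq_square)
  also have "\<dots> = (\<Sum>k\<in>S. \<Sum>l\<in>S. if k = l then 0 else t k * t l) + (\<Sum>k\<in>S. (t k)\<^sup>2)"
    using assms by (simp add: sum.distrib)
  finally show ?thesis by simp
qed

lemma abs_sum_remove_le:
  fixes f :: "'a \<Rightarrow> real"
  assumes "\<And>k. \<bar>f k\<bar> \<le> 1" "finite S"
  shows "\<bar>\<Sum>k\<in>S - {i}. f k\<bar> \<le> \<bar>\<Sum>k\<in>S. f k\<bar> + 1"
proof (cases "i \<in> S")
  case True
  hence "(\<Sum>k\<in>S - {i}. f k) = (\<Sum>k\<in>S. f k) - f i"
    using assms(2) by (simp add: sum_diff1)
  thus ?thesis using assms(1)[of i] by linarith
qed simp

lemma sum2_remove: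
  fixes f :: "'a \<Rightarrow> 'a \<Rightarrow> real"
  assumes "finite S" "\<And>l. f i l = 0" "\<And>k. f k i = 0"
  shows "(\<Sum>k\<in>S. \<Sum>l\<in>S. f k l) = (\<Sum>k\<in>S - {i}. \<Sum>l\<in>S - {i}. f k l)"
proof -
  have "(\<Sum>k\<in>S. \<Sum>l\<in>S. f k l) = (\<Sum>k\<in>S - {i}. \<Sum>l\<in>S. f k l)"
    using assms by (intro sum.mono_neutral_right) auto
  also have "\<dots> = (\<Sum>k\<in>S - {i}. \<Sum>l\<in>S - {i}. f k l)"
    using assms by (intro sum.cong refl sum.mono_neutral_right) auto
  finally show ?thesis .
qed

lemma sum_pairs_ordered:
  fixes f :: "nat \<Rightarrow> nat \<Rightarrow> real"
  assumes "\<And>x. x \<in> S \<Longrightarrow> f x x = 0"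
  shows "(\<Sum>x\<in>S. \<Sum>x'\<in>S. f x x') = (\<Sum>x'\<in>S. \<Sum>x\<in>S. if x < x' then f x x' + f x' x else 0)"
proof -
  have "(\<Sum>x\<in>S. \<Sum>x'\<in>S. f x x') = (\<Sum>x\<in>S. \<Sum>x'\<in>S. (if x < x' then f x x' else 0) + (if x' < x then f x x' else 0))"
  proof (rule sum.cong[OF refl], rule sum.cong[OF refl])
    fix x x' assume "x \<in> S"
    thus "f x x' = (if x < x' then f x x' else 0) + (if x' < x then f x x' else 0)"
      using assms[of x] by (cases x x' rule: linorder_cases) auto
  qed
  also have "\<dots> = (\<Sum>x\<in>S. \<Sum>x'\<in>S. if x < x' then f x x' else 0) + (\<Sum>x\<in>S. \<Sum>x'\<in>S. if x' < x then f x x' else 0)"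
    by (simp add: sum.distrib)
  also have "(\<Sum>x\<in>S. \<Sum>x'\<in>S. if x < x' then f x x' else 0) = (\<Sum>x'\<in>S. \<Sum>x\<in>S. if x < x' then f x x' else 0)"
    by (rule sum.swap)
  also have "(\<Sum>x'\<in>S. \<Sum>x\<in>S. if x < x' then f x x' else 0) + (\<Sum>x\<in>S. \<Sum>x'\<in>S. if x' < x then f x x' else 0)
    = (\<Sum>x'\<in>S. \<Sum>x\<in>S. (if x < x' then f x x' else 0) + (if x < x' then f x' x else 0))"
    by (simp add: sum.distrib)
  also have "\<dots> = (\<Sum>x'\<in>S. \<Sum>x\<in>S. if x < x' then f x x' + f x' x else 0)"
    by (intro sum.cong refl) simp
  finally show ?thesis .
qed

text \<open>Everything the conjugated 4-cycle estimate uses about the random graph.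
  \<open>chaos1\<close> and \<open>chaos2\<close> are implications because the tail bounds speak of
  the event that the square sum is small; their premises follow deterministically from the codegree
  bounds and, for \<open>chaos2\<close>, from \<open>chaos1\<close>.\<close>

locale quasirandom =
  fixes n :: nat and a :: "nat \<Rightarrow> nat \<Rightarrow> real" and L :: real
  assumes sym: "a i j = a j i"
    and zero: "a i i = 0"
    and sq: "i \<noteq> j \<Longrightarrow> (a i j)\<^sup>2 = 1"
    and L_nonneg: "0 \<le> L"
    and codeg2: "p \<in> {1..n} \<Longrightarrow> q \<in> {1..n} \<Longrightarrow> p \<noteq> q \<Longrightarrow> \<bar>\<Sum>k\<in>{1..n}. a p k * a q k\<bar> \<le> sqrt n * L"
    and codeg4: "{p, q, r, s} \<subseteq> {1..n} \<Longrightarrow> distinct [p, q, r, s] \<Longrightarrow>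
      \<bar>\<Sum>k\<in>{1..n}. a p k * a q k * a r k * a s k\<bar> \<le> sqrt n * L"
    and chaos1: "{i, j, j', x'} \<subseteq> {1..n} \<Longrightarrow>
      (\<Sum>x\<in>{1..n} - {i}. (if x < x' then gramC n a i j j' x x' else 0)\<^sup>2) \<le> n * (2 * gram_bound n L)\<^sup>2 \<Longrightarrow>
      \<bar>gramY n a i j j' x'\<bar> \<le> L * sqrt (n * (2 * gram_bound n L)\<^sup>2)"
    and chaos2: "{i, j, j'} \<subseteq> {1..n} \<Longrightarrow>
      (\<Sum>x\<in>{1..n} - {i}. (gramY n a i j j' x)\<^sup>2) \<le> n * (L\<^sup>2 * (n * (2 * gram_bound n L)\<^sup>2)) \<Longrightarrow>
      \<bar>\<Sum>x\<in>{1..n} - {i}. a i x * gramY n a i j j' x\<bar> \<le> L * sqrt (n * (L\<^sup>2 * (n * (2 * gram_bound n L)\<^sup>2)))"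
begin

abbreviation "V \<equiv> {1..n}"
abbreviation "b \<equiv> gram_bound n L"
abbreviation "tau \<equiv> sqrt n * L"

lemma sq_le_1: "(a i j)\<^sup>2 \<le> 1"
  by (cases "i = j") (auto simp: zero sq)

lemma abs_le: "\<bar>a i j\<bar> \<le> 1"
  using sq_le_1[of i j] by (simp add: abs_square_le_1)

lemma abs4_le: "\<bar>a p q * a r s * a t u * a v w\<bar> \<le> 1"
  unfolding abs_mult by (intro mult_le_one abs_le) auto

lemma tau_nonneg: "0 \<le> tau" using L_nonneg by simp

lemma b_ge: "n \<le> b" "0 \<le> b" by (auto simp: gram_bound_def)

lemma abs_gramB_le:
  assumes "\<bar>\<Sum>k\<in>V - {i}. a x k * a x' k * a j k * a j' k\<bar> \<le> c" "c\<^sup>2 \<le> d" "real n \<le> d"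
  shows "\<bar>gramB n a i j j' x x'\<bar> \<le> d"
proof -
  let ?t = "\<lambda>k. a x k * a x' k * a j k * a j' k"
  have "(\<Sum>k\<in>V - {i}. ?t k)\<^sup>2 \<le> c\<^sup>2"
    using assms(1) by (rule abs_le_square_iff[THEN iffD1, OF order.trans]) simp
  moreover have "(\<Sum>k\<in>V - {i}. (?t k)\<^sup>2) \<le> (\<Sum>k\<in>V - {i}. 1)"
    by (intro sum_mono) (use abs4_le in \<open>simp add: abs_square_le_1\<close>)
  moreover have "(\<Sum>k\<in>V - {i}. 1) \<le> real n"
    using card_mono[of V "V - {i}"] by simp
  moreover have "0 \<le> (\<Sum>k\<in>V - {i}. (?t k)\<^sup>2)" by (intro sum_nonneg) auto
  ultimately have "\<bar>(\<Sum>k\<in>V - {i}. ?t k)\<^sup>2 - (\<Sum>k\<in>V - {i}. (?t k)\<^sup>2)\<bar> \<le> d"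
    using assms(2,3) zero_le_power2[of "\<Sum>k\<in>V - {i}. ?t k"] by linarith
  moreover have "\<bar>a x j * a x' j'\<bar> \<le> 1"
    unfolding abs_mult by (intro mult_le_one abs_le) auto
  ultimately have "\<bar>a x j * a x' j'\<bar> * \<bar>(\<Sum>k\<in>V - {i}. ?t k)\<^sup>2 - (\<Sum>k\<in>V - {i}. (?t k)\<^sup>2)\<bar> \<le> 1 * d"
    by (intro mult_mono) auto
  thus ?thesis unfolding gramB_def by (simp add: abs_mult)
qed

text \<open>The weight is 1 except at \<open>k = s\<close>, where it vanishes, so it merely deletes
  one more term of modulus at most 1.\<close>

lemma abs_sum_sq_weight_le:
  assumes "p \<in> V" "q \<in> V" "p \<noteq> q" "s \<in> V"
  shows "\<bar>\<Sum>k\<in>V - {i}. (a s k)\<^sup>2 * (a p k * a q k)\<bar> \<le> tau + 2"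
proof -
  have pq: "\<bar>a p k * a q k\<bar> \<le> 1" for k
    unfolding abs_mult by (intro mult_le_one abs_le) auto
  have "(\<Sum>k\<in>V - {i}. (a s k)\<^sup>2 * (a p k * a q k)) = (\<Sum>k\<in>V - {i} - {s}. (a s k)\<^sup>2 * (a p k * a q k))"
    by (intro sum.mono_neutral_right) (auto simp: zero)
  also have "\<dots> = (\<Sum>k\<in>V - {i} - {s}. a p k * a q k)"
    by (intro sum.cong refl) (simp add: sq)
  also have "\<bar>\<dots>\<bar> \<le> \<bar>\<Sum>k\<in>V - {i}. a p k * a q k\<bar> + 1"
    by (rule abs_sum_remove_le) (auto simp: pq)
  also have "\<dots> \<le> \<bar>\<Sum>k\<in>V. a p k * a q k\<bar> + 1 + 1"
    using abs_sum_remove_le[of "\<lambda>k. a p k * a q k" V i, OF pq] by simp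
  also have "\<dots> \<le> tau + 2" using codeg2[OF assms(1-3)] by simp
  finally show ?thesis .
qed

text \<open>The prefactor vanishes for \<open>x = j\<close> and for \<open>x' = j'\<close>, so these
  patterns are left out. Each other single coincidence creates a squared factor and reduces the
  fourfold codegree to a twofold one. Only \<open>x = j'\<close> together with \<open>x' = j\<close>
  makes every summand a square and destroys the cancellation.\<close>

lemma gramB_le:
  assumes V: "{x, x', j, j'} \<subseteq> V" and ne: "j \<noteq> j'" "x \<noteq> j" "x' \<noteq> j'" "\<not> (x = j' \<and> x' = j)"
  shows "\<bar>gramB n a i j j' x x'\<bar> \<le> b"
proof (rule abs_gramB_le)
  have mem: "x \<in> V" "x' \<in> V" "j \<in> V" "j' \<in> V" using V by auto
  consider "x = x'" | "x \<noteq> x'" "x = j'" | "x \<noteq> x'" "x' = j" | "distinct [x, x', j, j']"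
    using ne by fastforce
  thus "\<bar>\<Sum>k\<in>V - {i}. a x k * a x' k * a j k * a j' k\<bar> \<le> tau + 2"
  proof cases
    case 1
    have eq: "(\<Sum>k\<in>V - {i}. a x k * a x' k * a j k * a j' k) = (\<Sum>k\<in>V - {i}. (a x k)\<^sup>2 * (a j k * a j' k))"
      by (rule sum.cong[OF refl]) (simp add: 1 power2_eq_square)
    show ?thesis unfolding eq
      by (rule abs_sum_sq_weight_le) (use mem ne 1 in simp_all)
  next
    case 2
    have eq: "(\<Sum>k\<in>V - {i}. a x k * a x' k * a j k * a j' k) = (\<Sum>k\<in>V - {i}. (a j' k)\<^sup>2 * (a x' k * a j k))"
      by (rule sum.cong[OF refl]) (simp add: 2 power2_eq_square)
    show ?thesis unfolding eq
      by (rule abs_sum_sq_weight_le) (use mem ne 2 in simp_all)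
  next
    case 3
    have eq: "(\<Sum>k\<in>V - {i}. a x k * a x' k * a j k * a j' k) = (\<Sum>k\<in>V - {i}. (a j k)\<^sup>2 * (a x k * a j' k))"
      by (rule sum.cong[OF refl]) (simp add: 3 power2_eq_square)
    show ?thesis unfolding eq
      by (rule abs_sum_sq_weight_le) (use mem ne 3 in simp_all)
  next
    case 4
    have "\<bar>\<Sum>k\<in>V - {i}. a x k * a x' k * a j k * a j' k\<bar> \<le> \<bar>\<Sum>k\<in>V. a x k * a x' k * a j k * a j' k\<bar> + 1"
      by (rule abs_sum_remove_le) (auto simp: abs4_le)
    also have "\<dots> \<le> tau + 2" using codeg4[OF V 4] by simp
    finally show ?thesis .
  qed
qed (auto simp: gram_bound_def)

lemma gramB_le_sq:
  assumes "{x, x', j, j'} \<subseteq> V"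
  shows "\<bar>gramB n a i j j' x x'\<bar> \<le> (real n)\<^sup>2"
proof (rule abs_gramB_le)
  have "\<bar>\<Sum>k\<in>V - {i}. a x k * a x' k * a j k * a j' k\<bar> \<le> (\<Sum>k\<in>V - {i}. 1)"
    by (rule order.trans[OF sum_abs]) (intro sum_mono abs4_le)
  also have "\<dots> \<le> real n" using card_mono[of V "V - {i}"] by simp
  finally show "\<bar>\<Sum>k\<in>V - {i}. a x k * a x' k * a j k * a j' k\<bar> \<le> real n" .
  show "real n \<le> (real n)\<^sup>2" using assms by (simp add: power2_eq_square)
qed simp

lemma gramC_le:
  assumes "{i, j, j', x, x'} \<subseteq> V"
  shows "\<bar>gramC n a i j j' x x'\<bar> \<le> 2 * b"
proof (cases "distinct [i, j, j', x, x']")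
  case True
  hence "\<bar>gramB n a i j j' x x'\<bar> \<le> b" "\<bar>gramB n a i j j' x' x\<bar> \<le> b"
    using assms by (auto intro!: gramB_le)
  thus ?thesis using True unfolding gramC_def by simp
next
  case False
  show ?thesis unfolding gramC_def if_not_P[OF False] using b_ge by simp
qed

text \<open>The chaos is treated as a linear sum of linear sums: \<open>chaos1\<close> bounds each
  inner sum \<open>gramY\<close>, which supplies the square sum demanded by \<open>chaos2\<close>.
  Each layer contributes a factor \<open>sqrt n * L\<close>, and \<open>2 * b\<close> bounds the
  coefficients.\<close>

lemma chaos_bound:
  assumes "{i, j, j'} \<subseteq> V"
  shows "\<bar>\<Sum>x\<in>V - {i}. a i x * gramY n a i j j' x\<bar> \<le> 2 * L\<^sup>2 * n * b"
proof -
  have Y: "(gramY n a i j j' x')\<^sup>2 \<le> L\<^sup>2 * (n * (2 * b)\<^sup>2)" if x': "x' \<in> V" for x'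
  proof -
    have "(\<Sum>x\<in>V - {i}. (if x < x' then gramC n a i j j' x x' else 0)\<^sup>2) \<le> (\<Sum>x\<in>V - {i}. (2 * b)\<^sup>2)"
    proof (rule sum_mono)
      fix x assume "x \<in> V - {i}"
      hence "\<bar>if x < x' then gramC n a i j j' x x' else 0\<bar> \<le> \<bar>2 * b\<bar>"
        using gramC_le[of i j j' x x'] assms x' b_ge by auto
      thus "(if x < x' then gramC n a i j j' x x' else 0)\<^sup>2 \<le> (2 * b)\<^sup>2"
        by (rule abs_le_square_iff[THEN iffD1])
    qed
    also have "\<dots> \<le> n * (2 * b)\<^sup>2"
      using card_mono[of V "V - {i}"] by (simp add: mult_right_mono)
    finally have "\<bar>gramY n a i j j' x'\<bar> \<le> L * sqrt (n * (2 * b)\<^sup>2)"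
      using assms x' by (intro chaos1) auto
    hence "\<bar>gramY n a i j j' x'\<bar> \<le> \<bar>L * sqrt (n * (2 * b)\<^sup>2)\<bar>" by linarith
    hence "(gramY n a i j j' x')\<^sup>2 \<le> (L * sqrt (n * (2 * b)\<^sup>2))\<^sup>2"
      by (rule abs_le_square_iff[THEN iffD1])
    thus ?thesis by (simp add: power_mult_distrib)
  qed
  have "(\<Sum>x\<in>V - {i}. (gramY n a i j j' x)\<^sup>2) \<le> (\<Sum>x\<in>V - {i}. L\<^sup>2 * (n * (2 * b)\<^sup>2))"
    by (intro sum_mono Y) auto
  also have "\<dots> \<le> n * (L\<^sup>2 * (n * (2 * b)\<^sup>2))"
    using card_mono[of V "V - {i}"] by (simp add: mult_right_mono)
  finally have "\<bar>\<Sum>x\<in>V - {i}. a i x * gramY n a i j j' x\<bar> \<le> L * sqrt (n * (L\<^sup>2 * (n * (2 * b)\<^sup>2)))"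
    using assms by (intro chaos2) auto
  also have "n * (L\<^sup>2 * (n * (2 * b)\<^sup>2)) = (n * L * (2 * b))\<^sup>2" by (simp add: power2_eq_square)
  also have "L * sqrt ((n * L * (2 * b))\<^sup>2) = 2 * L\<^sup>2 * n * b"
    using L_nonneg b_ge unfolding real_sqrt_abs by (simp add: power2_eq_square)
  finally show ?thesis .
qed

text \<open>The pairs with all indices distinct form the chaos. Of the others, the terms with
  \<open>x = i\<close>, \<open>x' = i\<close>, \<open>x = j\<close> or \<open>x' = j'\<close>
  vanish; the lines \<open>x = x'\<close>, \<open>x = j'\<close> and \<open>x' = j\<close> have
  \<open>n\<close> pairs each, of size at most \<open>b\<close>; and the single pair
  \<open>x = j'\<close>, \<open>x' = j\<close> has only the trivial bound \<open>n\<^sup>2\<close>,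
  which is affordable.\<close>

lemma gram_form_le:
  assumes V: "{i, j, j'} \<subseteq> V" and ne: "distinct [i, j, j']"
  shows "\<bar>\<Sum>x\<in>V. \<Sum>x'\<in>V. a x i * a x' i * gramB n a i j j' x x'\<bar> \<le> (2 * L\<^sup>2 + 3) * n * b + (real n)\<^sup>2"
proof -
  let ?d = "\<lambda>x x'. distinct [i, j, j', x, x']"
  let ?B = "gramB n a i j j'"
  have split: "a x i * a x' i * ?B x x' = a i x * a i x' * (if ?d x x' then ?B x x' else 0)
      + (if ?d x x' then 0 else a i x * a i x' * ?B x x')" for x x'
    by (simp add: sym)
  have main: "(\<Sum>x\<in>V. \<Sum>x'\<in>V. a i x * a i x' * (if ?d x x' then ?B x x' else 0))
    = (\<Sum>x\<in>V - {i}. a i x * gramY n a i j j' x)"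
  proof -
    have "(\<Sum>x\<in>V. \<Sum>x'\<in>V. a i x * a i x' * (if ?d x x' then ?B x x' else 0))
      = (\<Sum>x'\<in>V. \<Sum>x\<in>V. if x < x' then a i x * a i x' * (if ?d x x' then ?B x x' else 0)
          + a i x' * a i x * (if ?d x' x then ?B x' x else 0) else 0)"
      by (rule sum_pairs_ordered) auto
    also have "\<dots> = (\<Sum>x'\<in>V. \<Sum>x\<in>V. a i x' * (a i x * (if x < x' then gramC n a i j j' x x' else 0)))"
      by (intro sum.cong refl) (auto simp: gramC_def algebra_simps)
    also have "\<dots> = (\<Sum>x'\<in>V - {i}. \<Sum>x\<in>V - {i}. a i x' * (a i x * (if x < x' then gramC n a i j j' x x' else 0)))"
      by (rule sum2_remove) (auto simp: zero)
    finally show ?thesis by (simp add: gramY_def sum_distrib_left)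
  qed
  have rest: "\<bar>\<Sum>x\<in>V. \<Sum>x'\<in>V. if ?d x x' then 0 else a i x * a i x' * ?B x x'\<bar> \<le> 3 * n * b + (real n)\<^sup>2"
  proof -
    have "\<bar>\<Sum>x\<in>V. \<Sum>x'\<in>V. if ?d x x' then 0 else a i x * a i x' * ?B x x'\<bar>
      \<le> (\<Sum>x\<in>V. \<Sum>x'\<in>V. \<bar>if ?d x x' then 0 else a i x * a i x' * ?B x x'\<bar>)"
      by (intro order.trans[OF sum_abs] sum_mono sum_abs)
    also have "\<dots> \<le> (\<Sum>x\<in>V. \<Sum>x'\<in>V. (if x = x' then b else 0) + (if x = j' then b else 0) + (if x' = j then b else 0)
        + (if x = j' then if x' = j then (real n)\<^sup>2 else 0 else 0))"
    proof (intro sum_mono)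
      fix x x' assume xV: "x \<in> V" "x' \<in> V"
      define r where "r = (if x = x' then b else 0) + (if x = j' then b else 0) + (if x' = j then b else 0)
        + (if x = j' then if x' = j then (real n)\<^sup>2 else 0 else 0)"
      define q where "q = a i x * a i x' * ?B x x'"
      have r0: "0 \<le> r" using b_ge by (auto simp: r_def)
      have le: "\<bar>q\<bar> \<le> \<bar>?B x x'\<bar>"
        unfolding q_def abs_mult[of "a i x * a i x'"]
        by (rule mult_left_le_one_le) (auto simp: abs_mult intro: mult_le_one abs_le)
      have q: "\<bar>q\<bar> \<le> r" if nd: "\<not> ?d x x'"
      proof -
        consider "x = i \<or> x' = i" | "x = j \<or> x' = j'" | "x = j'" "x' = j"
          | "x = x' \<or> x = j' \<or> x' = j" "x \<noteq> j" "x' \<noteq> j'" "\<not> (x = j' \<and> x' = j)"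
          using ne nd by auto
        thus ?thesis
        proof cases
          case 1
          hence "q = 0" by (auto simp: q_def zero)
          thus ?thesis using r0 by simp
        next
          case 2
          hence "q = 0" by (auto simp: q_def gramB_def zero)
          thus ?thesis using r0 by simp
        next
          case 3
          have "\<bar>?B x x'\<bar> \<le> (real n)\<^sup>2" using V xV by (intro gramB_le_sq) auto
          moreover have "(real n)\<^sup>2 \<le> r" unfolding r_def using 3 b_ge by simp
          ultimately show ?thesis using le by linarith
        next
          case 4
          have "\<bar>?B x x'\<bar> \<le> b" using 4 V xV ne by (intro gramB_le) auto
          moreover have "b \<le> r" unfolding r_def using 4(1) b_ge by auto
          ultimately show ?thesis using le by linarith
        qed
      qed
      have "\<bar>if ?d x x' then 0 else q\<bar> \<le> r"
        using q r0 by (cases "?d x x'") (simp_all only: if_True if_False abs_zero not_False_eq_True simp_thms)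
      thus "\<bar>if ?d x x' then 0 else a i x * a i x' * ?B x x'\<bar> \<le> (if x = x' then b else 0) + (if x = j' then b else 0)
          + (if x' = j then b else 0) + (if x = j' then if x' = j then (real n)\<^sup>2 else 0 else 0)"
        unfolding q_def r_def .
    qed
    also have "\<dots> = n * b + n * b + n * b + (real n)\<^sup>2"
    proof -
      have "(\<Sum>x'\<in>V. if x = j' then b else 0) = (if x = j' then n * b else 0)"
        "(\<Sum>x'\<in>V. if x = j' then if x' = j then (real n)\<^sup>2 else 0 else 0) = (if x = j' then (real n)\<^sup>2 else 0)" for x
        using V by simp_all
      thus ?thesis using V by (simp add: sum.distrib)
    qed
    finally show ?thesis by simp
  qed
  have "(\<Sum>x\<in>V. \<Sum>x'\<in>V. a x i * a x' i * ?B x x') = (\<Sum>x\<in>V - {i}. a i x * gramY n a i j j' x)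
      + (\<Sum>x\<in>V. \<Sum>x'\<in>V. if ?d x x' then 0 else a i x * a i x' * ?B x x')"
    by (simp only: split sum.distrib main)
  also have "\<bar>\<dots>\<bar> \<le> 2 * L\<^sup>2 * n * b + (3 * n * b + (real n)\<^sup>2)"
    by (intro order.trans[OF abs_triangle_ineq] add_mono rest chaos_bound V)
  finally show ?thesis by (simp add: algebra_simps)
qed

text \<open>The edges \<open>i k\<close> and \<open>i l\<close> of the 4-cycle are missing because
  they are moved into a weight on \<open>(k, l)\<close>; that weight vanishes where the entries are
  set to zero. Excluding \<open>k = i\<close> and \<open>l = i\<close> removes the edges at
  \<open>i\<close> from the codegree sums that arise in the Gram matrix.\<close>

definition cyc :: "nat \<Rightarrow> nat \<Rightarrow> nat \<Rightarrow> nat \<Rightarrow> real" where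
  "cyc i j k l = (if k = i \<or> l = i \<or> k = l then 0
     else \<Sum>x\<in>V. a x i * a x j * a x k * a x l * a j k * a j l)"

text \<open>After expanding both copies over \<open>x\<close> and \<open>x'\<close>, the sum over
  \<open>k \<noteq> l\<close> factors as a squared sum minus its diagonal. This is
  \<open>gramB\<close>, so the Gram entry becomes a quadratic form in the signs at
  \<open>i\<close>.\<close>

lemma cyc_gram:
  assumes "{i, j, j'} \<subseteq> V" "distinct [i, j, j']"
  shows "\<bar>\<Sum>k\<in>V. \<Sum>l\<in>V. cyc i j k l * cyc i j' k l\<bar> \<le> (2 * L\<^sup>2 + 3) * n * b + (real n)\<^sup>2"
proof -
  let ?t = "\<lambda>x x' k. a x k * a x' k * a j k * a j' k"
  have "(\<Sum>k\<in>V. \<Sum>l\<in>V. cyc i j k l * cyc i j' k l) = (\<Sum>k\<in>V - {i}. \<Sum>l\<in>V - {i}. cyc i j k l * cyc i j' k l)"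
    by (rule sum2_remove) (auto simp: cyc_def)
  also have "\<dots> = (\<Sum>k\<in>V - {i}. \<Sum>l\<in>V - {i}. \<Sum>x\<in>V. \<Sum>x'\<in>V.
       a x i * a x' i * (a x j * a x' j' * (if k = l then 0 else ?t x x' k * ?t x x' l)))"
  proof (rule sum.cong[OF refl], rule sum.cong[OF refl])
    fix k l assume kl: "k \<in> V - {i}" "l \<in> V - {i}"
    show "cyc i j k l * cyc i j' k l = (\<Sum>x\<in>V. \<Sum>x'\<in>V.
       a x i * a x' i * (a x j * a x' j' * (if k = l then 0 else ?t x x' k * ?t x x' l)))"
    proof (cases "k = l")
      case False
      hence "cyc i j k l * cyc i j' k l = (\<Sum>x\<in>V. a x i * a x j * a x k * a x l * a j k * a j l)
          * (\<Sum>x\<in>V. a x i * a x j' * a x k * a x l * a j' k * a j' l)"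
        using kl by (simp add: cyc_def)
      thus ?thesis using False unfolding sum_product by (simp add: mult_ac)
    qed (simp add: cyc_def)
  qed
  also have "\<dots> = (\<Sum>x\<in>V. \<Sum>x'\<in>V. \<Sum>k\<in>V - {i}. \<Sum>l\<in>V - {i}.
       a x i * a x' i * (a x j * a x' j' * (if k = l then 0 else ?t x x' k * ?t x x' l)))"
    by (rule sum_swap_pairs)
  also have "\<dots> = (\<Sum>x\<in>V. \<Sum>x'\<in>V. a x i * a x' i * gramB n a i j j' x x')"
    unfolding gramB_def by (simp add: sum_distrib_left[symmetric] sum_sq_minus_sum_diag)
  finally show ?thesis using gram_form_le[OF assms] by simp
qed

lemma cyc_sq_le:
  assumes "{i, j, k, l} \<subseteq> V" "i \<noteq> j"
  shows "(cyc i j k l)\<^sup>2 \<le> n * L\<^sup>2"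
proof (cases "distinct [i, j, k, l]")
  case True
  have "cyc i j k l = (\<Sum>x\<in>V. a i x * a j x * a k x * a l x) * (a j k * a j l)"
  proof -
    have "cyc i j k l = (\<Sum>x\<in>V. a x i * a x j * a x k * a x l * a j k * a j l)"
      using True by (simp add: cyc_def)
    also have "\<dots> = (\<Sum>x\<in>V. a i x * a j x * a k x * a l x * (a j k * a j l))"
    proof (rule sum.cong[OF refl])
      fix x
      show "a x i * a x j * a x k * a x l * a j k * a j l = a i x * a j x * a k x * a l x * (a j k * a j l)"
        unfolding sym[of x i] sym[of x j] sym[of x k] sym[of x l] by simp
    qed
    finally show ?thesis by (simp add: sum_distrib_right)
  qed
  hence "(cyc i j k l)\<^sup>2 = (\<Sum>x\<in>V. a i x * a j x * a k x * a l x)\<^sup>2"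
    using True by (simp add: power_mult_distrib sq)
  also have "\<dots> \<le> tau\<^sup>2"
    using codeg4[OF assms(1) True] tau_nonneg by (intro abs_le_square_iff[THEN iffD1]) linarith
  finally show ?thesis by (simp add: power_mult_distrib)
next
  case False
  hence "cyc i j k l = 0" using assms(2) by (auto simp: cyc_def zero)
  thus ?thesis by simp
qed

text \<open>A Gershgorin-type bound for the Gram matrix. A diagonal entry adds
  \<open>n\<^sup>2\<close> squares of size \<open>n * L\<^sup>2\<close>; off-diagonal entries are
  bounded one by one, and passing from the \<open>l\<^sub>1\<close> to the \<open>l\<^sub>2\<close>
  norm of \<open>v\<close> costs a factor \<open>n\<close>. Both parts are \<open>n ^ 3\<close> up
  to logarithms. The condition \<open>v i = 0\<close> removes the row \<open>j = i\<close>, to which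
  the estimates do not apply.\<close>

lemma cyc_comb_le:
  assumes i: "i \<in> V" and v: "v i = 0"
  shows "(\<Sum>k\<in>V. \<Sum>l\<in>V. (\<Sum>j\<in>V. v j * cyc i j k l)\<^sup>2)
    \<le> (real n ^ 3 * L\<^sup>2 + n * ((2 * L\<^sup>2 + 3) * n * b + (real n)\<^sup>2)) * (\<Sum>j\<in>V. (v j)\<^sup>2)"
proof -
  define e1 where "e1 = (2 * L\<^sup>2 + 3) * n * b + (real n)\<^sup>2"
  define e0 where "e0 = real n ^ 3 * L\<^sup>2"
  have e: "0 \<le> e0" "0 \<le> e1" using b_ge by (auto simp: e0_def e1_def)
  let ?E = "\<lambda>j j'. \<Sum>k\<in>V. \<Sum>l\<in>V. cyc i j k l * cyc i j' k l"
  have E0: "\<bar>?E j j\<bar> \<le> e0" if "j \<in> V" "j \<noteq> i" for j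
  proof -
    have "\<bar>?E j j\<bar> = (\<Sum>k\<in>V. \<Sum>l\<in>V. (cyc i j k l)\<^sup>2)"
      unfolding power2_eq_square by (intro abs_of_nonneg sum_nonneg) auto
    also have "\<dots> \<le> (\<Sum>k\<in>V. \<Sum>l\<in>V. n * L\<^sup>2)"
      using that i by (intro sum_mono cyc_sq_le) auto
    finally show ?thesis by (simp add: e0_def power3_eq_cube mult_ac)
  qed
  have "(\<Sum>k\<in>V. \<Sum>l\<in>V. (\<Sum>j\<in>V. v j * cyc i j k l)\<^sup>2)
    = (\<Sum>k\<in>V. \<Sum>l\<in>V. \<Sum>j\<in>V. \<Sum>j'\<in>V. v j * v j' * (cyc i j k l * cyc i j' k l))"
    by (simp add: power2_eq_square sum_product mult_ac)
  also have "\<dots> = (\<Sum>j\<in>V. \<Sum>j'\<in>V. \<Sum>k\<in>V. \<Sum>l\<in>V. v j * v j' * (cyc i j k l * cyc i j' k l))"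
    by (rule sum_swap_pairs)
  also have "\<dots> = (\<Sum>j\<in>V. \<Sum>j'\<in>V. v j * v j' * ?E j j')"
    by (simp add: sum_distrib_left)
  also have "\<dots> \<le> (\<Sum>j\<in>V. \<Sum>j'\<in>V. (if j = j' then e0 * (v j)\<^sup>2 else 0) + e1 * (\<bar>v j\<bar> * \<bar>v j'\<bar>))"
  proof (intro sum_mono)
    fix j j' assume J: "j \<in> V" "j' \<in> V"
    show "v j * v j' * ?E j j' \<le> (if j = j' then e0 * (v j)\<^sup>2 else 0) + e1 * (\<bar>v j\<bar> * \<bar>v j'\<bar>)"
    proof (cases "j = i \<or> j' = i")
      case True thus ?thesis using v e by auto
    next
      case False
      have "v j * v j' * ?E j j' \<le> \<bar>v j * v j' * ?E j j'\<bar>" by simp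
      also have "\<dots> = (\<bar>v j\<bar> * \<bar>v j'\<bar>) * \<bar>?E j j'\<bar>" by (simp add: abs_mult)
      also have "\<dots> \<le> (\<bar>v j\<bar> * \<bar>v j'\<bar>) * ((if j = j' then e0 else 0) + e1)"
      proof (intro mult_left_mono)
        show "\<bar>?E j j'\<bar> \<le> (if j = j' then e0 else 0) + e1"
        proof (cases "j = j'")
          case True thus ?thesis using E0[of j] J False e by auto
        next
          case ne: False
          hence "\<bar>?E j j'\<bar> \<le> e1" unfolding e1_def using J i False by (intro cyc_gram) auto
          thus ?thesis using ne by simp
        qed
      qed simp
      also have "\<dots> = (if j = j' then e0 * (v j)\<^sup>2 else 0) + e1 * (\<bar>v j\<bar> * \<bar>v j'\<bar>)"
        by (auto simp: algebra_simps power2_eq_square)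
      finally show ?thesis .
    qed
  qed
  also have "\<dots> = e0 * (\<Sum>j\<in>V. (v j)\<^sup>2) + e1 * (\<Sum>j\<in>V. \<bar>v j\<bar>)\<^sup>2"
    unfolding power2_eq_square[of "sum _ _"] sum_product by (simp add: sum.distrib sum_distrib_left)
  also have "\<dots> \<le> e0 * (\<Sum>j\<in>V. (v j)\<^sup>2) + e1 * (n * (\<Sum>j\<in>V. (v j)\<^sup>2))"
    using sum_row_sq_le[of "\<lambda>j. \<bar>v j\<bar>" V] e by (intro add_left_mono mult_left_mono) auto
  finally show ?thesis by (simp add: e0_def e1_def algebra_simps)
qed

text \<open>With the sum over \<open>x\<close> carried out inside \<open>cyc\<close>, each row
  \<open>u i\<close> is mapped with norm about \<open>n powr (3/2)\<close>. Adding the rows costs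
  \<open>sqrt n\<close>, for a total of \<open>n\<^sup>2\<close> up to logarithms, whereas
  \<open>quad_cycle\<close> applied for every \<open>x\<close> gives
  \<open>n powr (5/2)\<close>.\<close>

lemma sum_quad_cycle:
  assumes u0: "\<And>i. u i i = 0"
  shows "\<bar>\<Sum>x\<in>V. quad V (\<lambda>i j. a x i * u i j * a x j) (\<lambda>i j k l. a i k * a i l * a j k * a j l)\<bar>
    \<le> sqrt n * sqrt (real n ^ 3 * L\<^sup>2 + n * ((2 * L\<^sup>2 + 3) * n * b + (real n)\<^sup>2)) * frob2 V u"
proof -
  define e where "e = real n ^ 3 * L\<^sup>2 + n * ((2 * L\<^sup>2 + 3) * n * b + (real n)\<^sup>2)"
  have e: "0 \<le> e" using b_ge by (auto simp: e_def)
  let ?w = "\<lambda>i k l. a i k * u k l * a i l"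
  let ?F = "\<lambda>x i j k l. u i j * (?w i k l * (a x i * a x j * a x k * a x l * a j k * a j l))"
  have eq: "(\<Sum>x\<in>V. quad V (\<lambda>i j. a x i * u i j * a x j) (\<lambda>i j k l. a i k * a i l * a j k * a j l))
    = (\<Sum>i\<in>V. \<Sum>k\<in>V. \<Sum>l\<in>V. ?w i k l * (\<Sum>j\<in>V. u i j * cyc i j k l))"
  proof -
    have "(\<Sum>x\<in>V. quad V (\<lambda>i j. a x i * u i j * a x j) (\<lambda>i j k l. a i k * a i l * a j k * a j l))
      = (\<Sum>x\<in>V. \<Sum>i\<in>V. \<Sum>j\<in>V. \<Sum>k\<in>V. \<Sum>l\<in>V. ?F x i j k l)"
      unfolding quad_def by (simp only: mult_ac)
    also have "\<dots> = (\<Sum>i\<in>V. \<Sum>x\<in>V. \<Sum>j\<in>V. \<Sum>k\<in>V. \<Sum>l\<in>V. ?F x i j k l)"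
      by (rule sum.swap)
    also have "\<dots> = (\<Sum>i\<in>V. \<Sum>j\<in>V. \<Sum>x\<in>V. \<Sum>k\<in>V. \<Sum>l\<in>V. ?F x i j k l)"
      by (rule sum.cong[OF refl], rule sum.swap)
    also have "\<dots> = (\<Sum>i\<in>V. \<Sum>j\<in>V. \<Sum>k\<in>V. \<Sum>x\<in>V. \<Sum>l\<in>V. ?F x i j k l)"
      by (rule sum.cong[OF refl], rule sum.cong[OF refl], rule sum.swap)
    also have "\<dots> = (\<Sum>i\<in>V. \<Sum>j\<in>V. \<Sum>k\<in>V. \<Sum>l\<in>V. \<Sum>x\<in>V. ?F x i j k l)"
      by (rule sum.cong[OF refl], rule sum.cong[OF refl], rule sum.cong[OF refl], rule sum.swap)
    also have "\<dots> = (\<Sum>i\<in>V. \<Sum>j\<in>V. \<Sum>k\<in>V. \<Sum>l\<in>V. ?w i k l * (u i j * cyc i j k l))"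
    proof (rule sum.cong[OF refl], rule sum.cong[OF refl], rule sum.cong[OF refl], rule sum.cong[OF refl])
      fix i j k l
      show "(\<Sum>x\<in>V. ?F x i j k l) = ?w i k l * (u i j * cyc i j k l)"
      proof (cases "k = i \<or> l = i \<or> k = l")
        case True
        hence "?w i k l = 0" by (auto simp: zero u0)
        thus ?thesis by (simp only: mult_zero_left mult_zero_right sum.neutral_const)
      next
        case False
        have "(\<Sum>x\<in>V. ?F x i j k l)
          = u i j * (?w i k l * (\<Sum>x\<in>V. a x i * a x j * a x k * a x l * a j k * a j l))"
          by (simp only: sum_distrib_left)
        thus ?thesis unfolding cyc_def if_not_P[OF False] by simp
      qed
    qed
    also have "\<dots> = (\<Sum>i\<in>V. \<Sum>k\<in>V. \<Sum>j\<in>V. \<Sum>l\<in>V. ?w i k l * (u i j * cyc i j k l))"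
      by (rule sum.cong[OF refl], rule sum.swap)
    also have "\<dots> = (\<Sum>i\<in>V. \<Sum>k\<in>V. \<Sum>l\<in>V. \<Sum>j\<in>V. ?w i k l * (u i j * cyc i j k l))"
      by (rule sum.cong[OF refl], rule sum.cong[OF refl], rule sum.swap)
    also have "\<dots> = (\<Sum>i\<in>V. \<Sum>k\<in>V. \<Sum>l\<in>V. ?w i k l * (\<Sum>j\<in>V. u i j * cyc i j k l))"
      by (simp add: sum_distrib_left)
    finally show ?thesis .
  qed
  have "\<bar>\<Sum>i\<in>V. \<Sum>k\<in>V. \<Sum>l\<in>V. ?w i k l * (\<Sum>j\<in>V. u i j * cyc i j k l)\<bar> \<le> (\<Sum>i\<in>V. sqrt (frob2 V u) * sqrt (e * (\<Sum>j\<in>V. (u i j)\<^sup>2)))"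
  proof (rule order.trans[OF sum_abs], rule sum_mono)
    fix i assume i: "i \<in> V"
    have "\<bar>\<Sum>k\<in>V. \<Sum>l\<in>V. ?w i k l * (\<Sum>j\<in>V. u i j * cyc i j k l)\<bar>
      \<le> sqrt (frob2 V (?w i)) * sqrt (frob2 V (\<lambda>k l. \<Sum>j\<in>V. u i j * cyc i j k l))"
      by (rule abs_sum2_mult_le)
    also have "\<dots> \<le> sqrt (frob2 V u) * sqrt (e * (\<Sum>j\<in>V. (u i j)\<^sup>2))"
    proof (intro mult_mono real_sqrt_le_mono)
      have "(a i k * u k l * a i l)\<^sup>2 \<le> (u k l)\<^sup>2" for k l
      proof -
        have "(a i k)\<^sup>2 * (a i l)\<^sup>2 \<le> 1" by (intro mult_le_one sq_le_1) auto
        thus ?thesis using mult_left_le_one_le[of "(u k l)\<^sup>2" "(a i k)\<^sup>2 * (a i l)\<^sup>2"]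
          by (simp add: power_mult_distrib mult_ac)
      qed
      thus "frob2 V (?w i) \<le> frob2 V u" unfolding frob2_def by (intro sum_mono)
      show "frob2 V (\<lambda>k l. \<Sum>j\<in>V. u i j * cyc i j k l) \<le> e * (\<Sum>j\<in>V. (u i j)\<^sup>2)"
        unfolding frob2_def e_def using i u0 by (intro cyc_comb_le) auto
    qed auto
    finally show "\<bar>\<Sum>k\<in>V. \<Sum>l\<in>V. ?w i k l * (\<Sum>j\<in>V. u i j * cyc i j k l)\<bar>
      \<le> sqrt (frob2 V u) * sqrt (e * (\<Sum>j\<in>V. (u i j)\<^sup>2))" .
  qed
  also have "\<dots> = sqrt (frob2 V u) * sqrt e * (\<Sum>i\<in>V. sqrt (\<Sum>j\<in>V. (u i j)\<^sup>2))"
    unfolding real_sqrt_mult by (simp only: sum_distrib_left mult.assoc)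
  also have "\<dots> \<le> sqrt (frob2 V u) * sqrt e * (sqrt (card V) * sqrt (\<Sum>i\<in>V. \<Sum>j\<in>V. (u i j)\<^sup>2))"
    using e by (intro mult_left_mono sum_sqrt_le) (auto intro!: sum_nonneg)
  also have "\<dots> = sqrt n * sqrt e * (sqrt (frob2 V u) * sqrt (frob2 V u))"
    by (simp add: frob2_def)
  finally show ?thesis unfolding eq by (simp add: e_def)
qed

end

section \<open>Quasirandomness of the random graph\<close>

lemma sum_ksubsets_2:
  fixes f :: "nat set \<Rightarrow> real"
  shows "(\<Sum>i\<in>{1..n}. \<Sum>j\<in>{1..n}. if i = j then 0 else f {i, j}) = 2 * (\<Sum>A\<in>ksubsets n 2. f A)"
proof -
  define P where "P = {p \<in> {1..n} \<times> {1..n}. fst p \<noteq> snd p}"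
  define g where "g = (\<lambda>p::nat \<times> nat. {fst p, snd p})"
  have finP: "finite P" unfolding P_def by simp
  have img: "g ` P \<subseteq> ksubsets n 2"
  proof
    fix A assume "A \<in> g ` P"
    then obtain p where "p \<in> P" "A = g p" by blast
    thus "A \<in> ksubsets n 2" by (simp add: P_def g_def ksubsets_2_iff mem_Times_iff)
  qed
  have fibre: "sum (\<lambda>p. f (g p)) {p \<in> P. g p = A} = 2 * f A" if A: "A \<in> ksubsets n 2" for A
  proof -
    obtain i j where ij: "A = {i, j}" "i \<noteq> j" using A by (auto simp: ksubsets_def card_2_iff)
    have m: "i \<in> {1..n}" "j \<in> {1..n}" using A unfolding ij(1) ksubsets_2_iff by auto
    have "{p \<in> P. g p = A} = {(i, j), (j, i)}"
      using ij m by (auto simp: P_def g_def doubleton_eq_iff)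
    moreover have "g (i, j) = A" "g (j, i) = A" by (auto simp: g_def ij)
    ultimately show ?thesis using ij(2) by simp
  qed
  have "(\<Sum>i\<in>{1..n}. \<Sum>j\<in>{1..n}. if i = j then 0 else f {i, j})
    = (\<Sum>p\<in>{1..n} \<times> {1..n}. if fst p = snd p then 0 else f (g p))"
    unfolding g_def by (simp add: sum.cartesian_product case_prod_unfold)
  also have "\<dots> = (\<Sum>p\<in>P. f (g p))"
    unfolding P_def by (rule sum.mono_neutral_cong_right) auto
  also have "\<dots> = (\<Sum>A\<in>ksubsets n 2. sum (\<lambda>p. f (g p)) {p \<in> P. g p = A})"
    by (rule sum.group[symmetric, OF finP _ img]) simp
  also have "\<dots> = (\<Sum>A\<in>ksubsets n 2. 2 * f A)"
    by (intro sum.cong refl fibre)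
  finally show ?thesis by (simp add: sum_distrib_left)
qed

lemma edge_sign_sym: "edge_sign G i j = edge_sign G j i"
  by (simp add: edge_sign_def insert_commute)

lemma edge_sign_same [simp]: "edge_sign G i i = 0"
  by (simp add: edge_sign_def)

lemma edge_sign_sq: "i \<noteq> j \<Longrightarrow> (edge_sign G i j)\<^sup>2 = 1"
  by (simp add: edge_sign_def)

lemma edge_sign_abs_le: "\<bar>edge_sign G i j\<bar> \<le> 1"
  by (simp add: edge_sign_def)

lemma edge_sign_sq_le: "(edge_sign G i j)\<^sup>2 \<le> 1"
  by (simp add: edge_sign_def)

text \<open>The edge \<open>{i, j}\<close> carries the deterministic coefficient
  \<open>2 * (x i * x j)\<close>, so every order of the edges is adapted. The squared coefficients
  add up to at most \<open>2 * X\<^sup>2\<close>; hence the rescaling by \<open>sqrt 2\<close> and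
  the exponent \<open>t\<^sup>2 / 4\<close>.\<close>

lemma quadratic_form_tail:
  fixes x :: "nat \<Rightarrow> real"
  assumes "t \<ge> 0"
  shows "graph_prob n
           {G. \<bar>\<Sum>i\<in>{1..n}. \<Sum>j\<in>{1..n}. x i * edge_sign G i j * x j\<bar> > t * (\<Sum>i\<in>{1..n}. (x i)\<^sup>2)}
         \<le> 2 * exp (- (t\<^sup>2 / 4))"
proof (cases "(\<Sum>i\<in>{1..n}. (x i)\<^sup>2) = 0")
  case True
  hence "x i = 0" if "i \<in> {1..n}" for i
    using that by (simp add: sum_nonneg_eq_0_iff)
  hence "{G. \<bar>\<Sum>i\<in>{1..n}. \<Sum>j\<in>{1..n}. x i * edge_sign G i j * x j\<bar> > t * (\<Sum>i\<in>{1..n}. (x i)\<^sup>2)} = {}"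
    by simp
  thus ?thesis by simp
next
  case False
  define X where "X = (\<Sum>i\<in>{1..n}. (x i)\<^sup>2)"
  have X: "0 < X" using False unfolding X_def by (simp add: less_le sum_nonneg)
  obtain es where es: "set es = ksubsets n 2" "distinct es"
    using finite_distinct_list[OF finite_ksubsets] by blast
  define y where "y = (\<lambda>(e::nat set) (G::nat set set). 2 * (\<Prod>k\<in>e. x k))"
  have y2: "y {i, j} G = 2 * (x i * x j)" if "i \<noteq> j" for i j G
    using that by (simp add: y_def)
  have sl: "(\<Sum>e\<leftarrow>es. h e) = (\<Sum>e\<in>ksubsets n 2. h e)" for h :: "nat set \<Rightarrow> real"
    using es by (simp add: sum_list_distinct_conv_sum_set)
  have s1: "(\<Sum>e\<leftarrow>es. (y e G)\<^sup>2) \<le> 2 * X\<^sup>2" for G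
  proof -
    have "2 * (\<Sum>e\<leftarrow>es. (y e G)\<^sup>2) = (\<Sum>i\<in>{1..n}. \<Sum>j\<in>{1..n}. if i = j then 0 else (y {i, j} G)\<^sup>2)"
      unfolding sl sum_ksubsets_2[where n = n and f = "\<lambda>e. (y e G)\<^sup>2"] ..
    also have "\<dots> \<le> (\<Sum>i\<in>{1..n}. \<Sum>j\<in>{1..n}. 4 * ((x i)\<^sup>2 * (x j)\<^sup>2))"
      by (intro sum_mono) (simp add: y2 power_mult_distrib)
    also have "\<dots> = 4 * X\<^sup>2"
      unfolding X_def power2_eq_square[of "sum _ _"] sum_product by (simp add: sum_distrib_left)
    finally show ?thesis by simp
  qed
  have s2: "(\<Sum>e\<leftarrow>es. esign G e * y e G) = (\<Sum>i\<in>{1..n}. \<Sum>j\<in>{1..n}. x i * edge_sign G i j * x j)" for G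
  proof -
    have "2 * (\<Sum>e\<leftarrow>es. esign G e * y e G) = (\<Sum>i\<in>{1..n}. \<Sum>j\<in>{1..n}. if i = j then 0 else esign G {i, j} * y {i, j} G)"
      unfolding sl sum_ksubsets_2[where n = n and f = "\<lambda>e. esign G e * y e G"] ..
    also have "\<dots> = (\<Sum>i\<in>{1..n}. \<Sum>j\<in>{1..n}. 2 * (x i * edge_sign G i j * x j))"
      by (intro sum.cong refl) (simp add: y2 edge_sign_esign)
    finally show ?thesis by (simp add: sum_distrib_left[symmetric])
  qed
  have "graph_prob n
           {G. (\<Sum>e\<leftarrow>es. (y e G)\<^sup>2) \<le> 2 * X\<^sup>2 \<and> \<bar>\<Sum>e\<leftarrow>es. esign G e * y e G\<bar> > (t / sqrt 2) * sqrt (2 * X\<^sup>2)}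
         \<le> 2 * exp (- ((t / sqrt 2)\<^sup>2 / 2))"
    by (rule adapted_tail) (use es X assms in \<open>auto simp: y_def sorted_wrt_iff_nth_less\<close>)
  also have "(t / sqrt 2) * sqrt (2 * X\<^sup>2) = t * X"
    using X by (simp add: real_sqrt_mult)
  also have "(t / sqrt 2)\<^sup>2 / 2 = t\<^sup>2 / 4" by (simp add: power_divide)
  finally show ?thesis using s1 s2 by (simp add: X_def)
qed

lemma prob_union_le:
  fixes c :: real
  assumes "finite I" "\<And>i. i \<in> I \<Longrightarrow> measure_pmf.prob p {x. P i x} \<le> c"
  shows "measure_pmf.prob p {x. \<exists>i\<in>I. P i x} \<le> card I * c"
proof -
  have "{x. \<exists>i\<in>I. P i x} = (\<Union>i\<in>I. {x. P i x})" by auto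
  also have "measure_pmf.prob p \<dots> \<le> (\<Sum>i\<in>I. measure_pmf.prob p {x. P i x})"
    using assms(1) by (intro measure_UNION_le) auto
  also have "\<dots> \<le> (\<Sum>i\<in>I. c)" by (intro sum_mono assms(2))
  finally show ?thesis by simp
qed

text \<open>The inequality is homogeneous, so integer vectors stand for the grid of mesh
  \<open>1 / n\<close> in the cube. At \<open>t = sqrt n * L\<close> with \<open>L = ln n\<close>,
  the exponent \<open>n * L\<^sup>2 / 4\<close> outweighs the logarithm of the number
  \<open>(2 * n + 1) ^ n\<close> of points for large \<open>n\<close>.\<close>

definition net_bounded :: "nat \<Rightarrow> (nat \<Rightarrow> nat \<Rightarrow> real) \<Rightarrow> real \<Rightarrow> bool" where
  "net_bounded n a t \<longleftrightarrow> (\<forall>z \<in> {1..n} \<rightarrow>\<^sub>E {- int n..int n}.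
     \<bar>\<Sum>i\<in>{1..n}. \<Sum>j\<in>{1..n}. real_of_int (z i) * a i j * real_of_int (z j)\<bar> \<le> t * (\<Sum>i\<in>{1..n}. (real_of_int (z i))\<^sup>2))"

lemma prob_not_net_bounded:
  assumes "t \<ge> 0"
  shows "graph_prob n {G. \<not> net_bounded n (edge_sign G) t}
    \<le> (2 * n + 1) ^ n * (2 * exp (- (t\<^sup>2 / 4)))"
proof -
  have "graph_prob n {G. \<exists>z \<in> {1..n} \<rightarrow>\<^sub>E {- int n..int n}.
     \<bar>\<Sum>i\<in>{1..n}. \<Sum>j\<in>{1..n}. real_of_int (z i) * edge_sign G i j * real_of_int (z j)\<bar> > t * (\<Sum>i\<in>{1..n}. (real_of_int (z i))\<^sup>2)}
    \<le> card ({1..n} \<rightarrow>\<^sub>E {- int n..int n}) * (2 * exp (- (t\<^sup>2 / 4)))"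
    by (rule prob_union_le) (rule finite_PiE, simp_all only: finite_atLeastAtMost finite_atLeastAtMost_int,
      rule quadratic_form_tail[OF assms])
  also have "card ({1..n} \<rightarrow>\<^sub>E {- int n..int n}) = (2 * n + 1) ^ n"
    by (simp add: card_PiE nat_add_distrib nat_mult_distrib)
  finally show ?thesis by (simp add: net_bounded_def not_le Bex_def add.commute)
qed

text \<open>For \<open>k \<noteq> p\<close> the product over \<open>S\<close> contains no edge at
  \<open>p\<close>. Lists of length one and three give the two kinds of codegree.\<close>

lemma prob_codeg:
  assumes "p \<in> {1..n}" "L \<ge> 0" and sub: "\<And>s. s \<in> set S \<Longrightarrow> s \<noteq> p"
  shows "graph_prob n
    {G. \<bar>\<Sum>k\<in>{1..n}. edge_sign G p k * (\<Prod>s\<leftarrow>S. edge_sign G s k)\<bar> > sqrt n * L} \<le> 2 * exp (- (L\<^sup>2 / 2))"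
proof -
  let ?y = "\<lambda>k G. \<Prod>s\<leftarrow>S. edge_sign G s k"
  have y1: "(?y k G)\<^sup>2 \<le> 1" for k G
    by (induction S) (auto simp: power_mult_distrib intro!: mult_le_one edge_sign_sq_le)
  have y2: "(\<Sum>k\<in>{1..n} - {p}. (?y k G)\<^sup>2) \<le> n" for G
  proof -
    have "(\<Sum>k\<in>{1..n} - {p}. (?y k G)\<^sup>2) \<le> (\<Sum>k\<in>{1..n} - {p}. 1)" by (intro sum_mono y1)
    also have "\<dots> \<le> n" using card_mono[of "{1..n}" "{1..n} - {p}"] by simp
    finally show ?thesis .
  qed
  have s: "(\<Sum>k\<in>{1..n}. edge_sign G p k * ?y k G) = (\<Sum>k\<in>{1..n} - {p}. edge_sign G p k * ?y k G)" for G
    by (rule sum.mono_neutral_right) auto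
  have "graph_prob n
    {G. (\<Sum>k\<in>{1..n} - {p}. (?y k G)\<^sup>2) \<le> real n \<and> \<bar>\<Sum>k\<in>{1..n} - {p}. edge_sign G p k * ?y k G\<bar> > L * sqrt (real n)}
    \<le> 2 * exp (- (L\<^sup>2 / 2))"
  proof (rule row_tail)
    fix k x G assume k: "k \<in> {1..n} - {p}"
    have "map (\<lambda>s. edge_sign (insert {p, x} G) s k) S = map (\<lambda>s. edge_sign G s k) S"
      using k sub by (auto intro!: edge_sign_insert simp: doubleton_eq_iff)
    thus "?y k (insert {p, x} G) = ?y k G" by metis
  qed (use assms in auto)
  thus ?thesis unfolding s using y2 by (simp add: mult.commute)
qed

lemma gramC_insert:
  "gramC n (edge_sign (insert {i, z} G)) i j j' x x' = gramC n (edge_sign G) i j j' x x'"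
proof (cases "distinct [i, j, j', x, x']")
  case True
  have e: "edge_sign (insert {i, z} G) p q = edge_sign G p q" if "p \<noteq> i" "q \<noteq> i" for p q
    using that by (intro edge_sign_insert) (auto simp: doubleton_eq_iff)
  have "x \<noteq> i" "x' \<noteq> i" "j \<noteq> i" "j' \<noteq> i" using True by auto
  hence "gramB n (edge_sign (insert {i, z} G)) i j j' x x' = gramB n (edge_sign G) i j j' x x'"
    "gramB n (edge_sign (insert {i, z} G)) i j j' x' x = gramB n (edge_sign G) i j j' x' x"
    unfolding gramB_def by (simp_all add: e)
  thus ?thesis unfolding gramC_def by simp
next
  case False
  show ?thesis unfolding gramC_def if_not_P[OF False] ..
qed

lemma prob_chaos1:
  assumes "i \<in> {1..n}" "L \<ge> 0" "B > 0"
  shows "graph_prob n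
    {G. (\<Sum>x\<in>{1..n} - {i}. (if x < x' then gramC n (edge_sign G) i j j' x x' else 0)\<^sup>2) \<le> B \<and>
      \<bar>gramY n (edge_sign G) i j j' x'\<bar> > L * sqrt B} \<le> 2 * exp (- (L\<^sup>2 / 2))"
  unfolding gramY_def by (rule row_tail) (use assms in \<open>auto simp: gramC_insert\<close>)

text \<open>\<open>gramY\<close> at \<open>k\<close> uses the signs at \<open>i\<close> only for
  \<open>x < k\<close>, and \<open>gramC\<close> has no edge at \<open>i\<close>. This is the
  dependence that \<open>row_tail\<close> permits, and the reason for ordering the pairs of the
  chaos.\<close>

lemma prob_chaos2:
  assumes "i \<in> {1..n}" "L \<ge> 0" "B > 0"
  shows "graph_prob n
    {G. (\<Sum>x\<in>{1..n} - {i}. (gramY n (edge_sign G) i j j' x)\<^sup>2) \<le> B \<and>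
      \<bar>\<Sum>x\<in>{1..n} - {i}. edge_sign G i x * gramY n (edge_sign G) i j j' x\<bar> > L * sqrt B} \<le> 2 * exp (- (L\<^sup>2 / 2))"
proof (rule row_tail)
  fix k z G assume kz: "k \<in> {1..n} - {i}" "z \<in> {1..n} - {i}" "k \<le> z"
  show "gramY n (edge_sign (insert {i, z} G)) i j j' k = gramY n (edge_sign G) i j j' k"
    unfolding gramY_def gramC_insert
  proof (rule sum.cong[OF refl])
    fix x
    have "edge_sign (insert {i, z} G) i x = edge_sign G i x" if "x < k"
      using that kz by (intro edge_sign_insert) (auto simp: doubleton_eq_iff)
    thus "edge_sign (insert {i, z} G) i x * (if x < k then gramC n (edge_sign G) i j j' x k else 0)
      = edge_sign G i x * (if x < k then gramC n (edge_sign G) i j j' x k else 0)" by simp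
  qed
qed (use assms in auto)

text \<open>A union bound over the grid failure and \<open>n ^ 2 + 2 * n ^ 4 + n ^ 3\<close> index
  tuples, each failing with probability at most \<open>2 * exp (- (L\<^sup>2 / 2))\<close>; raising
  the count to \<open>4 * n ^ 4\<close> yields the constant 8.\<close>

lemma prob_not_quasirandom:
  assumes n: "n \<ge> 1" and L: "L > 0"
  shows "graph_prob n
    {G. \<not> (net_bounded n (edge_sign G) (sqrt n * L) \<and> quasirandom n (edge_sign G) L)}
    \<le> (2 * n + 1) ^ n * (2 * exp (- (n * L\<^sup>2 / 4))) + 8 * real n ^ 4 * exp (- (L\<^sup>2 / 2))"
proof -
  define V where "V = {1..n}"
  define B where "B = n * (2 * gram_bound n L)\<^sup>2"
  define c where "c = 2 * exp (- (L\<^sup>2 / 2))"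
  have gb: "gram_bound n L > 0" using n unfolding gram_bound_def by (intro add_nonneg_pos) auto
  have B: "B > 0" using n gb by (simp add: B_def)
  define P1 where "P1 = (\<lambda>G. \<not> net_bounded n (edge_sign G) (sqrt n * L))"
  define P2 where "P2 = (\<lambda>(p, q) G. p \<noteq> q \<and> \<bar>\<Sum>k\<in>{1..n}. edge_sign G p k * edge_sign G q k\<bar> > sqrt n * L)"
  define P4 where "P4 = (\<lambda>(p, q, r, s) G. distinct [p, q, r, s] \<and>
    \<bar>\<Sum>k\<in>{1..n}. edge_sign G p k * edge_sign G q k * edge_sign G r k * edge_sign G s k\<bar> > sqrt n * L)"
  define C1 where "C1 = (\<lambda>(i, j, j', x') G. (\<Sum>x\<in>{1..n} - {i}. (if x < x' then gramC n (edge_sign G) i j j' x x' else 0)\<^sup>2) \<le> B \<and>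
      \<bar>gramY n (edge_sign G) i j j' x'\<bar> > L * sqrt B)"
  define C2 where "C2 = (\<lambda>(i, j, j') G. (\<Sum>x\<in>{1..n} - {i}. (gramY n (edge_sign G) i j j' x)\<^sup>2) \<le> n * (L\<^sup>2 * B) \<and>
      \<bar>\<Sum>x\<in>{1..n} - {i}. edge_sign G i x * gramY n (edge_sign G) i j j' x\<bar> > L * sqrt (n * (L\<^sup>2 * B)))"
  have p1: "graph_prob n {G. P1 G} \<le> (2 * n + 1) ^ n * (2 * exp (- (n * L\<^sup>2 / 4)))"
    using prob_not_net_bounded[of "sqrt n * L" n] L unfolding P1_def by (simp add: power_mult_distrib add.commute)
  have p2: "graph_prob n {G. \<exists>p\<in>V \<times> V. P2 p G} \<le> card (V \<times> V) * c"
  proof (rule prob_union_le)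
    fix pq assume "pq \<in> V \<times> V"
    then obtain p q where pq: "pq = (p, q)" "p \<in> {1..n}" "q \<in> {1..n}" by (auto simp: V_def)
    show "graph_prob n {G. P2 pq G} \<le> c"
    proof (cases "p = q")
      case False
      thus ?thesis using prob_codeg[of p n L "[q]"] pq L by (simp add: P2_def c_def)
    qed (simp add: P2_def pq c_def)
  qed (simp add: V_def)
  have p4: "graph_prob n {G. \<exists>p\<in>V \<times> V \<times> V \<times> V. P4 p G} \<le> card (V \<times> V \<times> V \<times> V) * c"
  proof (rule prob_union_le)
    fix t assume "t \<in> V \<times> V \<times> V \<times> V"
    then obtain p q r s where t: "t = (p, q, r, s)" "p \<in> {1..n}" by (auto simp: V_def)
    show "graph_prob n {G. P4 t G} \<le> c"
    proof (cases "distinct [p, q, r, s]")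
      case True
      hence S: "s' \<noteq> p" if "s' \<in> set [q, r, s]" for s' using that by auto
      have "{G. P4 t G} = {G. \<bar>\<Sum>k\<in>{1..n}. edge_sign G p k * (\<Prod>s\<leftarrow>[q, r, s]. edge_sign G s k)\<bar> > sqrt n * L}"
        using True unfolding P4_def t(1) prod.case by (simp only: simp_thms list.map prod_list.Cons prod_list.Nil mult.assoc mult_1_right)
      thus ?thesis using prob_codeg[OF t(2) _ S] L by (simp only: c_def less_imp_le)
    next
      case False
      hence "{G. P4 t G} = {}" unfolding P4_def t(1) by blast
      thus ?thesis by (simp add: c_def)
    qed
  qed (simp add: V_def)
  have c1: "graph_prob n {G. \<exists>t\<in>V \<times> V \<times> V \<times> V. C1 t G} \<le> card (V \<times> V \<times> V \<times> V) * c"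
  proof (rule prob_union_le)
    fix t assume "t \<in> V \<times> V \<times> V \<times> V"
    then obtain i j j' x' where t: "t = (i, j, j', x')" "i \<in> {1..n}" by (auto simp: V_def)
    show "graph_prob n {G. C1 t G} \<le> c"
      unfolding t(1) C1_def prod.case c_def using t(2) L B by (intro prob_chaos1) auto
  qed (simp add: V_def)
  have c2: "graph_prob n {G. \<exists>t\<in>V \<times> V \<times> V. C2 t G} \<le> card (V \<times> V \<times> V) * c"
  proof (rule prob_union_le)
    fix t assume "t \<in> V \<times> V \<times> V"
    then obtain i j j' where t: "t = (i, j, j')" "i \<in> {1..n}" by (auto simp: V_def)
    show "graph_prob n {G. C2 t G} \<le> c"
      unfolding t(1) C2_def prod.case c_def using t(2) L B n by (intro prob_chaos2) auto
  qed (simp add: V_def)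
  have sub: "{G. \<not> (net_bounded n (edge_sign G) (sqrt n * L) \<and> quasirandom n (edge_sign G) L)}
    \<subseteq> {G. P1 G} \<union> ({G. \<exists>p\<in>V \<times> V. P2 p G} \<union> ({G. \<exists>p\<in>V \<times> V \<times> V \<times> V. P4 p G} \<union>
      ({G. \<exists>t\<in>V \<times> V \<times> V \<times> V. C1 t G} \<union> {G. \<exists>t\<in>V \<times> V \<times> V. C2 t G})))"
  proof (rule subsetI, rule ccontr)
    fix G assume G: "G \<in> {G. \<not> (net_bounded n (edge_sign G) (sqrt n * L) \<and> quasirandom n (edge_sign G) L)}"
    assume "G \<notin> {G. P1 G} \<union> ({G. \<exists>p\<in>V \<times> V. P2 p G} \<union> ({G. \<exists>p\<in>V \<times> V \<times> V \<times> V. P4 p G} \<union>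
      ({G. \<exists>t\<in>V \<times> V \<times> V \<times> V. C1 t G} \<union> {G. \<exists>t\<in>V \<times> V \<times> V. C2 t G})))"
    hence not: "\<not> P1 G" "\<And>t. t \<in> V \<times> V \<Longrightarrow> \<not> P2 t G" "\<And>t. t \<in> V \<times> V \<times> V \<times> V \<Longrightarrow> \<not> P4 t G"
      "\<And>t. t \<in> V \<times> V \<times> V \<times> V \<Longrightarrow> \<not> C1 t G" "\<And>t. t \<in> V \<times> V \<times> V \<Longrightarrow> \<not> C2 t G"
      by blast+
    have "quasirandom n (edge_sign G) L"
    proof
      show "edge_sign G i j = edge_sign G j i" for i j by (rule edge_sign_sym)
      show "edge_sign G i i = 0" for i by simp
      show "(edge_sign G i j)\<^sup>2 = 1" if "i \<noteq> j" for i j using that by (rule edge_sign_sq)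
      show "0 \<le> L" using L by simp
      show "\<bar>\<Sum>k\<in>{1..n}. edge_sign G p k * edge_sign G q k\<bar> \<le> sqrt n * L"
        if "p \<in> {1..n}" "q \<in> {1..n}" "p \<noteq> q" for p q
        using not(2)[of "(p, q)"] that unfolding P2_def V_def by (simp add: not_less)
      show "\<bar>\<Sum>k\<in>{1..n}. edge_sign G p k * edge_sign G q k * edge_sign G r k * edge_sign G s k\<bar> \<le> sqrt n * L"
        if "{p, q, r, s} \<subseteq> {1..n}" "distinct [p, q, r, s]" for p q r s
      proof -
        have "(p, q, r, s) \<in> V \<times> V \<times> V \<times> V" using that(1) by (simp add: V_def)
        from not(3)[OF this] that(2) show ?thesis unfolding P4_def prod.case not_less[symmetric] by blast
      qed
      show "\<bar>gramY n (edge_sign G) i j j' x'\<bar> \<le> L * sqrt (n * (2 * gram_bound n L)\<^sup>2)"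
        if "{i, j, j', x'} \<subseteq> {1..n}" "(\<Sum>x\<in>{1..n} - {i}. (if x < x' then gramC n (edge_sign G) i j j' x x' else 0)\<^sup>2)
          \<le> n * (2 * gram_bound n L)\<^sup>2" for i j j' x'
      proof -
        have "(i, j, j', x') \<in> V \<times> V \<times> V \<times> V" using that(1) by (simp add: V_def)
        from not(4)[OF this] that(2) show ?thesis unfolding C1_def prod.case not_less[symmetric] B_def by blast
      qed
      show "\<bar>\<Sum>x\<in>{1..n} - {i}. edge_sign G i x * gramY n (edge_sign G) i j j' x\<bar>
          \<le> L * sqrt (n * (L\<^sup>2 * (n * (2 * gram_bound n L)\<^sup>2)))"
        if "{i, j, j'} \<subseteq> {1..n}" "(\<Sum>x\<in>{1..n} - {i}. (gramY n (edge_sign G) i j j' x)\<^sup>2)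
          \<le> n * (L\<^sup>2 * (n * (2 * gram_bound n L)\<^sup>2))" for i j j'
      proof -
        have "(i, j, j') \<in> V \<times> V \<times> V" using that(1) by (simp add: V_def)
        from not(5)[OF this] that(2) show ?thesis unfolding C2_def prod.case not_less[symmetric] B_def by blast
      qed
    qed
    thus False using G not(1) by (simp add: P1_def)
  qed
  have un: "graph_prob n (X \<union> Y) \<le> x + y" if "graph_prob n X \<le> x" "graph_prob n Y \<le> y" for X Y x y
    using measure_Un_le[of X "measure_pmf (pmf_of_set (Pow (ksubsets n 2)))" Y] that by simp
  have "graph_prob n {G. \<not> (net_bounded n (edge_sign G) (sqrt n * L) \<and> quasirandom n (edge_sign G) L)}
    \<le> (2 * n + 1) ^ n * (2 * exp (- (n * L\<^sup>2 / 4))) + (card (V \<times> V) * c + (card (V \<times> V \<times> V \<times> V) * c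
      + (card (V \<times> V \<times> V \<times> V) * c + card (V \<times> V \<times> V) * c)))"
    by (rule order.trans[OF measure_pmf.finite_measure_mono[OF sub]])
      (use un[OF p1 un[OF p2 un[OF p4 un[OF c1 c2]]]] in auto)
  also have "\<dots> = (2 * n + 1) ^ n * (2 * exp (- (n * L\<^sup>2 / 4))) + (real n ^ 2 + real n ^ 4 + real n ^ 4 + real n ^ 3) * c"
    by (simp add: V_def card_cartesian_product algebra_simps power2_eq_square power3_eq_cube power4_eq_xxxx)
  also have "(real n ^ 2 + real n ^ 4 + real n ^ 4 + real n ^ 3) * c \<le> (4 * real n ^ 4) * c"
  proof (rule mult_right_mono)
    have "real n ^ 2 \<le> real n ^ 4" "real n ^ 3 \<le> real n ^ 4"
      using n by (intro power_increasing; simp)+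
    thus "real n ^ 2 + real n ^ 4 + real n ^ 4 + real n ^ 3 \<le> 4 * real n ^ 4" by linarith
  qed (simp add: c_def)
  finally show ?thesis by (simp add: c_def add.commute mult.assoc)
qed

section \<open>From the grid to the operator norm\<close>

lemma quad_form_add:
  fixes a :: "nat \<Rightarrow> nat \<Rightarrow> real"
  assumes "\<And>i j. a i j = a j i"
  shows "(\<Sum>i\<in>V. \<Sum>j\<in>V. (x i + y i) * a i j * (x j + y j)) =
    (\<Sum>i\<in>V. \<Sum>j\<in>V. x i * a i j * x j) + 2 * (\<Sum>i\<in>V. \<Sum>j\<in>V. x i * a i j * y j)
    + (\<Sum>i\<in>V. \<Sum>j\<in>V. y i * a i j * y j)"
proof -
  have "(\<Sum>i\<in>V. \<Sum>j\<in>V. y i * a i j * x j) = (\<Sum>i\<in>V. \<Sum>j\<in>V. x i * a i j * y j)"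
    by (subst sum.swap) (simp add: assms[of _ _] mult_ac)
  moreover have "(\<Sum>i\<in>V. \<Sum>j\<in>V. (x i + y i) * a i j * (x j + y j)) =
    (\<Sum>i\<in>V. \<Sum>j\<in>V. x i * a i j * x j) + (\<Sum>i\<in>V. \<Sum>j\<in>V. x i * a i j * y j)
    + (\<Sum>i\<in>V. \<Sum>j\<in>V. y i * a i j * x j) + (\<Sum>i\<in>V. \<Sum>j\<in>V. y i * a i j * y j)"
    unfolding sum.distrib[symmetric] by (intro sum.cong refl) (simp add: algebra_simps)
  ultimately show ?thesis by simp
qed

text \<open>Polarisation: for \<open>x = a y\<close> the values of the form at
  \<open>x + lam y\<close> and \<open>x - lam y\<close> differ by four times \<open>lam\<close>
  times the squared norm of \<open>x\<close>, while the parallelogram law bounds the same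
  difference. The scale \<open>lam\<close> on \<open>y\<close> balances the two sides.\<close>

lemma op_bound_of_quad_form:
  fixes a :: "nat \<Rightarrow> nat \<Rightarrow> real"
  assumes a: "\<And>i j. a i j = a j i" and lam: "lam > 0"
    and q: "\<And>x. \<bar>\<Sum>i\<in>V. \<Sum>j\<in>V. x i * a i j * x j\<bar> \<le> lam * (\<Sum>i\<in>V. (x i)\<^sup>2)"
  shows "(\<Sum>i\<in>V. (\<Sum>j\<in>V. a i j * y j)\<^sup>2) \<le> lam\<^sup>2 * (\<Sum>j\<in>V. (y j)\<^sup>2)"
proof -
  define x where "x = (\<lambda>i. \<Sum>j\<in>V. a i j * y j)"
  define X where "X = (\<Sum>i\<in>V. (x i)\<^sup>2)"
  define Y where "Y = (\<Sum>i\<in>V. (y i)\<^sup>2)"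
  let ?q = "\<lambda>u v. \<Sum>i\<in>V. \<Sum>j\<in>V. u i * a i j * v j"
  have xy: "?q x (\<lambda>j. lam * y j) = lam * X"
    unfolding X_def x_def power2_eq_square by (simp add: sum_distrib_left sum_distrib_right mult_ac)
  have neg: "?q x (\<lambda>j. - (lam * y j)) = - ?q x (\<lambda>j. lam * y j)"
    "?q (\<lambda>j. - (lam * y j)) (\<lambda>j. - (lam * y j)) = ?q (\<lambda>j. lam * y j) (\<lambda>j. lam * y j)"
    by (simp_all add: sum_negf)
  have "4 * (lam * X) = ?q (\<lambda>i. x i + lam * y i) (\<lambda>i. x i + lam * y i) - ?q (\<lambda>i. x i + - (lam * y i)) (\<lambda>i. x i + - (lam * y i))"
    unfolding quad_form_add[OF a] neg xy by simp
  also have "\<dots> \<le> lam * (\<Sum>i\<in>V. (x i + lam * y i)\<^sup>2) + lam * (\<Sum>i\<in>V. (x i + - (lam * y i))\<^sup>2)"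
    using q[of "\<lambda>i. x i + lam * y i"] q[of "\<lambda>i. x i + - (lam * y i)"] by linarith
  also have "\<dots> = lam * (\<Sum>i\<in>V. 2 * (x i)\<^sup>2 + 2 * (lam\<^sup>2 * (y i)\<^sup>2))"
    unfolding distrib_left[symmetric] sum.distrib[symmetric]
    by (intro arg_cong[where f = "\<lambda>z. lam * z"] sum.cong refl) (simp add: power2_eq_square algebra_simps)
  also have "\<dots> = lam * (2 * X + 2 * (lam\<^sup>2 * Y))"
    by (simp add: sum.distrib sum_distrib_left X_def Y_def)
  finally have "lam * (2 * X) \<le> lam * (2 * (lam\<^sup>2 * Y))" by (simp add: algebra_simps)
  hence "X \<le> lam\<^sup>2 * Y" using lam by simp
  thus ?thesis by (simp add: X_def Y_def x_def)
qed

lemma abs_form_le: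
  fixes a :: "nat \<Rightarrow> nat \<Rightarrow> real"
  assumes "\<And>i j. \<bar>a i j\<bar> \<le> 1"
  shows "\<bar>\<Sum>i\<in>V. \<Sum>j\<in>V. x i * a i j * y j\<bar> \<le> (\<Sum>i\<in>V. \<bar>x i\<bar>) * (\<Sum>j\<in>V. \<bar>y j\<bar>)"
proof -
  have "\<bar>\<Sum>i\<in>V. \<Sum>j\<in>V. x i * a i j * y j\<bar> \<le> (\<Sum>i\<in>V. \<Sum>j\<in>V. \<bar>x i * a i j * y j\<bar>)"
    by (intro order.trans[OF sum_abs] sum_mono sum_abs)
  also have "\<dots> \<le> (\<Sum>i\<in>V. \<Sum>j\<in>V. \<bar>x i\<bar> * \<bar>y j\<bar>)"
  proof (intro sum_mono)
    fix i j
    have "\<bar>x i * a i j * y j\<bar> = \<bar>a i j\<bar> * (\<bar>x i\<bar> * \<bar>y j\<bar>)" by (simp add: abs_mult)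
    also have "\<dots> \<le> \<bar>x i\<bar> * \<bar>y j\<bar>" using assms by (intro mult_left_le_one_le) auto
    finally show "\<bar>x i * a i j * y j\<bar> \<le> \<bar>x i\<bar> * \<bar>y j\<bar>" .
  qed
  finally show ?thesis by (simp add: sum_product)
qed

text \<open>A unit vector is rounded to multiples of \<open>1 / n\<close>; the error has \<open>l\<^sub>1\<close> norm at most \<open>1\<close>.\<close>

lemma quad_form_le_of_net:
  fixes a :: "nat \<Rightarrow> nat \<Rightarrow> real"
  assumes a: "\<And>i j. a i j = a j i" "\<And>i j. \<bar>a i j\<bar> \<le> 1" and n: "n \<ge> 1"
    and t: "sqrt n \<le> t" and net: "net_bounded n a t"
  shows "\<bar>\<Sum>i\<in>{1..n}. \<Sum>j\<in>{1..n}. x i * a i j * x j\<bar> \<le> 9 * t * (\<Sum>i\<in>{1..n}. (x i)\<^sup>2)"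
proof (cases "(\<Sum>i\<in>{1..n}. (x i)\<^sup>2) = 0")
  case True
  hence "x i = 0" if "i \<in> {1..n}" for i
    using that by (simp add: sum_nonneg_eq_0_iff)
  thus ?thesis by simp
next
  case False
  let ?V = "{1..n}"
  let ?q = "\<lambda>u v. \<Sum>i\<in>?V. \<Sum>j\<in>?V. u i * a i j * v j"
  define s where "s = sqrt (\<Sum>i\<in>?V. (x i)\<^sup>2)"
  have s2: "s\<^sup>2 = (\<Sum>i\<in>?V. (x i)\<^sup>2)" unfolding s_def by (simp add: sum_nonneg)
  have s: "s > 0" using False unfolding s_def by (simp add: less_le sum_nonneg)
  define y where "y = (\<lambda>i. x i / s)"
  define z where "z = restrict (\<lambda>i. \<lfloor>n * y i\<rfloor>) ?V"
  define p where "p = (\<lambda>i. real_of_int (z i) / n)"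
  define d where "d = (\<lambda>i. y i - p i)"
  have y2: "(\<Sum>i\<in>?V. (y i)\<^sup>2) = 1"
    unfolding y_def power_divide sum_divide_distrib[symmetric] s2[symmetric] using s by simp
  have y1: "\<bar>y i\<bar> \<le> 1" if "i \<in> ?V" for i
  proof -
    have "(y i)\<^sup>2 \<le> (\<Sum>i\<in>?V. (y i)\<^sup>2)" using that by (intro member_le_sum) auto
    thus ?thesis unfolding y2 by (simp add: abs_square_le_1)
  qed
  have zr: "z \<in> ?V \<rightarrow>\<^sub>E {- int n..int n}"
  proof (rule PiE_I)
    fix i assume i: "i \<in> ?V"
    have "\<bar>n * y i\<bar> \<le> n" using y1[OF i] n by (simp add: abs_mult)
    hence "- real n \<le> n * y i" "n * y i \<le> n" by linarith+
    hence "- int n \<le> \<lfloor>n * y i\<rfloor>" "\<lfloor>n * y i\<rfloor> \<le> int n"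
      by (simp_all add: le_floor_iff floor_le_iff)
    thus "z i \<in> {- int n..int n}" using i by (simp add: z_def)
  qed (auto simp: z_def)
  have d1: "\<bar>d i\<bar> \<le> 1 / n" if "i \<in> ?V" for i
  proof -
    have "\<bar>n * y i - z i\<bar> \<le> 1" using that by (simp add: z_def) linarith
    moreover have "d i = (n * y i - z i) / n" using n by (simp add: d_def p_def field_simps)
    ultimately show ?thesis using n by (simp add: divide_right_mono)
  qed
  have ds: "(\<Sum>i\<in>?V. \<bar>d i\<bar>) \<le> 1"
  proof -
    have "(\<Sum>i\<in>?V. \<bar>d i\<bar>) \<le> (\<Sum>i\<in>?V. 1 / n)" by (intro sum_mono d1)
    thus ?thesis using n by simp
  qed
  have dd: "(\<Sum>i\<in>?V. (d i)\<^sup>2) \<le> 1"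
  proof -
    have "(\<Sum>i\<in>?V. (d i)\<^sup>2) \<le> (\<Sum>i\<in>?V. \<bar>d i\<bar>)"
    proof (rule sum_mono)
      fix i assume "i \<in> ?V"
      hence "\<bar>d i\<bar> \<le> 1" using d1[of i] n by (simp add: order.trans divide_le_eq_1)
      thus "(d i)\<^sup>2 \<le> \<bar>d i\<bar>" by (metis abs_ge_zero abs_mult_self_eq mult_left_le power2_eq_square)
    qed
    thus ?thesis using ds by linarith
  qed
  have pp: "(\<Sum>i\<in>?V. (p i)\<^sup>2) \<le> 4"
  proof -
    have "(\<Sum>i\<in>?V. (p i)\<^sup>2) \<le> (\<Sum>i\<in>?V. 2 * (y i)\<^sup>2 + 2 * (d i)\<^sup>2)"
    proof (rule sum_mono)
      fix i
      have "0 \<le> (y i + d i)\<^sup>2" by simp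
      thus "(p i)\<^sup>2 \<le> 2 * (y i)\<^sup>2 + 2 * (d i)\<^sup>2"
        unfolding d_def by (simp add: power2_eq_square algebra_simps)
    qed
    thus ?thesis using y2 dd by (simp add: sum.distrib sum_distrib_left[symmetric])
  qed
  have ps: "(\<Sum>i\<in>?V. \<bar>p i\<bar>) \<le> 2 * sqrt n"
  proof -
    have "(\<Sum>i\<in>?V. \<bar>p i\<bar>) = (\<Sum>i\<in>?V. sqrt ((p i)\<^sup>2))" by simp
    also have "\<dots> \<le> sqrt (card ?V) * sqrt (\<Sum>i\<in>?V. (p i)\<^sup>2)" by (rule sum_sqrt_le) simp
    also have "\<dots> \<le> sqrt n * sqrt 4" using pp by (intro mult_mono real_sqrt_le_mono) (simp_all add: sum_nonneg)
    finally show ?thesis by simp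
  qed
  have sn: "1 \<le> sqrt n" using n by simp
  have t0: "0 \<le> t" using t sn by linarith
  have q1: "\<bar>?q p p\<bar> \<le> 4 * t"
  proof -
    have "?q p p = (\<Sum>i\<in>?V. \<Sum>j\<in>?V. z i * a i j * z j) / (real n)\<^sup>2"
      by (simp add: p_def sum_divide_distrib power2_eq_square)
    hence "\<bar>?q p p\<bar> = \<bar>\<Sum>i\<in>?V. \<Sum>j\<in>?V. z i * a i j * z j\<bar> / (real n)\<^sup>2" by simp
    also have "\<dots> \<le> t * (\<Sum>i\<in>?V. (real_of_int (z i))\<^sup>2) / (real n)\<^sup>2"
      using net zr unfolding net_bounded_def by (intro divide_right_mono) auto
    also have "\<dots> = t * (\<Sum>i\<in>?V. (p i)\<^sup>2)"
      unfolding p_def power_divide sum_divide_distrib[symmetric] by simp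
    also have "\<dots> \<le> t * 4" using pp t0 by (intro mult_left_mono) auto
    finally show ?thesis by simp
  qed
  have q2: "\<bar>?q p d\<bar> \<le> 2 * sqrt n * 1"
    by (rule order.trans[OF abs_form_le[OF a(2)]]) (intro mult_mono ps ds; simp add: sum_nonneg)
  have q3: "\<bar>?q d d\<bar> \<le> 1 * 1"
    by (rule order.trans[OF abs_form_le[OF a(2)]]) (intro mult_mono ds; simp add: sum_nonneg)
  have "?q y y = ?q (\<lambda>i. p i + d i) (\<lambda>i. p i + d i)" by (simp add: d_def)
  also have "\<dots> = ?q p p + 2 * ?q p d + ?q d d" by (rule quad_form_add[OF a(1)])
  \<comment> \<open>The rounded vector contributes \<open>4 * t\<close>, the mixed term twice
    \<open>2 * sqrt n\<close> and the rounding error 1; since \<open>1 \<le> sqrt n \<le> t\<close>,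
    the total is at most \<open>9 * t\<close>.\<close>
  finally have yy: "\<bar>?q y y\<bar> \<le> 9 * t" using q1 q2 q3 t sn by linarith
  have "?q x x = s\<^sup>2 * ?q y y"
    using s by (simp add: y_def sum_distrib_left power2_eq_square)
  hence "\<bar>?q x x\<bar> = s\<^sup>2 * \<bar>?q y y\<bar>" by (simp add: abs_mult)
  also have "\<dots> \<le> s\<^sup>2 * (9 * t)" by (intro mult_left_mono yy) simp
  finally show ?thesis by (simp add: s2 mult.commute)
qed

section \<open>Entries of the matrices\<close>

lemma edge_ind_eq: "i \<noteq> j \<Longrightarrow> edge_ind G i j = (1 + edge_sign G i j) / 2"
  by (simp add: edge_ind_def edge_sign_def)

lemma edge_ind_sym: "edge_ind G i j = edge_ind G j i"
  by (simp add: edge_ind_def insert_commute)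

lemma expectation_edge_ind:
  assumes "p \<noteq> q" "p \<in> {1..n}" "q \<in> {1..n}"
  shows "measure_pmf.expectation (gnp n (1/2)) (\<lambda>G. c * edge_ind G p q - d) = c / 2 - d"
proof -
  let ?E = "ksubsets n 2"
  have e: "{p, q} \<in> ?E" using assms by (simp add: ksubsets_2_iff)
  have "(\<Sum>G\<in>Pow ?E. c * edge_ind G p q - d) = (\<Sum>G\<in>Pow (?E - {{p, q}}). (c * edge_ind G p q - d) + (c * edge_ind (insert {p, q} G) p q - d))"
    by (rule sum_Pow_split) (use e in auto)
  also have "\<dots> = (\<Sum>G\<in>Pow (?E - {{p, q}}). c - 2 * d)"
    by (intro sum.cong refl) (auto simp: edge_ind_def)
  also have "\<dots> = 2 ^ (card ?E - 1) * (c - 2 * d)"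
    using e by (simp add: card_Pow)
  also have "(2::real) ^ (card ?E - 1) = 2 ^ card ?E / 2"
  proof -
    have "card ?E > 0" using e by (auto simp: card_gt_0_iff)
    thus ?thesis by (cases "card ?E") auto
  qed
  finally have s: "(\<Sum>G\<in>Pow ?E. c * edge_ind G p q - d) = 2 ^ card ?E * (c / 2 - d)"
    by (simp add: field_simps)
  have "measure_pmf.expectation (gnp n (1/2)) (\<lambda>G. c * edge_ind G p q - d)
    = (\<Sum>G\<in>Pow ?E. c * edge_ind G p q - d) / card (Pow ?E)"
    unfolding gnp_half by (subst integral_pmf_of_set) auto
  also have "\<dots> = c / 2 - d" unfolding s by (simp add: card_Pow)
  finally show ?thesis .
qed

lemma Nmat_same: "card A = 2 \<Longrightarrow> Nmat \<alpha> G A A = \<alpha> 2"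
  by (simp add: Nmat_def)

lemma Nmat_share:
  assumes "distinct [c, p, q]"
  shows "Nmat \<alpha> G {c, p} {c, q} = \<alpha> 3 * edge_ind G p q"
proof -
  have "{c, p} - {c, q} = {p}" "{c, q} - {c, p} = {q}" "{c, p} \<union> {c, q} = {c, p, q}"
    using assms by auto
  moreover have "card {c, p, q} = 3" using assms by simp
  ultimately show ?thesis unfolding Nmat_def by simp
qed

lemma Nmat_disjoint:
  assumes "distinct [i, j, k, l]"
  shows "Nmat \<alpha> G {i, j} {k, l} = \<alpha> 4 * (edge_ind G i k * edge_ind G i l * edge_ind G j k * edge_ind G j l)"
proof -
  have e: "{i, j} - {k, l} = {i, j}" "{k, l} - {i, j} = {k, l}" "{i, j} \<union> {k, l} = {i, j, k, l}"
    using assms by auto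
  have c: "card {i, j, k, l} = 4" using assms by simp
  show ?thesis unfolding Nmat_def e c using assms by simp
qed

text \<open>For disjoint pairs this is the product of the four edge indicators. At coinciding
  indices it has no such meaning but still lies between 0 and 1; it is kept there so that the
  character expansion runs over all quadruples, and the excess is charged to
  \<open>overlap\<close>.\<close>

definition cross4 :: "nat set set \<Rightarrow> nat \<Rightarrow> nat \<Rightarrow> nat \<Rightarrow> nat \<Rightarrow> real" where
  "cross4 G i j k l = (1 + edge_sign G i k) * (1 + edge_sign G i l) * (1 + edge_sign G j k) * (1 + edge_sign G j l) / 16"

text \<open>For \<open>i \<noteq> j\<close> and \<open>k \<noteq> l\<close> this is the number of
  common vertices. As a form in a symmetric \<open>u\<close> it is four times the sum of the squared
  row sums, hence nonnegative.\<close>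

definition overlap :: "nat \<Rightarrow> nat \<Rightarrow> nat \<Rightarrow> nat \<Rightarrow> real" where
  "overlap i j k l = of_bool (i = k) + of_bool (i = l) + of_bool (j = k) + of_bool (j = l)"

definition same_pair :: "nat \<Rightarrow> nat \<Rightarrow> nat \<Rightarrow> nat \<Rightarrow> real" where
  "same_pair i j k l = of_bool (i = k \<and> j = l) + of_bool (i = l \<and> j = k)"

lemma cross4_bounds: "0 \<le> cross4 G i j k l" "cross4 G i j k l \<le> 1"
proof -
  have e: "0 \<le> (1 + edge_sign G p q) / 2" "(1 + edge_sign G p q) / 2 \<le> 1" for p q
    by (auto simp: edge_sign_def)
  have eq: "cross4 G i j k l = (1 + edge_sign G i k) / 2 * ((1 + edge_sign G i l) / 2) *
    ((1 + edge_sign G j k) / 2) * ((1 + edge_sign G j l) / 2)"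
    by (simp add: cross4_def)
  show "0 \<le> cross4 G i j k l" unfolding eq by (intro mult_nonneg_nonneg e)
  show "cross4 G i j k l \<le> 1" unfolding eq by (intro mult_le_one mult_nonneg_nonneg e)
qed

lemma pair_cases:
  assumes "i \<noteq> j" "k \<noteq> l"
  obtains (same) "{i, j} = {k, l}" "overlap i j k l = 2" "same_pair i j k l = 1"
    | (share) c p q where "{i, j} = {c, p}" "{k, l} = {c, q}" "distinct [c, p, q]"
        "overlap i j k l = 1" "same_pair i j k l = 0"
    | (disj) "distinct [i, j, k, l]" "overlap i j k l = 0" "same_pair i j k l = 0"
proof -
  consider "i = k \<and> j = l \<or> i = l \<and> j = k" | "i = k" "j \<noteq> l" | "i = l" "j \<noteq> k" | "j = k" "i \<noteq> l"
    | "j = l" "i \<noteq> k" | "distinct [i, j, k, l]"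
    using assms by fastforce
  thus ?thesis
  proof cases
    case 1 thus ?thesis using assms by (intro same) (auto simp: overlap_def same_pair_def)
  next
    case 2 thus ?thesis using assms by (intro share[of i j l]) (auto simp: overlap_def same_pair_def)
  next
    case 3 thus ?thesis using assms by (intro share[of i j k]) (auto simp: overlap_def same_pair_def)
  next
    case 4 thus ?thesis using assms by (intro share[of j i l]) (auto simp: overlap_def same_pair_def)
  next
    case 5 thus ?thesis using assms by (intro share[of j i k]) (auto simp: overlap_def same_pair_def)
  next
    case 6 thus ?thesis by (intro disj) (auto simp: overlap_def same_pair_def)
  qed
qed

lemma Hmat22_pair:
  assumes "{i, j} \<in> ksubsets n 2" "{k, l} \<in> ksubsets n 2"
  shows "Hmat n \<alpha> 2 2 G {i, j} {k, l} = Nmat \<alpha> G {i, j} {k, l} - (\<alpha> 2)\<^sup>2"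
  using assms by (auto simp: Hmat_def submat_def Amat_def ksubsets_def power2_eq_square)

text \<open>Without conjugation the crude error \<alpha>3 at overlapping pairs is affordable: its
  form is at most \<open>4 * n * \<alpha> 3\<close> times the Frobenius norm squared, of order
  \<open>L\<^sup>-\<^sup>4\<^sup>8 / sqrt n\<close>.\<close>

lemma Hmat22_approx:
  assumes P: "{i, j} \<in> ksubsets n 2" "{k, l} \<in> ksubsets n 2" and \<alpha>: "0 \<le> \<alpha> 4" "\<alpha> 4 \<le> \<alpha> 3"
  shows "\<bar>Hmat n \<alpha> 2 2 G {i, j} {k, l} - (\<alpha> 4 * cross4 G i j k l - (\<alpha> 2)\<^sup>2 + \<alpha> 2 * same_pair i j k l)\<bar>
    \<le> \<alpha> 3 * overlap i j k l"
proof -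
  have ne: "i \<noteq> j" "k \<noteq> l" using P by (auto simp: ksubsets_2_iff)
  have c: "0 \<le> \<alpha> 4 * cross4 G i j k l" "\<alpha> 4 * cross4 G i j k l \<le> \<alpha> 3"
    using \<alpha> cross4_bounds[of G i j k l] mult_left_le[of "cross4 G i j k l" "\<alpha> 4"] by auto
  from ne show ?thesis
  proof (cases rule: pair_cases)
    case same
    have "card {k, l} = 2" using ne by simp
    hence "Hmat n \<alpha> 2 2 G {i, j} {k, l} = \<alpha> 2 - (\<alpha> 2)\<^sup>2"
      unfolding Hmat22_pair[OF P] unfolding same(1) by (simp add: Nmat_same)
    thus ?thesis using same(2,3) c \<alpha> by simp
  next
    case (share c p q)
    have "Hmat n \<alpha> 2 2 G {i, j} {k, l} = \<alpha> 3 * edge_ind G p q - (\<alpha> 2)\<^sup>2"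
      unfolding Hmat22_pair[OF P] unfolding share(1,2) Nmat_share[OF share(3)] ..
    moreover have "0 \<le> \<alpha> 3 * edge_ind G p q" "\<alpha> 3 * edge_ind G p q \<le> \<alpha> 3"
      using \<alpha> by (auto simp: edge_ind_def)
    ultimately show ?thesis unfolding share(4,5) using c \<alpha> by (simp add: abs_le_iff)
  next
    case disj
    hence "Hmat n \<alpha> 2 2 G {i, j} {k, l} = \<alpha> 4 * cross4 G i j k l - (\<alpha> 2)\<^sup>2"
      unfolding Hmat22_pair[OF P] Nmat_disjoint[OF disj(1)] by (simp add: edge_ind_eq cross4_def)
    thus ?thesis using disj by simp
  qed
qed

definition Mmat :: "nat \<Rightarrow> (nat \<Rightarrow> real) \<Rightarrow> nat set set \<Rightarrow> nat set rmat" where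
  "Mmat n \<alpha> G = (\<lambda>A B. Hmat n \<alpha> 2 2 G A B + 1/16 * (\<alpha> 2)\<^sup>2 * Jmat A B - Kmat n \<alpha> G A B)"

lemma Mmat_eq:
  "Mmat n \<alpha> G A B = (if A \<inter> B = {} then Hmat n \<alpha> 2 2 G A B else EH22 n \<alpha> A B) + 1/16 * (\<alpha> 2)\<^sup>2"
  by (simp add: Mmat_def Kmat_def Qmat_def Jmat_def)

text \<open>Removing \<open>Kmat\<close> leaves overlapping entries at their expectation, so the
  mean \<open>\<alpha> 3 / 2\<close> of a shared entry is kept exactly and only the spurious
  \<open>cross4\<close> is an error. The coefficient \<open>\<alpha> 2 - \<alpha> 3\<close> of
  \<open>same_pair\<close> corrects for equal pairs having overlap 2.\<close>

lemma Mmat_approx: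
  assumes P: "{i, j} \<in> ksubsets n 2" "{k, l} \<in> ksubsets n 2" and \<alpha>: "0 \<le> \<alpha> 4"
  shows "\<bar>Mmat n \<alpha> G {i, j} {k, l} - (\<alpha> 4 * cross4 G i j k l - 15/16 * (\<alpha> 2)\<^sup>2 + \<alpha> 3 / 2 * overlap i j k l
      + (\<alpha> 2 - \<alpha> 3) * same_pair i j k l)\<bar> \<le> \<alpha> 4 * overlap i j k l"
proof -
  have ne: "i \<noteq> j" "k \<noteq> l" using P by (auto simp: ksubsets_2_iff)
  have c: "0 \<le> \<alpha> 4 * cross4 G i j k l" "\<alpha> 4 * cross4 G i j k l \<le> \<alpha> 4"
    using \<alpha> cross4_bounds[of G i j k l] mult_left_le[of "cross4 G i j k l" "\<alpha> 4"] by auto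
  from ne show ?thesis
  proof (cases rule: pair_cases)
    case same
    have "card {k, l} = 2" using ne by simp
    hence "Hmat n \<alpha> 2 2 G {i, j} {k, l} = \<alpha> 2 - (\<alpha> 2)\<^sup>2" for G
      unfolding Hmat22_pair[OF P] unfolding same(1) by (simp add: Nmat_same)
    hence "EH22 n \<alpha> {i, j} {k, l} = \<alpha> 2 - (\<alpha> 2)\<^sup>2" by (simp add: EH22_def)
    moreover have int: "{i, j} \<inter> {k, l} \<noteq> {}" unfolding same(1) by simp
    ultimately have "Mmat n \<alpha> G {i, j} {k, l} = \<alpha> 2 - 15/16 * (\<alpha> 2)\<^sup>2"
      unfolding Mmat_eq if_not_P[OF int] by simp
    thus ?thesis unfolding same(2,3) using c \<alpha> by (simp add: abs_le_iff)
  next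
    case (share c p q)
    have pq: "p \<in> {1..n}" "q \<in> {1..n}" "p \<noteq> q"
      using P share(3) unfolding share(1,2) ksubsets_2_iff by auto
    have "Hmat n \<alpha> 2 2 G {i, j} {k, l} = \<alpha> 3 * edge_ind G p q - (\<alpha> 2)\<^sup>2" for G
      unfolding Hmat22_pair[OF P] unfolding share(1,2) Nmat_share[OF share(3)] ..
    hence "EH22 n \<alpha> {i, j} {k, l} = \<alpha> 3 / 2 - (\<alpha> 2)\<^sup>2"
      unfolding EH22_def using expectation_edge_ind[OF pq(3,1,2), of "\<alpha> 3" "(\<alpha> 2)\<^sup>2"] by simp
    moreover have int: "{i, j} \<inter> {k, l} \<noteq> {}" unfolding share(1,2) by simp
    ultimately have "Mmat n \<alpha> G {i, j} {k, l} = \<alpha> 3 / 2 - 15/16 * (\<alpha> 2)\<^sup>2"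
      unfolding Mmat_eq if_not_P[OF int] by simp
    thus ?thesis unfolding share(4,5) using c \<alpha> by (simp add: abs_le_iff)
  next
    case disj
    hence "Hmat n \<alpha> 2 2 G {i, j} {k, l} = \<alpha> 4 * cross4 G i j k l - (\<alpha> 2)\<^sup>2"
      unfolding Hmat22_pair[OF P] Nmat_disjoint[OF disj(1)] by (simp add: edge_ind_eq cross4_def)
    moreover have "{i, j} \<inter> {k, l} = {}" using disj(1) by auto
    ultimately have "Mmat n \<alpha> G {i, j} {k, l} = \<alpha> 4 * cross4 G i j k l - 15/16 * (\<alpha> 2)\<^sup>2" by (simp add: Mmat_eq)
    thus ?thesis using disj by simp
  qed
qed

section \<open>Forms of the coincidence patterns\<close>

lemma quad_overlap:
  assumes V: "finite V" and u: "\<And>i j. u i j = u j i"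
  shows "quad V u overlap = 4 * (\<Sum>i\<in>V. (\<Sum>j\<in>V. u i j)\<^sup>2)"
proof -
  note sl = quad_swap_left[of u V, OF u] and sr = quad_swap_right[of u V, OF u]
  have 1: "quad V u (\<lambda>i j k l. of_bool (i = l)) = quad V u (\<lambda>i j k l. of_bool (i = k))"
    using sr[of "\<lambda>i j k l. of_bool (i = k)"] by simp
  have 2: "quad V u (\<lambda>i j k l. of_bool (j = k)) = quad V u (\<lambda>i j k l. of_bool (i = k))"
    using sl[of "\<lambda>i j k l. of_bool (i = k)"] by simp
  have 3: "quad V u (\<lambda>i j k l. of_bool (j = l)) = quad V u (\<lambda>i j k l. of_bool (i = k))"
    using sl[of "\<lambda>i j k l. of_bool (i = l)"] 1 by simp
  have "quad V u (\<lambda>i j k l. of_bool (i = k)) = (\<Sum>i\<in>V. \<Sum>j\<in>V. \<Sum>k\<in>V. if i = k then \<Sum>l\<in>V. u i j * u k l else 0)"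
    unfolding quad_def by (rule sum.cong[OF refl], rule sum.cong[OF refl], rule sum.cong[OF refl]) simp
  also have "\<dots> = (\<Sum>i\<in>V. \<Sum>j\<in>V. \<Sum>l\<in>V. u i j * u i l)"
    by (rule sum.cong[OF refl], rule sum.cong[OF refl]) (use V in simp)
  also have "\<dots> = (\<Sum>i\<in>V. (\<Sum>j\<in>V. u i j)\<^sup>2)"
    by (simp add: power2_eq_square sum_product)
  finally have 0: "quad V u (\<lambda>i j k l. of_bool (i = k)) = (\<Sum>i\<in>V. (\<Sum>j\<in>V. u i j)\<^sup>2)" .
  have "quad V u overlap = quad V u (\<lambda>i j k l. of_bool (i = k) + of_bool (i = l) + of_bool (j = k) + of_bool (j = l))"
    by (rule arg_cong[where f = "quad V u"]) (intro ext, simp only: overlap_def)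
  thus ?thesis unfolding quad_add 1 2 3 0 by simp
qed

lemma quad_same_pair:
  assumes V: "finite V" and u: "\<And>i j. u i j = u j i"
  shows "quad V u same_pair = 2 * frob2 V u"
proof -
  have *: "(\<Sum>k\<in>V. \<Sum>l\<in>V. u i j * u k l * of_bool (i = k \<and> j = l)) = (u i j)\<^sup>2" if "i \<in> V" "j \<in> V" for i j
  proof -
    have "(\<Sum>k\<in>V. \<Sum>l\<in>V. u i j * u k l * of_bool (i = k \<and> j = l)) = (\<Sum>k\<in>V. if i = k then (\<Sum>l\<in>V. if j = l then u i j * u i j else 0) else 0)"
      by (intro sum.cong refl) (auto intro!: sum.cong)
    also have "\<dots> = (u i j)\<^sup>2" using V that by (simp add: power2_eq_square)
    finally show ?thesis .
  qed
  have 0: "quad V u (\<lambda>i j k l. of_bool (i = k \<and> j = l)) = frob2 V u"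
    unfolding quad_def frob2_def by (intro sum.cong refl *)
  have 1: "quad V u (\<lambda>i j k l. of_bool (i = l \<and> j = k)) = quad V u (\<lambda>i j k l. of_bool (i = k \<and> j = l))"
    using quad_swap_right[of u V "\<lambda>i j k l. of_bool (i = k \<and> j = l)", OF u] by simp
  have "quad V u same_pair = quad V u (\<lambda>i j k l. of_bool (i = k \<and> j = l) + of_bool (i = l \<and> j = k))"
    by (rule arg_cong[where f = "quad V u"]) (intro ext, simp only: same_pair_def)
  thus ?thesis unfolding quad_add 0 1 by simp
qed

text \<open>The difference is dominated by the overlap form of the absolute values of
  \<open>u\<close>, whose row sums Cauchy-Schwarz bounds. The zero diagonal of \<open>u\<close>
  disposes of index pairs that are not edges.\<close>

lemma quad_mono_overlap:
  fixes c :: real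
  assumes V: "finite V" and u: "\<And>i j. u i j = u j i" and u0: "\<And>i. u i i = 0"
    and c: "0 \<le> c"
    and h: "\<And>i j k l. i \<in> V \<Longrightarrow> j \<in> V \<Longrightarrow> k \<in> V \<Longrightarrow> l \<in> V \<Longrightarrow> i \<noteq> j \<Longrightarrow> k \<noteq> l \<Longrightarrow>
      \<bar>f i j k l - g i j k l\<bar> \<le> c * overlap i j k l"
  shows "quad V u f \<ge> quad V u g - 4 * card V * c * frob2 V u"
proof -
  let ?a = "\<lambda>i j. \<bar>u i j\<bar>"
  have "quad V u g - quad V u f \<le> quad V ?a (\<lambda>i j k l. c * overlap i j k l)"
    unfolding quad_def sum_subtractf[symmetric]
  proof (intro sum_mono)
    fix i j k l assume m: "i \<in> V" "j \<in> V" "k \<in> V" "l \<in> V"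
    show "u i j * u k l * g i j k l - u i j * u k l * f i j k l \<le> \<bar>u i j\<bar> * \<bar>u k l\<bar> * (c * overlap i j k l)"
    proof (cases "i = j \<or> k = l")
      case True thus ?thesis using u0 by auto
    next
      case False
      have "u i j * u k l * g i j k l - u i j * u k l * f i j k l \<le> \<bar>u i j * u k l * (f i j k l - g i j k l)\<bar>"
        by (simp add: algebra_simps abs_le_iff)
      also have "\<dots> = \<bar>u i j\<bar> * \<bar>u k l\<bar> * \<bar>f i j k l - g i j k l\<bar>" by (simp add: abs_mult)
      also have "\<dots> \<le> \<bar>u i j\<bar> * \<bar>u k l\<bar> * (c * overlap i j k l)"
        using h m False by (intro mult_left_mono) auto
      finally show ?thesis .
    qed
  qed
  also have "\<dots> = c * (4 * (\<Sum>i\<in>V. (\<Sum>j\<in>V. \<bar>u i j\<bar>)\<^sup>2))"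
    unfolding quad_cmult using quad_overlap[of V ?a] V u by simp
  also have "\<dots> \<le> c * (4 * (\<Sum>i\<in>V. card V * (\<Sum>j\<in>V. (u i j)\<^sup>2)))"
  proof (intro mult_left_mono sum_mono)
    fix i
    show "(\<Sum>j\<in>V. \<bar>u i j\<bar>)\<^sup>2 \<le> card V * (\<Sum>j\<in>V. (u i j)\<^sup>2)"
      using sum_row_sq_le[of "\<lambda>j. \<bar>u i j\<bar>" V] by simp
  qed (use c in auto)
  finally show ?thesis by (simp add: frob2_def sum_distrib_left[symmetric] mult_ac)
qed

lemma quad_cross4:
  assumes u: "\<And>i j. u i j = u j i"
  shows "quad V u (cross4 G) = (quad V u (\<lambda>i j k l. 1) + 4 * quad V u (\<lambda>i j k l. edge_sign G i k)
    + 4 * quad V u (\<lambda>i j k l. edge_sign G i k * edge_sign G i l) + 2 * quad V u (\<lambda>i j k l. edge_sign G i k * edge_sign G j l)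
    + 4 * quad V u (\<lambda>i j k l. edge_sign G i k * edge_sign G i l * edge_sign G j k)
    + quad V u (\<lambda>i j k l. edge_sign G i k * edge_sign G i l * edge_sign G j k * edge_sign G j l)) / 16"
proof -
  have cr: "cross4 G = (\<lambda>i j k l. (1/16) * ((1 + edge_sign G i k) * (1 + edge_sign G i l) * (1 + edge_sign G j k) * (1 + edge_sign G j l)))"
    by (intro ext) (simp add: cross4_def)
  show ?thesis unfolding cr quad_cmult quad_expand[of u "edge_sign G" V, OF u edge_sign_sym] by simp
qed

section \<open>Lower bound for the modified block\<close>

definition offdiag :: "(nat set \<Rightarrow> real) \<Rightarrow> nat \<Rightarrow> nat \<Rightarrow> real" where
  "offdiag w i j = (if i = j then 0 else w {i, j})"

lemma offdiag_sym: "offdiag w i j = offdiag w j i"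
  by (simp add: offdiag_def insert_commute)

lemma offdiag_same: "offdiag w i i = 0"
  by (simp add: offdiag_def)

lemma pair_form_eq_quad:
  "4 * (\<Sum>A\<in>ksubsets n 2. \<Sum>B\<in>ksubsets n 2. w A * X A B * w B)
    = quad {1..n} (offdiag w) (\<lambda>i j k l. X {i, j} {k, l})"
proof -
  have "4 * (\<Sum>A\<in>ksubsets n 2. \<Sum>B\<in>ksubsets n 2. w A * X A B * w B)
    = 2 * (\<Sum>A\<in>ksubsets n 2. 2 * (\<Sum>B\<in>ksubsets n 2. w A * X A B * w B))"
    by (simp add: sum_distrib_left)
  also have "\<dots> = (\<Sum>i\<in>{1..n}. \<Sum>j\<in>{1..n}. if i = j then 0 else 2 * (\<Sum>B\<in>ksubsets n 2. w {i, j} * X {i, j} B * w B))"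
    by (rule sum_ksubsets_2[symmetric])
  also have "\<dots> = quad {1..n} (offdiag w) (\<lambda>i j k l. X {i, j} {k, l})"
    unfolding quad_def
  proof (rule sum.cong[OF refl], rule sum.cong[OF refl])
    fix i j
    show "(if i = j then 0 else 2 * (\<Sum>B\<in>ksubsets n 2. w {i, j} * X {i, j} B * w B))
      = (\<Sum>k\<in>{1..n}. \<Sum>l\<in>{1..n}. offdiag w i j * offdiag w k l * X {i, j} {k, l})"
    proof (cases "i = j")
      case True thus ?thesis by (simp add: offdiag_same)
    next
      case False
      have "2 * (\<Sum>B\<in>ksubsets n 2. w {i, j} * X {i, j} B * w B)
        = (\<Sum>k\<in>{1..n}. \<Sum>l\<in>{1..n}. if k = l then 0 else w {i, j} * X {i, j} {k, l} * w {k, l})"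
        by (rule sum_ksubsets_2[symmetric])
      also have "\<dots> = (\<Sum>k\<in>{1..n}. \<Sum>l\<in>{1..n}. offdiag w i j * offdiag w k l * X {i, j} {k, l})"
        using False by (intro sum.cong refl) (simp add: offdiag_def)
      finally show ?thesis using False by simp
    qed
  qed
  finally show ?thesis .
qed

lemma mat_prod_diag:
  assumes "finite P" "A \<in> P" "B \<in> P"
  shows "mat_prod P (mat_prod P (Defs.mat_diag v) M) (Defs.mat_diag v) A B = v A * M A B * v B"
proof -
  have "(\<Sum>C'\<in>P. Defs.mat_diag v A C' * M C' C) = v A * M A C" for C
  proof -
    have "(\<Sum>C'\<in>P. Defs.mat_diag v A C' * M C' C) = (\<Sum>C'\<in>P. if A = C' then v A * M A C else 0)"
      by (intro sum.cong refl) (simp add: Defs.mat_diag_def)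
    thus ?thesis using assms by simp
  qed
  moreover have "(\<Sum>C\<in>P. (v A * M A C) * Defs.mat_diag v C B) = v A * M A B * v B"
  proof -
    have "(\<Sum>C\<in>P. (v A * M A C) * Defs.mat_diag v C B) = (\<Sum>C\<in>P. if C = B then v A * M A B * v B else 0)"
      by (intro sum.cong refl) (simp add: Defs.mat_diag_def)
    thus ?thesis using assms by simp
  qed
  ultimately show ?thesis by (simp add: mat_prod_def)
qed

lemma H22'_entry:
  assumes "A \<in> ksubsets n 2" "B \<in> ksubsets n 2"
  shows "H22' n \<alpha> \<beta> G A B = Hmat n \<alpha> 2 2 G A B
    + \<beta> * (\<Sum>x\<in>{1..n}. avec G x A * Mmat n \<alpha> G A B * avec G x B)"
  using assms unfolding H22'_def Let_def Dmat_def
  by (simp add: mat_prod_diag Mmat_def)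

lemma offdiag_avec:
  "offdiag (\<lambda>A. avec G x A * w A) i j = edge_sign G x i * offdiag w i j * edge_sign G x j"
  by (simp add: offdiag_def avec_def)

lemma H22'_form:
  "4 * (\<Sum>A\<in>ksubsets n 2. \<Sum>B\<in>ksubsets n 2. w A * H22' n \<alpha> \<beta> G A B * w B) =
    quad {1..n} (offdiag w) (\<lambda>i j k l. Hmat n \<alpha> 2 2 G {i, j} {k, l})
    + \<beta> * (\<Sum>x\<in>{1..n}. quad {1..n} (\<lambda>i j. edge_sign G x i * offdiag w i j * edge_sign G x j)
         (\<lambda>i j k l. Mmat n \<alpha> G {i, j} {k, l}))"
proof -
  let ?P = "ksubsets n 2"
  have "(\<Sum>A\<in>?P. \<Sum>B\<in>?P. w A * H22' n \<alpha> \<beta> G A B * w B) =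
    (\<Sum>A\<in>?P. \<Sum>B\<in>?P. w A * Hmat n \<alpha> 2 2 G A B * w B
      + \<beta> * (\<Sum>x\<in>{1..n}. (avec G x A * w A) * Mmat n \<alpha> G A B * (avec G x B * w B)))"
    by (intro sum.cong refl) (simp add: H22'_entry algebra_simps sum_distrib_left)
  also have "\<dots> = (\<Sum>A\<in>?P. \<Sum>B\<in>?P. w A * Hmat n \<alpha> 2 2 G A B * w B)
      + \<beta> * (\<Sum>A\<in>?P. \<Sum>B\<in>?P. \<Sum>x\<in>{1..n}. (avec G x A * w A) * Mmat n \<alpha> G A B * (avec G x B * w B))"
    by (simp add: sum.distrib sum_distrib_left)
  also have "(\<Sum>A\<in>?P. \<Sum>B\<in>?P. \<Sum>x\<in>{1..n}. (avec G x A * w A) * Mmat n \<alpha> G A B * (avec G x B * w B))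
    = (\<Sum>A\<in>?P. \<Sum>x\<in>{1..n}. \<Sum>B\<in>?P. (avec G x A * w A) * Mmat n \<alpha> G A B * (avec G x B * w B))"
    by (rule sum.cong[OF refl], rule sum.swap)
  also have "\<dots> = (\<Sum>x\<in>{1..n}. \<Sum>A\<in>?P. \<Sum>B\<in>?P. (avec G x A * w A) * Mmat n \<alpha> G A B * (avec G x B * w B))"
    by (rule sum.swap)
  finally have "4 * (\<Sum>A\<in>?P. \<Sum>B\<in>?P. w A * H22' n \<alpha> \<beta> G A B * w B) =
    4 * (\<Sum>A\<in>?P. \<Sum>B\<in>?P. w A * Hmat n \<alpha> 2 2 G A B * w B)
    + \<beta> * (\<Sum>x\<in>{1..n}. 4 * (\<Sum>A\<in>?P. \<Sum>B\<in>?P. (avec G x A * w A) * Mmat n \<alpha> G A B * (avec G x B * w B)))"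
    by (simp add: sum_distrib_left algebra_simps)
  moreover have "offdiag (\<lambda>A. avec G x A * w A) = (\<lambda>i j. edge_sign G x i * offdiag w i j * edge_sign G x j)" for x
    by (intro ext offdiag_avec)
  ultimately show ?thesis unfolding pair_form_eq_quad by simp
qed

text \<open>Conjugation by \<open>x\<close> preserves the square of \<open>u i j\<close> except for
  \<open>x = i\<close> and \<open>x = j\<close>, where it erases it. This is the source of the
  multiple of order \<beta> n \<alpha>2 of the identity.\<close>

lemma sum_frob2_sandwich:
  assumes u0: "\<And>i. u i i = 0"
  shows "(\<Sum>x\<in>{1..n}. frob2 {1..n} (\<lambda>i j. edge_sign G x i * u i j * edge_sign G x j)) = (real n - 2) * frob2 {1..n} u"
proof -
  have "(\<Sum>x\<in>{1..n}. frob2 {1..n} (\<lambda>i j. edge_sign G x i * u i j * edge_sign G x j))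
    = (\<Sum>i\<in>{1..n}. \<Sum>x\<in>{1..n}. \<Sum>j\<in>{1..n}. (edge_sign G x i * u i j * edge_sign G x j)\<^sup>2)"
    unfolding frob2_def by (rule sum.swap)
  also have "\<dots> = (\<Sum>i\<in>{1..n}. \<Sum>j\<in>{1..n}. \<Sum>x\<in>{1..n}. (edge_sign G x i * u i j * edge_sign G x j)\<^sup>2)"
    by (rule sum.cong[OF refl], rule sum.swap)
  also have "\<dots> = (\<Sum>i\<in>{1..n}. \<Sum>j\<in>{1..n}. (real n - 2) * (u i j)\<^sup>2)"
  proof (rule sum.cong[OF refl], rule sum.cong[OF refl])
    fix i j assume ij: "i \<in> {1..n}" "j \<in> {1..n}"
    show "(\<Sum>x\<in>{1..n}. (edge_sign G x i * u i j * edge_sign G x j)\<^sup>2) = (real n - 2) * (u i j)\<^sup>2"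
    proof (cases "i = j")
      case True thus ?thesis by (simp add: u0)
    next
      case False
      have "(\<Sum>x\<in>{1..n}. (edge_sign G x i * u i j * edge_sign G x j)\<^sup>2) = (\<Sum>x\<in>{1..n} - {i, j}. (u i j)\<^sup>2)"
        by (rule sum.mono_neutral_cong_right) (auto simp: power_mult_distrib edge_sign_sq)
      also have "\<dots> = real (card ({1..n} - {i, j})) * (u i j)\<^sup>2" by simp
      also have "card ({1..n} - {i, j}) = n - 2"
        using ij False by (subst card_Diff_subset) auto
      also have "real (n - 2) = real n - 2"
      proof -
        have "card {i, j} \<le> card {1..n}" using ij by (intro card_mono) auto
        thus ?thesis using False by (simp add: of_nat_diff)
      qed
      finally show ?thesis .
    qed
  qed
  finally show ?thesis by (simp add: frob2_def sum_distrib_left)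
qed

lemma weighted_sum_lower:
  fixes s :: real
  assumes "\<bar>b1\<bar> \<le> B1" "\<bar>b2\<bar> \<le> B2" "\<bar>b3\<bar> \<le> B3" "\<bar>b4\<bar> \<le> B4" "\<bar>b5\<bar> \<le> B5"
  shows "s - (4 * B1 + 4 * B2 + 2 * B3 + 4 * B4 + B5) \<le> s + 4 * b1 + 4 * b2 + 2 * b3 + 4 * b4 + b5"
  using assms by linarith

text \<open>The square of the total sum keeps its own coefficient: it is needed against the rank-one
  part of the rectangular block. In the error, 5 collects four stars and the cycle, and 6 two
  matchings and four paths.\<close>

lemma H22_quad_lower:
  assumes op: "op_bounded {1..n} (edge_sign G) lam" and \<alpha>: "0 \<le> \<alpha> 4" "\<alpha> 4 \<le> \<alpha> 3"
    and u: "\<And>i j. u i j = u j i" and u0: "\<And>i. u i i = 0"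
  shows "quad {1..n} u (\<lambda>i j k l. Hmat n \<alpha> 2 2 G {i, j} {k, l}) \<ge>
    (\<alpha> 4 / 16 - (\<alpha> 2)\<^sup>2) * (\<Sum>i\<in>{1..n}. \<Sum>j\<in>{1..n}. u i j)\<^sup>2
    + (2 * \<alpha> 2 - 4 * n * \<alpha> 3 - \<alpha> 4 / 16 * (4 * lam * n + 5 * sqrt n * lam\<^sup>2 + 6 * lam\<^sup>2)) * frob2 {1..n} u"
proof -
  interpret op_bounded "{1..n}" "edge_sign G" lam by (rule op)
  let ?V = "{1..n}"
  let ?a = "edge_sign G"
  let ?N = "frob2 ?V u"
  let ?f = "\<lambda>i j k l. Hmat n \<alpha> 2 2 G {i, j} {k, l}"
  let ?g = "\<lambda>i j k l. \<alpha> 4 * cross4 G i j k l + ((- ((\<alpha> 2)\<^sup>2)) * 1 + \<alpha> 2 * same_pair i j k l)"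
  have 1: "quad ?V u ?f \<ge> quad ?V u ?g - 4 * card ?V * \<alpha> 3 * ?N"
  proof (rule quad_mono_overlap[OF _ u u0])
    fix i j k l assume "i \<in> ?V" "j \<in> ?V" "k \<in> ?V" "l \<in> ?V" "i \<noteq> j" "k \<noteq> l"
    hence P: "{i, j} \<in> ksubsets n 2" "{k, l} \<in> ksubsets n 2" unfolding ksubsets_2_iff by auto
    show "\<bar>?f i j k l - ?g i j k l\<bar> \<le> \<alpha> 3 * overlap i j k l"
      using Hmat22_approx[OF P, of \<alpha> G, OF \<alpha>] by (simp add: algebra_simps)
  qed (use \<alpha> in auto)
  have sp: "quad ?V u (\<lambda>i j k l. same_pair i j k l) = 2 * ?N"
    using quad_same_pair[of ?V u, OF _ u] by (simp add: eta_contract_eq)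
  have 2: "quad ?V u ?g = \<alpha> 4 * quad ?V u (cross4 G) - (\<alpha> 2)\<^sup>2 * quad ?V u (\<lambda>i j k l. 1) + 2 * \<alpha> 2 * ?N"
    unfolding quad_add quad_cmult sp by simp
  have r: "(\<Sum>i\<in>?V. (\<Sum>j\<in>?V. u i j)\<^sup>2) \<le> n * ?N" using sum_rows_sq_le[of u] by simp
  have e1: "\<bar>quad ?V u (\<lambda>i j k l. ?a i k)\<bar> \<le> lam * (n * ?N)"
    by (rule order.trans[OF quad_edge]) (intro mult_left_mono r lam_nonneg)
  have e2: "\<bar>quad ?V u (\<lambda>i j k l. ?a i k * ?a i l)\<bar> \<le> sqrt n * lam\<^sup>2 * ?N"
  proof -
    have "\<bar>quad ?V u (\<lambda>i j k l. ?a i k * ?a i l)\<bar> \<le> sqrt (n * ?N) * (lam\<^sup>2 * sqrt ?N)"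
      by (rule order.trans[OF quad_star]) (intro mult_right_mono real_sqrt_le_mono r; simp)
    also have "\<dots> = sqrt n * lam\<^sup>2 * (sqrt ?N * sqrt ?N)" by (simp only: real_sqrt_mult mult_ac)
    finally show ?thesis by simp
  qed
  have e5: "\<bar>quad ?V u (\<lambda>i j k l. ?a i k * ?a i l * ?a j k * ?a j l)\<bar> \<le> sqrt n * lam\<^sup>2 * ?N"
    using quad_cycle[of u] by simp
  note es = e1 e2 quad_matching[of u] quad_path[of u] e5
  have "16 * quad ?V u (cross4 G) \<ge> quad ?V u (\<lambda>i j k l. 1)
      - (4 * (lam * (n * ?N)) + 4 * (sqrt n * lam\<^sup>2 * ?N) + 2 * (lam\<^sup>2 * ?N) + 4 * (lam\<^sup>2 * ?N) + sqrt n * lam\<^sup>2 * ?N)"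
    using weighted_sum_lower[OF es] unfolding quad_cross4[of u, OF u] by simp
  hence "quad ?V u (cross4 G) \<ge> (quad ?V u (\<lambda>i j k l. 1)
      - (4 * lam * n + 5 * sqrt n * lam\<^sup>2 + 6 * lam\<^sup>2) * ?N) / 16"
    by (simp add: algebra_simps)
  hence "\<alpha> 4 * quad ?V u (cross4 G) \<ge> \<alpha> 4 * ((quad ?V u (\<lambda>i j k l. 1)
      - (4 * lam * n + 5 * sqrt n * lam\<^sup>2 + 6 * lam\<^sup>2) * ?N) / 16)"
    by (rule mult_left_mono) (rule \<alpha>)
  with 1 2 show ?thesis unfolding quad_one by (simp add: algebra_simps)
qed

text \<open>The conjugated all-ones forms have coefficient
  \<open>\<alpha> 4 / 16 - 15/16 * (\<alpha> 2)\<^sup>2\<close>, nonnegative by assumption, and the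
  mean overlap form is nonnegative, so both are dropped. The factor 15/16 is what remains of the
  \<open>- (\<alpha> 2)\<^sup>2\<close> in \<open>Hmat\<close> after the added multiple of
  \<open>Jmat\<close>.\<close>

lemma M_quad_sum_lower:
  assumes op: "op_bounded {1..n} (edge_sign G) lam" and qr: "quasirandom n (edge_sign G) L"
    and \<alpha>: "0 \<le> \<alpha> 4" "0 \<le> \<alpha> 3" "15 * (\<alpha> 2)\<^sup>2 \<le> \<alpha> 4"
    and u: "\<And>i j. u i j = u j i" and u0: "\<And>i. u i i = 0"
  shows "(\<Sum>x\<in>{1..n}. quad {1..n} (\<lambda>i j. edge_sign G x i * u i j * edge_sign G x j)
        (\<lambda>i j k l. Mmat n \<alpha> G {i, j} {k, l})) \<ge>
    ((2 * (\<alpha> 2 - \<alpha> 3) - 4 * n * \<alpha> 4) * (real n - 2)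
      - \<alpha> 4 / 16 * (4 * lam ^ 3 + 4 * sqrt n * lam ^ 3 + 6 * n * lam\<^sup>2
        + sqrt n * sqrt (real n ^ 3 * L\<^sup>2 + n * ((2 * L\<^sup>2 + 3) * n * gram_bound n L + (real n)\<^sup>2)))) * frob2 {1..n} u"
proof -
  interpret op_bounded "{1..n}" "edge_sign G" lam by (rule op)
  interpret q: quasirandom n "edge_sign G" L by (rule qr)
  let ?V = "{1..n}"
  let ?a = "edge_sign G"
  let ?N = "frob2 ?V u"
  define U where "U = (\<lambda>x i j. ?a x i * u i j * ?a x j)"
  define S where "S = (\<lambda>f. \<Sum>x\<in>?V. quad ?V (U x) f)"
  define e where "e = real n ^ 3 * L\<^sup>2 + n * ((2 * L\<^sup>2 + 3) * n * gram_bound n L + (real n)\<^sup>2)"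
  let ?f = "\<lambda>i j k l. Mmat n \<alpha> G {i, j} {k, l}"
  let ?g = "\<lambda>i j k l. \<alpha> 4 * cross4 G i j k l + ((- 15/16 * (\<alpha> 2)\<^sup>2) * 1 + (\<alpha> 3 / 2 * overlap i j k l
      + (\<alpha> 2 - \<alpha> 3) * same_pair i j k l))"
  have Us: "U x i j = U x j i" for x i j unfolding U_def by (simp add: u mult_ac)
  have U0: "U x i i = 0" for x i unfolding U_def by (simp add: u0)
  have fU: "(\<Sum>x\<in>?V. frob2 ?V (U x)) = (real n - 2) * ?N"
    unfolding U_def by (rule sum_frob2_sandwich) (rule u0)
  have 1: "quad ?V (U x) ?f \<ge> quad ?V (U x) ?g - 4 * card ?V * \<alpha> 4 * frob2 ?V (U x)" for x
  proof (rule quad_mono_overlap[OF _ Us U0])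
    fix i j k l assume "i \<in> ?V" "j \<in> ?V" "k \<in> ?V" "l \<in> ?V" "i \<noteq> j" "k \<noteq> l"
    hence P: "{i, j} \<in> ksubsets n 2" "{k, l} \<in> ksubsets n 2" unfolding ksubsets_2_iff by auto
    show "\<bar>?f i j k l - ?g i j k l\<bar> \<le> \<alpha> 4 * overlap i j k l"
      using Mmat_approx[OF P, of \<alpha> G, OF \<alpha>(1)] by (simp add: algebra_simps)
  qed (use \<alpha> in auto)
  have sp: "quad ?V (U x) (\<lambda>i j k l. same_pair i j k l) = 2 * frob2 ?V (U x)" for x
    using quad_same_pair[of ?V "U x", OF _ Us] by (simp add: eta_contract_eq)
  have ov: "quad ?V (U x) (\<lambda>i j k l. overlap i j k l) \<ge> 0" for x
    using quad_overlap[of ?V "U x", OF _ Us] by (simp add: eta_contract_eq sum_nonneg)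
  have 2: "quad ?V (U x) ?f \<ge> \<alpha> 4 * quad ?V (U x) (cross4 G) - 15/16 * (\<alpha> 2)\<^sup>2 * quad ?V (U x) (\<lambda>i j k l. 1)
      + (2 * (\<alpha> 2 - \<alpha> 3) - 4 * n * \<alpha> 4) * frob2 ?V (U x)" for x
  proof -
    have "0 \<le> \<alpha> 3 / 2 * quad ?V (U x) (\<lambda>i j k l. overlap i j k l)" using ov \<alpha> by simp
    thus ?thesis using 1[of x] unfolding quad_add quad_cmult sp by (simp add: algebra_simps)
  qed
  have "S ?f \<ge> (\<Sum>x\<in>?V. \<alpha> 4 * quad ?V (U x) (cross4 G) - 15/16 * (\<alpha> 2)\<^sup>2 * quad ?V (U x) (\<lambda>i j k l. 1)
      + (2 * (\<alpha> 2 - \<alpha> 3) - 4 * n * \<alpha> 4) * frob2 ?V (U x))"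
    unfolding S_def by (intro sum_mono 2)
  also have "(\<Sum>x\<in>?V. \<alpha> 4 * quad ?V (U x) (cross4 G) - 15/16 * (\<alpha> 2)\<^sup>2 * quad ?V (U x) (\<lambda>i j k l. 1)
      + (2 * (\<alpha> 2 - \<alpha> 3) - 4 * n * \<alpha> 4) * frob2 ?V (U x))
    = \<alpha> 4 * S (cross4 G) - 15/16 * (\<alpha> 2)\<^sup>2 * S (\<lambda>i j k l. 1) + (2 * (\<alpha> 2 - \<alpha> 3) - 4 * n * \<alpha> 4) * ((real n - 2) * ?N)"
    unfolding S_def fU[symmetric] by (simp add: sum.distrib sum_subtractf sum_distrib_left)
  finally have 3: "S ?f \<ge> \<alpha> 4 * S (cross4 G) - 15/16 * (\<alpha> 2)\<^sup>2 * S (\<lambda>i j k l. 1)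
    + (2 * (\<alpha> 2 - \<alpha> 3) - 4 * n * \<alpha> 4) * ((real n - 2) * ?N)" .
  have S1: "0 \<le> S (\<lambda>i j k l. 1)" unfolding S_def quad_one by (intro sum_nonneg) simp
  have e1: "\<bar>S (\<lambda>i j k l. ?a i k)\<bar> \<le> lam ^ 3 * ?N"
    unfolding S_def U_def by (rule sum_quad_edge)
  have e2: "\<bar>S (\<lambda>i j k l. ?a i k * ?a i l)\<bar> \<le> sqrt n * lam ^ 3 * ?N"
    unfolding S_def U_def using sum_quad_star[of u] by simp
  have e3: "\<bar>S (\<lambda>i j k l. ?a i k * ?a j l)\<bar> \<le> n * lam\<^sup>2 * ?N"
    unfolding S_def U_def using sum_quad_matching[of u] by simp
  have e4: "\<bar>S (\<lambda>i j k l. ?a i k * ?a i l * ?a j k)\<bar> \<le> n * lam\<^sup>2 * ?N"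
    unfolding S_def U_def using sum_quad_path[of u] by simp
  have e5: "\<bar>S (\<lambda>i j k l. ?a i k * ?a i l * ?a j k * ?a j l)\<bar> \<le> sqrt n * sqrt e * ?N"
    unfolding S_def U_def e_def by (rule q.sum_quad_cycle) (rule u0)
  have "16 * S (cross4 G) = S (\<lambda>i j k l. 1) + 4 * S (\<lambda>i j k l. ?a i k)
    + 4 * S (\<lambda>i j k l. ?a i k * ?a i l) + 2 * S (\<lambda>i j k l. ?a i k * ?a j l)
    + 4 * S (\<lambda>i j k l. ?a i k * ?a i l * ?a j k)
    + S (\<lambda>i j k l. ?a i k * ?a i l * ?a j k * ?a j l)"
    unfolding S_def quad_cross4[OF Us] sum_divide_distrib[symmetric] sum.distrib sum_distrib_left[symmetric] by simp
  hence "16 * S (cross4 G) \<ge> S (\<lambda>i j k l. 1)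
      - (4 * (lam ^ 3 * ?N) + 4 * (sqrt n * lam ^ 3 * ?N) + 2 * (n * lam\<^sup>2 * ?N) + 4 * (n * lam\<^sup>2 * ?N) + sqrt n * sqrt e * ?N)"
    using weighted_sum_lower[OF e1 e2 e3 e4 e5] by simp
  hence "S (cross4 G) \<ge> (S (\<lambda>i j k l. 1)
      - (4 * lam ^ 3 + 4 * sqrt n * lam ^ 3 + 6 * n * lam\<^sup>2 + sqrt n * sqrt e) * ?N) / 16"
    by (simp add: algebra_simps)
  hence 4: "\<alpha> 4 * S (cross4 G) \<ge> \<alpha> 4 * ((S (\<lambda>i j k l. 1)
      - (4 * lam ^ 3 + 4 * sqrt n * lam ^ 3 + 6 * n * lam\<^sup>2 + sqrt n * sqrt e) * ?N) / 16)"
    by (rule mult_left_mono) (rule \<alpha>)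
  have 5: "15/16 * (\<alpha> 2)\<^sup>2 * S (\<lambda>i j k l. 1) \<le> \<alpha> 4 / 16 * S (\<lambda>i j k l. 1)"
    using \<alpha>(3) by (intro mult_right_mono S1) simp
  have eq: "(\<Sum>x\<in>?V. quad ?V (\<lambda>i j. ?a x i * u i j * ?a x j) ?f) = S ?f"
    by (simp add: S_def U_def)
  show ?thesis unfolding eq e_def[symmetric] using 3 4 5 by (simp add: algebra_simps)
qed

section \<open>Schur complements\<close>

text \<open>The matrix is transported to an initial segment of the naturals; a vanishing determinant
  would yield a nonzero kernel vector, contrary to injectivity.\<close>

lemma inj_matrix_invertible_on:
  fixes X :: "'a rmat"
  assumes fin: "finite S"
    and inj: "\<And>v. (\<And>A. A \<in> S \<Longrightarrow> (\<Sum>B\<in>S. X A B * v B) = 0) \<Longrightarrow> (\<And>A. A \<in> S \<Longrightarrow> v A = 0)"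
  shows "invertible_on S X"
proof -
  define m where "m = card S"
  obtain f where f: "bij_betw f {0..<m} S"
    using ex_bij_betw_nat_finite[OF fin] unfolding m_def by blast
  define g where "g = inv_into {0..<m} f"
  have g: "bij_betw g S {0..<m}" unfolding g_def using f by (rule bij_betw_inv_into)
  have gf: "g (f i) = i" if "i < m" for i
    unfolding g_def using f that by (simp add: bij_betw_inv_into_left)
  have fg: "f (g A) = A" "g A < m" if "A \<in> S" for A
    using f g that unfolding g_def by (auto simp: bij_betw_inv_into_right bij_betw_def)
  have fS: "f i \<in> S" if "i < m" for i using f that by (auto simp: bij_betw_def)
  have tr: "(\<Sum>B\<in>S. h B) = (\<Sum>i<m. h (f i))" for h :: "'a \<Rightarrow> real"
    using sum.reindex_bij_betw[OF f, of h] by (simp add: lessThan_atLeast0)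
  define M where "M = mat m m (\<lambda>(i, j). X (f i) (f j))"
  have M: "M \<in> carrier_mat m m" by (simp add: M_def)
  have "det M \<noteq> 0"
  proof
    assume "det M = 0"
    then obtain v where v: "v \<in> carrier_vec m" "v \<noteq> 0\<^sub>v m" "M *\<^sub>v v = 0\<^sub>v m"
      using det_0_iff_vec_prod_zero[OF M] by blast
    have "v $ i = 0" if i: "i < m" for i
    proof -
      have "(\<Sum>B\<in>S. X A B * v $ (g B)) = 0" if A: "A \<in> S" for A
      proof -
        have "0 = (M *\<^sub>v v) $ (g A)" using v(3) fg(2)[OF A] by simp
        also have "\<dots> = (\<Sum>i<m. X A (f i) * v $ i)"
          using v(1) fg[OF A] by (simp add: M_def scalar_prod_def lessThan_atLeast0)
        also have "\<dots> = (\<Sum>B\<in>S. X A B * v $ (g B))" unfolding tr by (simp add: gf)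
        finally show ?thesis by simp
      qed
      from inj[OF this fS[OF i]] show ?thesis using gf[OF i] by simp
    qed
    hence "v = 0\<^sub>v m" using v(1) by (intro eq_vecI) auto
    thus False using v(2) by simp
  qed
  hence "M \<in> Units (ring_mat TYPE(real) m ())" by (rule det_non_zero_imp_unit[OF M])
  then obtain B where B: "B \<in> carrier_mat m m" "B * M = 1\<^sub>m m" "M * B = 1\<^sub>m m"
    unfolding Units_def ring_mat_def by auto
  define W where "W = (\<lambda>A A'. B $$ (g A, g A'))"
  have "is_inverse_on S X W"
    unfolding is_inverse_on_def mat_prod_def
  proof (intro ballI conjI)
    fix A A' assume A: "A \<in> S" "A' \<in> S"
    have gi: "g A = g A' \<longleftrightarrow> A = A'" using A fg by metis
    have "(\<Sum>C\<in>S. X A C * W C A') = (\<Sum>i<m. X A (f i) * B $$ (i, g A'))"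
      unfolding tr W_def by (simp add: gf)
    also have "\<dots> = (M * B) $$ (g A, g A')"
      using A fg B(1) by (simp add: M_def scalar_prod_def lessThan_atLeast0)
    finally show "(\<Sum>C\<in>S. X A C * W C A') = (if A = A' then 1 else 0)"
      unfolding B(3) using A fg gi by simp
    have "(\<Sum>C\<in>S. W A C * X C A') = (\<Sum>i<m. B $$ (g A, i) * X (f i) A')"
      unfolding tr W_def by (simp add: gf)
    also have "\<dots> = (B * M) $$ (g A, g A')"
      using A fg B(1) by (simp add: M_def scalar_prod_def lessThan_atLeast0)
    finally show "(\<Sum>C\<in>S. W A C * X C A') = (if A = A' then 1 else 0)"
      unfolding B(2) using A fg gi by simp
  qed
  thus ?thesis unfolding invertible_on_def by blast
qed

lemma pos_def_invertible_on:
  fixes X :: "'a rmat"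
  assumes fin: "finite S" and c: "0 < c"
    and pd: "\<And>z. c * (\<Sum>A\<in>S. (z A)\<^sup>2) \<le> (\<Sum>A\<in>S. \<Sum>B\<in>S. z A * X A B * z B)"
  shows "invertible_on S X"
proof (rule inj_matrix_invertible_on[OF fin])
  fix v A assume v: "\<And>A. A \<in> S \<Longrightarrow> (\<Sum>B\<in>S. X A B * v B) = 0" and A: "A \<in> S"
  have "(\<Sum>A\<in>S. \<Sum>B\<in>S. v A * X A B * v B) = (\<Sum>A\<in>S. v A * (\<Sum>B\<in>S. X A B * v B))"
    by (simp add: sum_distrib_left mult.assoc)
  also have "\<dots> = 0" using v by simp
  finally have "c * (\<Sum>A\<in>S. (v A)\<^sup>2) \<le> 0" using pd[of v] by simp
  hence "(\<Sum>A\<in>S. (v A)\<^sup>2) \<le> 0" using c by (simp add: mult_le_0_iff)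
  moreover have "(v A)\<^sup>2 \<le> (\<Sum>A\<in>S. (v A)\<^sup>2)" using fin A by (intro member_le_sum) auto
  ultimately show "v A = 0" by (metis order.trans power2_less_eq_zero_iff)
qed

lemma inverse_on_sym:
  assumes fin: "finite S" and W: "is_inverse_on S X W"
    and X: "\<And>A B. A \<in> S \<Longrightarrow> B \<in> S \<Longrightarrow> X A B = X B A" and AB: "A \<in> S" "B \<in> S"
  shows "W A B = W B A"
proof -
  have XW: "(\<Sum>C\<in>S. X A C * W C B) = (if A = B then 1 else 0)" if "A \<in> S" "B \<in> S" for A B
    using W that by (auto simp: is_inverse_on_def mat_prod_def)
  have "W B A = (\<Sum>C\<in>S. W C A * (if C = B then 1 else 0))"
    using fin AB by (simp add: if_distrib cong: if_cong)
  also have "\<dots> = (\<Sum>C\<in>S. W C A * (\<Sum>D\<in>S. X C D * W D B))"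
    using XW AB by (intro sum.cong refl) auto
  also have "\<dots> = (\<Sum>C\<in>S. \<Sum>D\<in>S. W C A * X C D * W D B)" by (simp add: sum_distrib_left mult.assoc)
  also have "\<dots> = (\<Sum>D\<in>S. \<Sum>C\<in>S. W C A * X C D * W D B)" by (rule sum.swap)
  also have "\<dots> = (\<Sum>D\<in>S. (\<Sum>C\<in>S. X D C * W C A) * W D B)"
    unfolding sum_distrib_right by (intro sum.cong refl) (use X in \<open>simp add: mult.commute\<close>)
  also have "\<dots> = (\<Sum>D\<in>S. (if D = A then 1 else 0) * W D B)"
    using XW AB by (intro sum.cong refl) auto
  also have "\<dots> = W A B" using fin AB by (simp add: if_distrib[of "\<lambda>x. x * _"] cong: if_cong)
  finally show ?thesis ..
qed

text \<open>Completing the square: the block form is evaluated at \<open>z = X\<^sup>-\<^sup>1 H w\<close>.\<close>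

lemma schur_complement:
  fixes X H Y :: "'a rmat"
  assumes fin: "finite S" "finite P" and inv: "invertible_on S X"
    and X: "\<And>A B. A \<in> S \<Longrightarrow> B \<in> S \<Longrightarrow> X A B = X B A"
    and Y: "\<And>A B. A \<in> P \<Longrightarrow> B \<in> P \<Longrightarrow> Y A B = Y B A"
    and block: "\<And>z w. 2 * (\<Sum>A\<in>S. \<Sum>B\<in>P. z A * H A B * w B) \<le>
      (\<Sum>A\<in>S. \<Sum>B\<in>S. z A * X A B * z B) + (\<Sum>A\<in>P. \<Sum>B\<in>P. w A * Y A B * w B)"
  shows "loewner_ge_on P Y (mat_prod S (mat_prod S (mat_transpose H) (inv_on S X)) H)"
proof -
  define W where "W = inv_on S X"
  have W: "is_inverse_on S X W"
    unfolding W_def inv_on_def using inv unfolding invertible_on_def by (rule someI_ex)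
  have Ws: "W A B = W B A" if "A \<in> S" "B \<in> S" for A B
    using inverse_on_sym[OF fin(1) W X that] .
  have XW: "(\<Sum>C\<in>S. X A C * W C B) = (if A = B then 1 else 0)" if "A \<in> S" "B \<in> S" for A B
    using W that by (auto simp: is_inverse_on_def mat_prod_def)
  define R where "R = mat_prod S (mat_prod S (mat_transpose H) W) H"
  have R: "R A B = (\<Sum>C\<in>S. \<Sum>D\<in>S. H D A * W D C * H C B)" for A B
    by (simp add: R_def mat_prod_def mat_transpose_def sum_distrib_right)
  have Rs: "R A B = R B A" for A B
  proof -
    have "R A B = (\<Sum>D\<in>S. \<Sum>C\<in>S. H D A * W D C * H C B)" unfolding R by (rule sum.swap)
    also have "\<dots> = R B A" unfolding R by (intro sum.cong refl) (use Ws in \<open>simp add: mult_ac\<close>)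
    finally show ?thesis .
  qed
  have form: "(\<Sum>A\<in>P. \<Sum>B\<in>P. w A * R A B * w B) \<le> (\<Sum>A\<in>P. \<Sum>B\<in>P. w A * Y A B * w B)" for w
  proof -
    define h where "h = (\<lambda>C. \<Sum>B\<in>P. H C B * w B)"
    define z where "z = (\<lambda>A. \<Sum>C\<in>S. W A C * h C)"
    define q where "q = (\<Sum>A\<in>S. z A * h A)"
    have Xz: "(\<Sum>B\<in>S. X A B * z B) = h A" if A: "A \<in> S" for A
    proof -
      have "(\<Sum>B\<in>S. X A B * z B) = (\<Sum>B\<in>S. \<Sum>C\<in>S. X A B * W B C * h C)"
        by (simp add: z_def sum_distrib_left mult.assoc)
      also have "\<dots> = (\<Sum>C\<in>S. \<Sum>B\<in>S. X A B * W B C * h C)" by (rule sum.swap)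
      also have "\<dots> = (\<Sum>C\<in>S. (if A = C then 1 else 0) * h C)"
        unfolding sum_distrib_right[symmetric] using XW A by (intro sum.cong refl) auto
      also have "\<dots> = h A" using fin A by (simp add: if_distrib[of "\<lambda>x. x * _"] cong: if_cong)
      finally show ?thesis .
    qed
    have 1: "(\<Sum>A\<in>S. \<Sum>B\<in>S. z A * X A B * z B) = q"
    proof -
      have "(\<Sum>A\<in>S. \<Sum>B\<in>S. z A * X A B * z B) = (\<Sum>A\<in>S. z A * (\<Sum>B\<in>S. X A B * z B))"
        by (simp add: sum_distrib_left mult.assoc)
      thus ?thesis using Xz by (simp add: q_def)
    qed
    have 2: "(\<Sum>A\<in>S. \<Sum>B\<in>P. z A * H A B * w B) = q"
      by (simp add: q_def h_def sum_distrib_left mult.assoc)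
    have 3: "(\<Sum>A\<in>P. \<Sum>B\<in>P. w A * R A B * w B) = q"
    proof -
      have "(\<Sum>A\<in>P. \<Sum>B\<in>P. w A * R A B * w B)
        = (\<Sum>A\<in>P. \<Sum>B\<in>P. \<Sum>C\<in>S. \<Sum>D\<in>S. (H D A * w A) * W D C * (H C B * w B))"
        unfolding R by (simp add: sum_distrib_left sum_distrib_right mult_ac)
      also have "\<dots> = (\<Sum>C\<in>S. \<Sum>D\<in>S. \<Sum>A\<in>P. \<Sum>B\<in>P. (H D A * w A) * W D C * (H C B * w B))"
        by (rule sum_swap_pairs)
      also have "\<dots> = (\<Sum>C\<in>S. \<Sum>D\<in>S. h D * W D C * h C)"
        unfolding h_def by (simp add: sum_distrib_left sum_distrib_right mult_ac)
      also have "\<dots> = (\<Sum>C\<in>S. z C * h C)"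
        unfolding z_def sum_distrib_right by (intro sum.cong refl) (use Ws in \<open>simp add: mult_ac\<close>)
      finally show ?thesis by (simp add: q_def)
    qed
    \<comment> \<open>All three forms equal \<open>q\<close> at this \<open>z\<close>, so
      \<open>block\<close> reads \<open>2 * q\<close> at most \<open>q\<close> plus the form of
      \<open>Y\<close>.\<close>
    show ?thesis using block[of z w] unfolding 1 2 3 by simp
  qed
  have "0 \<le> (\<Sum>A\<in>P. \<Sum>B\<in>P. w A * (Y A B - R A B) * w B)" for w
    using form[of w] by (simp add: algebra_simps sum_subtractf)
  thus ?thesis
    unfolding loewner_ge_on_def psd_on_def W_def[symmetric] R_def[symmetric] using Y Rs by auto
qed

section \<open>The blocks indexed by singletons\<close>

lemma sum_ksubsets_1: "(\<Sum>A\<in>ksubsets n 1. f A) = (\<Sum>i\<in>{1..n}. f {i})"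
proof -
  have "ksubsets n 1 = (\<lambda>i. {i}) ` {1..n}"
    by (auto simp: ksubsets_def card_1_singleton_iff)
  thus ?thesis by (simp add: sum.reindex inj_on_def)
qed

lemma Hmat11_entry:
  assumes "i \<in> {1..n}" "j \<in> {1..n}"
  shows "Hmat n \<alpha> 1 1 G {i} {j} = (if i = j then \<alpha> 1 - \<alpha> 2 / 2 else 0) + (\<alpha> 2 / 2 - (\<alpha> 1)\<^sup>2)
    + \<alpha> 2 / 2 * edge_sign G i j"
proof -
  have "{i} \<in> ksubsets n 1" "{j} \<in> ksubsets n 1" using assms by (auto simp: ksubsets_def)
  hence H: "Hmat n \<alpha> 1 1 G {i} {j} = Nmat \<alpha> G {i} {j} - \<alpha> 1 * \<alpha> 1"
    by (simp add: Hmat_def submat_def Amat_def)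
  show ?thesis
  proof (cases "i = j")
    case True thus ?thesis unfolding H by (simp add: Nmat_def power2_eq_square)
  next
    case False
    have d: "{i} - {j} = {i}" "{j} - {i} = {j}" and c: "card ({i} \<union> {j}) = 2" using False by auto
    have "Nmat \<alpha> G {i} {j} = \<alpha> 2 * edge_ind G i j" unfolding Nmat_def d c by simp
    thus ?thesis unfolding H using False by (simp add: edge_ind_eq power2_eq_square field_simps)
  qed
qed

lemma H11_form_lower:
  assumes op: "op_bounded {1..n} (edge_sign G) lam" and \<alpha>: "0 \<le> \<alpha> 2"
  shows "(\<alpha> 1 - \<alpha> 2 / 2 - \<alpha> 2 / 2 * lam) * (\<Sum>A\<in>ksubsets n 1. (z A)\<^sup>2)
      + (\<alpha> 2 / 2 - (\<alpha> 1)\<^sup>2) * (\<Sum>A\<in>ksubsets n 1. z A)\<^sup>2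
    \<le> (\<Sum>A\<in>ksubsets n 1. \<Sum>B\<in>ksubsets n 1. z A * Hmat n \<alpha> 1 1 G A B * z B)"
proof -
  interpret op_bounded "{1..n}" "edge_sign G" lam by (rule op)
  let ?V = "{1..n}"
  define y where "y = (\<lambda>i. z {i})"
  define Z where "Z = (\<Sum>i\<in>?V. (y i)\<^sup>2)"
  let ?q = "\<Sum>i\<in>?V. \<Sum>j\<in>?V. y i * edge_sign G i j * y j"
  have Z0: "0 \<le> Z" unfolding Z_def by (intro sum_nonneg) simp
  have "\<bar>?q\<bar> \<le> lam * (sqrt Z * sqrt Z)" unfolding Z_def by (rule op_bilin)
  hence q: "- (lam * Z) \<le> ?q" using Z0 by simp
  have "(\<Sum>A\<in>ksubsets n 1. \<Sum>B\<in>ksubsets n 1. z A * Hmat n \<alpha> 1 1 G A B * z B)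
    = (\<Sum>i\<in>?V. \<Sum>j\<in>?V. y i * Hmat n \<alpha> 1 1 G {i} {j} * y j)"
    unfolding sum_ksubsets_1 y_def ..
  also have "\<dots> = (\<Sum>i\<in>?V. \<Sum>j\<in>?V. (if i = j then (\<alpha> 1 - \<alpha> 2 / 2) * (y i)\<^sup>2 else 0)
      + ((\<alpha> 2 / 2 - (\<alpha> 1)\<^sup>2) * (y i * y j) + \<alpha> 2 / 2 * (y i * edge_sign G i j * y j)))"
  proof (rule sum.cong[OF refl], rule sum.cong[OF refl])
    fix i j assume "i \<in> ?V" "j \<in> ?V"
    note E = Hmat11_entry[OF this, of \<alpha> G]
    show "y i * Hmat n \<alpha> 1 1 G {i} {j} * y j = (if i = j then (\<alpha> 1 - \<alpha> 2 / 2) * (y i)\<^sup>2 else 0)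
      + ((\<alpha> 2 / 2 - (\<alpha> 1)\<^sup>2) * (y i * y j) + \<alpha> 2 / 2 * (y i * edge_sign G i j * y j))"
      unfolding E by (cases "i = j") (simp_all add: algebra_simps power2_eq_square)
  qed
  also have "\<dots> = (\<alpha> 1 - \<alpha> 2 / 2) * Z + ((\<alpha> 2 / 2 - (\<alpha> 1)\<^sup>2) * (\<Sum>i\<in>?V. y i)\<^sup>2 + \<alpha> 2 / 2 * ?q)"
    unfolding Z_def power2_eq_square[of "sum _ _"] sum_product by (simp add: sum.distrib sum_distrib_left)
  also have "\<dots> \<ge> (\<alpha> 1 - \<alpha> 2 / 2) * Z + ((\<alpha> 2 / 2 - (\<alpha> 1)\<^sup>2) * (\<Sum>i\<in>?V. y i)\<^sup>2 + \<alpha> 2 / 2 * (- (lam * Z)))"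
    using \<alpha> by (intro add_left_mono mult_left_mono q) simp
  finally show ?thesis unfolding sum_ksubsets_1 Z_def y_def by (simp add: algebra_simps)
qed

lemma Hmat12_approx:
  assumes i: "i \<in> {1..n}" and kl: "{k, l} \<in> ksubsets n 2" and \<alpha>: "0 \<le> \<alpha> 3" "\<alpha> 3 \<le> \<alpha> 2"
  shows "\<bar>Hmat n \<alpha> 1 2 G {i} {k, l} - (\<alpha> 3 / 4 * ((1 + edge_sign G i k) * (1 + edge_sign G i l)) - \<alpha> 1 * \<alpha> 2)\<bar>
    \<le> \<alpha> 2 * (of_bool (i = k) + of_bool (i = l))"
proof -
  have ne: "k \<noteq> l" using kl by (simp add: ksubsets_2_iff)
  have "{i} \<in> ksubsets n 1" using i by (auto simp: ksubsets_def)
  hence "Hmat n \<alpha> 1 2 G {i} {k, l} = Nmat \<alpha> G {i} {k, l} - \<alpha> (card {i}) * \<alpha> (card {k, l})"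
    unfolding Hmat_def submat_def Amat_def using kl by (simp only: simp_thms if_True)
  moreover have "card {i} = 1" "card {k, l} = 2" using ne by auto
  ultimately have H: "Hmat n \<alpha> 1 2 G {i} {k, l} = Nmat \<alpha> G {i} {k, l} - \<alpha> 1 * \<alpha> 2"
    by (simp only:)
  define x where "x = \<alpha> 3 / 4 * ((1 + edge_sign G i k) * (1 + edge_sign G i l))"
  show ?thesis
  proof (cases "i = k \<or> i = l")
    case True
    have u: "{i} \<union> {k, l} = {k, l}" "{i} - {k, l} = {}" and c: "card {k, l} = 2" using True ne by auto
    have N: "Nmat \<alpha> G {i} {k, l} = \<alpha> 2" unfolding Nmat_def u c by simp
    have e: "0 \<le> (1 + edge_sign G p q) / 2" "(1 + edge_sign G p q) / 2 \<le> 1" for p q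
      by (auto simp: edge_sign_def)
    have x: "x = \<alpha> 3 * ((1 + edge_sign G i k) / 2 * ((1 + edge_sign G i l) / 2))" by (simp add: x_def)
    have "0 \<le> x" unfolding x by (intro mult_nonneg_nonneg e \<alpha>)
    moreover have "x \<le> \<alpha> 3" unfolding x by (intro mult_left_le mult_le_one mult_nonneg_nonneg e \<alpha>)
    moreover have "of_bool (i = k) + of_bool (i = l) = (1::real)" using True ne by auto
    ultimately show ?thesis unfolding H N x_def[symmetric] using \<alpha> by simp
  next
    case False
    have d: "{i} - {k, l} = {i}" "{k, l} - {i} = {k, l}" and u: "{i} \<union> {k, l} = {i, k, l}" using False by auto
    have c: "card {i, k, l} = 3" using False ne by simp
    have "Nmat \<alpha> G {i} {k, l} = \<alpha> 3 * (edge_ind G i k * edge_ind G i l)"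
      unfolding Nmat_def d u c using ne by simp
    also have "\<dots> = x" using False by (simp add: edge_ind_eq x_def)
    finally show ?thesis unfolding H x_def[symmetric] using False by simp
  qed
qed

text \<open>The constant character gives the rank-one term, which is separated because its norm,
  about \<open>n powr (3/2) * \<alpha> 3\<close>, is too large for the general error. Single signs
  act on row sums, the product of two is a diagonal of \<open>a u a\<close>, and the entries with
  \<open>i\<close> in the pair cost the \<alpha>2 term.\<close>

lemma H12_form_approx:
  assumes op: "op_bounded {1..n} (edge_sign G) lam" and \<alpha>: "0 \<le> \<alpha> 3" "\<alpha> 3 \<le> \<alpha> 2"
  shows "\<bar>2 * (\<Sum>A\<in>ksubsets n 1. \<Sum>B\<in>ksubsets n 2. z A * Hmat n \<alpha> 1 2 G A B * w B)
     - (\<alpha> 3 / 4 - \<alpha> 1 * \<alpha> 2) * (\<Sum>A\<in>ksubsets n 1. z A) * (\<Sum>i\<in>{1..n}. \<Sum>j\<in>{1..n}. offdiag w i j)\<bar>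
    \<le> (\<alpha> 3 / 4 * (2 * lam * sqrt n + lam\<^sup>2) + 2 * \<alpha> 2 * sqrt n)
       * (sqrt (\<Sum>A\<in>ksubsets n 1. (z A)\<^sup>2) * sqrt (frob2 {1..n} (offdiag w)))"
proof -
  interpret op_bounded "{1..n}" "edge_sign G" lam by (rule op)
  let ?V = "{1..n}"
  let ?a = "edge_sign G"
  define u where "u = offdiag w"
  define y where "y = (\<lambda>i. z {i})"
  define Z where "Z = (\<Sum>i\<in>?V. (y i)\<^sup>2)"
  define N where "N = frob2 ?V u"
  define H where "H = (\<lambda>i k l. Hmat n \<alpha> 1 2 G {i} {k, l})"
  define T where "T = (\<lambda>f. \<Sum>i\<in>?V. \<Sum>k\<in>?V. \<Sum>l\<in>?V. y i * u k l * f i k l)"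
  have us: "u k l = u l k" and u0: "u k k = 0" for k l unfolding u_def by (rule offdiag_sym, rule offdiag_same)
  have \<alpha>2: "0 \<le> \<alpha> 2" using \<alpha> by simp
  have lhs: "2 * (\<Sum>A\<in>ksubsets n 1. \<Sum>B\<in>ksubsets n 2. z A * Hmat n \<alpha> 1 2 G A B * w B) = T H"
  proof -
    have "2 * (\<Sum>B\<in>ksubsets n 2. z {i} * Hmat n \<alpha> 1 2 G {i} B * w B) = (\<Sum>k\<in>?V. \<Sum>l\<in>?V. y i * u k l * H i k l)" for i
    proof -
      have "2 * (\<Sum>B\<in>ksubsets n 2. z {i} * Hmat n \<alpha> 1 2 G {i} B * w B)
        = (\<Sum>k\<in>?V. \<Sum>l\<in>?V. if k = l then 0 else z {i} * Hmat n \<alpha> 1 2 G {i} {k, l} * w {k, l})"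
        by (rule sum_ksubsets_2[symmetric])
      also have "\<dots> = (\<Sum>k\<in>?V. \<Sum>l\<in>?V. y i * u k l * H i k l)"
        by (intro sum.cong refl) (simp add: u_def offdiag_def y_def H_def)
      finally show ?thesis .
    qed
    thus ?thesis unfolding sum_ksubsets_1 T_def by (simp only: sum_distrib_left)
  qed
  have Tadd: "T (\<lambda>i k l. f i k l + g i k l) = T f + T g" for f g
    by (simp add: T_def distrib_left sum.distrib)
  have Tmul: "T (\<lambda>i k l. c * f i k l) = c * T f" for c f
    by (simp add: T_def sum_distrib_left mult_ac)
  have rows: "(\<Sum>i\<in>?V. (\<Sum>j\<in>?V. u i j)\<^sup>2) \<le> n * N"
    unfolding N_def using sum_rows_sq_le[of u] by simp
  have T0: "T (\<lambda>i k l. 1) = (\<Sum>i\<in>?V. y i) * (\<Sum>k\<in>?V. \<Sum>l\<in>?V. u k l)"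
    unfolding T_def sum_distrib_right by (simp add: sum_distrib_left)
  have T1: "\<bar>T (\<lambda>i k l. ?a i k)\<bar> \<le> lam * sqrt n * (sqrt Z * sqrt N)"
  proof -
    have "T (\<lambda>i k l. ?a i k) = (\<Sum>i\<in>?V. \<Sum>k\<in>?V. y i * ?a i k * (\<Sum>l\<in>?V. u k l))"
      by (simp add: T_def sum_distrib_left mult_ac)
    also have "\<bar>\<dots>\<bar> \<le> lam * (sqrt Z * sqrt (\<Sum>k\<in>?V. (\<Sum>l\<in>?V. u k l)\<^sup>2))"
      unfolding Z_def by (rule op_bilin)
    also have "\<dots> \<le> lam * (sqrt Z * sqrt (n * N))"
      by (intro mult_left_mono real_sqrt_le_mono rows lam_nonneg) (simp add: Z_def sum_nonneg)
    finally show ?thesis by (simp add: real_sqrt_mult mult_ac)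
  qed
  have T1': "T (\<lambda>i k l. ?a i l) = T (\<lambda>i k l. ?a i k)"
    unfolding T_def
  proof (rule sum.cong[OF refl])
    fix i
    have "(\<Sum>k\<in>?V. \<Sum>l\<in>?V. y i * u k l * ?a i l) = (\<Sum>l\<in>?V. \<Sum>k\<in>?V. y i * u k l * ?a i l)" by (rule sum.swap)
    also have "\<dots> = (\<Sum>l\<in>?V. \<Sum>k\<in>?V. y i * u l k * ?a i l)" 
      by (rule sum.cong[OF refl], rule sum.cong[OF refl], subst us, rule refl)
    finally show "(\<Sum>k\<in>?V. \<Sum>l\<in>?V. y i * u k l * ?a i l) = (\<Sum>k\<in>?V. \<Sum>l\<in>?V. y i * u k l * ?a i k)" .
  qed
  have T2: "\<bar>T (\<lambda>i k l. ?a i k * ?a i l)\<bar> \<le> lam\<^sup>2 * (sqrt Z * sqrt N)"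
  proof -
    have eq: "T (\<lambda>i k l. ?a i k * ?a i l) = (\<Sum>i\<in>?V. y i * (\<Sum>k\<in>?V. \<Sum>l\<in>?V. ?a i k * ?a i l * u k l))"
      by (simp add: T_def sum_distrib_left mult_ac)
    have "\<bar>T (\<lambda>i k l. ?a i k * ?a i l)\<bar> \<le> sqrt Z * sqrt (\<Sum>i\<in>?V. (\<Sum>k\<in>?V. \<Sum>l\<in>?V. ?a i k * ?a i l * u k l)\<^sup>2)"
      unfolding eq Z_def by (rule abs_sum_mult_le)
    also have "\<dots> \<le> sqrt Z * (lam\<^sup>2 * sqrt N)"
      unfolding N_def by (intro mult_left_mono sqrt_diag_conj) (simp add: Z_def sum_nonneg)
    finally show ?thesis by (simp add: mult_ac)
  qed
  define g where "g = (\<lambda>i k l. \<alpha> 3 / 4 * ((1 + ?a i k) * (1 + ?a i l)) - \<alpha> 1 * \<alpha> 2)"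
  have Tg: "T g = (\<alpha> 3 / 4 - \<alpha> 1 * \<alpha> 2) * T (\<lambda>i k l. 1) + \<alpha> 3 / 4 * (2 * T (\<lambda>i k l. ?a i k) + T (\<lambda>i k l. ?a i k * ?a i l))"
  proof -
    have "g = (\<lambda>i k l. (\<alpha> 3 / 4 - \<alpha> 1 * \<alpha> 2) * 1 + (\<alpha> 3 / 4 * ?a i k + (\<alpha> 3 / 4 * ?a i l + \<alpha> 3 / 4 * (?a i k * ?a i l))))"
      unfolding g_def by (intro ext) (simp add: algebra_simps)
    thus ?thesis by (simp only: Tadd Tmul T1') (simp add: algebra_simps)
  qed
  have err: "\<bar>T H - T g\<bar> \<le> 2 * \<alpha> 2 * sqrt n * (sqrt Z * sqrt N)"
  proof -
    have "\<bar>T H - T g\<bar> \<le> (\<Sum>i\<in>?V. \<Sum>k\<in>?V. \<Sum>l\<in>?V. \<bar>y i * u k l * H i k l - y i * u k l * g i k l\<bar>)"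
      unfolding T_def sum_subtractf[symmetric] by (intro order.trans[OF sum_abs] sum_mono sum_abs)
    also have "\<dots> \<le> (\<Sum>i\<in>?V. \<Sum>k\<in>?V. \<Sum>l\<in>?V. (if i = k then \<alpha> 2 * \<bar>y i\<bar> * \<bar>u k l\<bar> else 0) + (if i = l then \<alpha> 2 * \<bar>y i\<bar> * \<bar>u k l\<bar> else 0))"
    proof (intro sum_mono)
      fix i k l assume m: "i \<in> ?V" "k \<in> ?V" "l \<in> ?V"
      show "\<bar>y i * u k l * H i k l - y i * u k l * g i k l\<bar>
        \<le> (if i = k then \<alpha> 2 * \<bar>y i\<bar> * \<bar>u k l\<bar> else 0) + (if i = l then \<alpha> 2 * \<bar>y i\<bar> * \<bar>u k l\<bar> else 0)"
      proof (cases "k = l")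
        case True thus ?thesis using \<alpha>2 by (simp add: u0)
      next
        case False
        have "\<bar>y i * u k l * H i k l - y i * u k l * g i k l\<bar> = \<bar>y i\<bar> * \<bar>u k l\<bar> * \<bar>H i k l - g i k l\<bar>"
          by (simp add: right_diff_distrib[symmetric] abs_mult)
        also have "\<dots> \<le> \<bar>y i\<bar> * \<bar>u k l\<bar> * (\<alpha> 2 * (of_bool (i = k) + of_bool (i = l)))"
          unfolding H_def g_def using m False by (intro mult_left_mono Hmat12_approx \<alpha>) (auto simp: ksubsets_2_iff)
        also have "\<dots> = (if i = k then \<alpha> 2 * \<bar>y i\<bar> * \<bar>u k l\<bar> else 0) + (if i = l then \<alpha> 2 * \<bar>y i\<bar> * \<bar>u k l\<bar> else 0)"
          by simp
        finally show ?thesis .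
      qed
    qed
    also have "\<dots> = (\<Sum>i\<in>?V. \<bar>y i\<bar> * (2 * \<alpha> 2 * (\<Sum>l\<in>?V. \<bar>u i l\<bar>)))"
    proof (rule sum.cong[OF refl])
      fix i assume i: "i \<in> ?V"
      have "(\<Sum>k\<in>?V. \<Sum>l\<in>?V. if i = k then \<alpha> 2 * \<bar>y i\<bar> * \<bar>u k l\<bar> else 0)
        = (\<Sum>k\<in>?V. if i = k then (\<Sum>l\<in>?V. \<alpha> 2 * \<bar>y i\<bar> * \<bar>u k l\<bar>) else 0)"
        by (rule sum.cong[OF refl]) auto
      also have "\<dots> = (\<Sum>l\<in>?V. \<alpha> 2 * \<bar>y i\<bar> * \<bar>u i l\<bar>)" using i by simp
      finally have 1: "(\<Sum>k\<in>?V. \<Sum>l\<in>?V. if i = k then \<alpha> 2 * \<bar>y i\<bar> * \<bar>u k l\<bar> else 0) = (\<Sum>l\<in>?V. \<alpha> 2 * \<bar>y i\<bar> * \<bar>u i l\<bar>)" .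
      have 2: "(\<Sum>k\<in>?V. \<Sum>l\<in>?V. if i = l then \<alpha> 2 * \<bar>y i\<bar> * \<bar>u k l\<bar> else 0) = (\<Sum>l\<in>?V. \<alpha> 2 * \<bar>y i\<bar> * \<bar>u i l\<bar>)"
        using i us[of _ i] by simp
      show "(\<Sum>k\<in>?V. \<Sum>l\<in>?V. (if i = k then \<alpha> 2 * \<bar>y i\<bar> * \<bar>u k l\<bar> else 0) + (if i = l then \<alpha> 2 * \<bar>y i\<bar> * \<bar>u k l\<bar> else 0))
        = \<bar>y i\<bar> * (2 * \<alpha> 2 * (\<Sum>l\<in>?V. \<bar>u i l\<bar>))"
        unfolding sum.distrib 1 2 by (simp add: sum_distrib_left[symmetric])
    qed
    also have "\<dots> = 2 * \<alpha> 2 * (\<Sum>i\<in>?V. \<bar>y i\<bar> * (\<Sum>l\<in>?V. \<bar>u i l\<bar>))"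
      unfolding sum_distrib_left by (intro sum.cong refl) (simp add: sum_distrib_left mult_ac)
    also have "\<dots> \<le> 2 * \<alpha> 2 * (sqrt Z * sqrt (n * N))"
    proof (intro mult_left_mono)
      have "(\<Sum>i\<in>?V. \<bar>y i\<bar> * (\<Sum>l\<in>?V. \<bar>u i l\<bar>)) \<le> sqrt (\<Sum>i\<in>?V. \<bar>y i\<bar>\<^sup>2) * sqrt (\<Sum>i\<in>?V. (\<Sum>l\<in>?V. \<bar>u i l\<bar>)\<^sup>2)"
        using abs_sum_mult_le[of "\<lambda>i. \<bar>y i\<bar>" "\<lambda>i. \<Sum>l\<in>?V. \<bar>u i l\<bar>" ?V] by linarith
      also have "\<dots> \<le> sqrt Z * sqrt (n * N)"
      proof (intro mult_mono real_sqrt_le_mono)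
        show "(\<Sum>i\<in>?V. (\<Sum>l\<in>?V. \<bar>u i l\<bar>)\<^sup>2) \<le> n * N"
          using sum_rows_sq_le[of "\<lambda>i l. \<bar>u i l\<bar>"] unfolding N_def by (simp add: frob2_def)
      qed (simp_all add: Z_def sum_nonneg)
      finally show "(\<Sum>i\<in>?V. \<bar>y i\<bar> * (\<Sum>l\<in>?V. \<bar>u i l\<bar>)) \<le> sqrt Z * sqrt (n * N)" .
    qed (use \<alpha>2 in simp)
    finally show ?thesis by (simp add: real_sqrt_mult mult_ac)
  qed
  have main: "\<bar>\<alpha> 3 / 4 * (2 * T (\<lambda>i k l. ?a i k) + T (\<lambda>i k l. ?a i k * ?a i l))\<bar>
    \<le> \<alpha> 3 / 4 * (2 * (lam * sqrt n * (sqrt Z * sqrt N)) + lam\<^sup>2 * (sqrt Z * sqrt N))"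
  proof -
    have "\<bar>2 * T (\<lambda>i k l. ?a i k) + T (\<lambda>i k l. ?a i k * ?a i l)\<bar>
      \<le> 2 * (lam * sqrt n * (sqrt Z * sqrt N)) + lam\<^sup>2 * (sqrt Z * sqrt N)"
      using T1 T2 by linarith
    thus ?thesis using \<alpha>(1) unfolding abs_mult[of "\<alpha> 3 / 4"] by (simp add: mult_left_mono)
  qed
  have "\<bar>T H - (\<alpha> 3 / 4 - \<alpha> 1 * \<alpha> 2) * T (\<lambda>i k l. 1)\<bar>
    \<le> \<alpha> 3 / 4 * (2 * (lam * sqrt n * (sqrt Z * sqrt N)) + lam\<^sup>2 * (sqrt Z * sqrt N)) + 2 * \<alpha> 2 * sqrt n * (sqrt Z * sqrt N)"
    using err main Tg by linarith
  also have "\<dots> = (\<alpha> 3 / 4 * (2 * lam * sqrt n + lam\<^sup>2) + 2 * \<alpha> 2 * sqrt n) * (sqrt Z * sqrt N)"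
    by (simp add: algebra_simps)
  finally show ?thesis
    unfolding lhs unfolding T0 sum_ksubsets_1 Z_def N_def y_def u_def by (simp only: mult.assoc)
qed

section \<open>Numerical estimates\<close>

text \<open>Both terms decay faster than any power: \<open>n * ln (2 * n + 1)\<close> is beaten by
  \<open>n * (ln n)\<^sup>2 / 4\<close>, and any multiple of \<open>ln n\<close> by
  \<open>(ln n)\<^sup>2 / 2\<close>.\<close>

lemma tail_bound_bigo:
  "(\<lambda>n. (2 * real n + 1) ^ n * (2 * exp (- (real n * (ln (real n))\<^sup>2 / 4)))
      + 8 * real n ^ 4 * exp (- ((ln (real n))\<^sup>2 / 2))) \<in> O(\<lambda>n. 1 / real n ^ 4)"
proof -
  have asymp: "(\<lambda>n. exp (real n * ln (2 * real n + 1)) * (2 * exp (- (real n * (ln (real n))\<^sup>2 / 4)))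
      + 8 * real n ^ 4 * exp (- ((ln (real n))\<^sup>2 / 2))) \<in> O(\<lambda>n. 1 / real n ^ 4)"
    by real_asymp
  have e: "exp (real n * ln (2 * real n + 1)) = (2 * real n + 1) ^ n" for n
    by (simp add: exp_of_nat_mult)
  show ?thesis using asymp unfolding e .
qed

lemma AM_GM_form:
  fixes p q m x y :: real
  assumes "0 \<le> p" "0 \<le> q" "m\<^sup>2 \<le> 4 * p * q"
  shows "m * (x * y) \<le> p * x\<^sup>2 + q * y\<^sup>2"
proof -
  have "(m * (x * y))\<^sup>2 \<le> (p * x\<^sup>2 + q * y\<^sup>2)\<^sup>2"
  proof -
    have "(m * (x * y))\<^sup>2 = m\<^sup>2 * (x\<^sup>2 * y\<^sup>2)" by (simp add: power_mult_distrib)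
    also have "\<dots> \<le> (4 * p * q) * (x\<^sup>2 * y\<^sup>2)" by (intro mult_right_mono assms) auto
    also have "\<dots> \<le> (p * x\<^sup>2 + q * y\<^sup>2)\<^sup>2"
      using zero_le_power2[of "p * x\<^sup>2 - q * y\<^sup>2"] by (simp add: power2_eq_square algebra_simps)
    finally show ?thesis .
  qed
  thus ?thesis by (rule power2_le_imp_le) (use assms in auto)
qed

context
  fixes s L :: real
  assumes s: "2 \<le> s" and L: "10 \<le> L"
begin

text \<open>Here \<open>s\<close> stands for \<open>sqrt n\<close>. The coefficients are monomials
  in \<open>1 / L\<close> and \<open>1 / s\<close>; at equal powers of \<open>s\<close>, a spare
  factor \<open>L ^ j\<close> absorbs the constants.\<close>

lemma inv_pow_le:
  "1 / (L ^ (k + j) * s ^ m) \<le> 1 / (L ^ k * s ^ m) / 10 ^ j"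
proof -
  have "10 ^ j \<le> L ^ j" using L by (intro power_mono) auto
  hence "L ^ k * s ^ m * 10 ^ j \<le> L ^ k * s ^ m * L ^ j" using s L by (intro mult_left_mono) auto
  hence "1 / (L ^ k * s ^ m * L ^ j) \<le> 1 / (L ^ k * s ^ m * 10 ^ j)"
    using s L by (intro divide_left_mono) (auto intro!: mult_pos_pos)
  thus ?thesis by (simp add: power_add mult_ac)
qed

lemma inv_pow_le':
  assumes "c \<le> d * 10 ^ j" "0 \<le> c"
  shows "c * (1 / (L ^ (k + j) * s ^ m)) \<le> d * (1 / (L ^ k * s ^ m))"
proof -
  define x where "x = 1 / (L ^ k * s ^ m)"
  have x: "0 \<le> x" using s L by (simp add: x_def)
  have "c * (1 / (L ^ (k + j) * s ^ m)) \<le> c * (x / 10 ^ j)"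
    unfolding x_def by (intro mult_left_mono inv_pow_le assms)
  also have "\<dots> = (c / 10 ^ j) * x" by simp
  also have "\<dots> \<le> d * x" using assms x by (intro mult_right_mono) (auto simp: field_simps)
  finally show ?thesis unfolding x_def .
qed

lemma gram_error_le:
  "sqrt (s ^ 6 * L\<^sup>2 + s\<^sup>2 * ((2 * L\<^sup>2 + 3) * s\<^sup>2 * ((s * L + 2)\<^sup>2 + s\<^sup>2) + s ^ 4)) \<le> 8 * s ^ 3 * L\<^sup>2"
proof (rule real_le_lsqrt)
  have L1: "1 \<le> L\<^sup>2" "1 \<le> L ^ 4" "L\<^sup>2 \<le> L ^ 4" using L by (auto intro!: one_le_power power_increasing)
  have sL: "2 \<le> s * L" using mult_mono[of 2 s 1 L] s L by simp
  have "(s * L + 2)\<^sup>2 \<le> (2 * (s * L))\<^sup>2" using sL by (intro power_mono) linarith+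
  hence 1: "(s * L + 2)\<^sup>2 \<le> 4 * (s\<^sup>2 * L\<^sup>2)" by (simp add: power_mult_distrib)
  have 2: "s\<^sup>2 \<le> s\<^sup>2 * L\<^sup>2" using L1 mult_left_mono[of 1 "L\<^sup>2" "s\<^sup>2"] by simp
  have "(2 * L\<^sup>2 + 3) * ((s * L + 2)\<^sup>2 + s\<^sup>2) \<le> (5 * L\<^sup>2) * (5 * (s\<^sup>2 * L\<^sup>2))"
    using 1 2 L1 by (intro mult_mono) auto
  hence "s\<^sup>2 * (s\<^sup>2 * ((2 * L\<^sup>2 + 3) * ((s * L + 2)\<^sup>2 + s\<^sup>2))) \<le> s\<^sup>2 * (s\<^sup>2 * ((5 * L\<^sup>2) * (5 * (s\<^sup>2 * L\<^sup>2))))"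
    by (intro mult_left_mono) auto
  also have "\<dots> = 25 * (s ^ 6 * L ^ 4)" by (simp add: power_numeral_reduce)
  finally have 3: "s\<^sup>2 * (s\<^sup>2 * ((2 * L\<^sup>2 + 3) * ((s * L + 2)\<^sup>2 + s\<^sup>2))) \<le> 25 * (s ^ 6 * L ^ 4)" .
  have 4: "s ^ 6 * L\<^sup>2 \<le> s ^ 6 * L ^ 4" using L1 s by (intro mult_left_mono) auto
  have 5: "s ^ 6 \<le> s ^ 6 * L ^ 4" using L1 s mult_left_mono[of 1 "L ^ 4" "s ^ 6"] by simp
  have "s ^ 6 * L\<^sup>2 + s\<^sup>2 * ((2 * L\<^sup>2 + 3) * s\<^sup>2 * ((s * L + 2)\<^sup>2 + s\<^sup>2) + s ^ 4)
    = s ^ 6 * L\<^sup>2 + s\<^sup>2 * (s\<^sup>2 * ((2 * L\<^sup>2 + 3) * ((s * L + 2)\<^sup>2 + s\<^sup>2))) + s ^ 6"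
    by (simp add: algebra_simps power_numeral_reduce)
  \<comment> \<open>The three summands contribute 1, 25 and 1; the generous 64 is a square.\<close>
  also have "\<dots> \<le> 64 * (s ^ 6 * L ^ 4)"
  proof -
    have "0 \<le> s ^ 6 * L ^ 4" using s L by simp
    thus ?thesis using 3 4 5 by linarith
  qed
  also have "\<dots> = (8 * s ^ 3 * L\<^sup>2)\<^sup>2" by (simp add: power_mult_distrib flip: power_mult)
  finally show "s ^ 6 * L\<^sup>2 + s\<^sup>2 * ((2 * L\<^sup>2 + 3) * s\<^sup>2 * ((s * L + 2)\<^sup>2 + s\<^sup>2) + s ^ 4) \<le> (8 * s ^ 3 * L\<^sup>2)\<^sup>2" .
qed (use s L in auto)

text \<open>In units of \<open>K = 1 / (L ^ 37 * s)\<close> the conjugated identity contributes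
  3/400: \<open>be\<close> gives 1/100, at least 3/2 of \<open>2 * a2\<close> survives the
  corrections, and \<open>s\<^sup>2 - 2\<close> is at least half of \<open>s\<^sup>2\<close>. The
  errors have at least eleven further powers of \<open>1 / L\<close>, so 1/200 remains.\<close>

lemma pair_coeff_lower:
  assumes a2: "a2 = 1 / (L ^ 36 * s\<^sup>2)" and a3: "a3 = 1 / (L ^ 48 * s ^ 3)" and a4: "a4 = 1 / (L ^ 56 * s ^ 4)"
    and be: "be = 1 / (100 * s * L)" and lam: "lam = 9 * (s * L)" and e: "0 \<le> e" "e \<le> 8 * s ^ 3 * L\<^sup>2"
  shows "1 / (L ^ 37 * s ^ 1) / 200 \<le> (2 * a2 - 4 * s\<^sup>2 * a3 - a4 / 16 * (4 * lam * s\<^sup>2 + 5 * s * lam\<^sup>2 + 6 * lam\<^sup>2))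
    + be * ((2 * (a2 - a3) - 4 * s\<^sup>2 * a4) * (s\<^sup>2 - 2) - a4 / 16 * (4 * lam ^ 3 + 4 * s * lam ^ 3 + 6 * s\<^sup>2 * lam\<^sup>2 + s * e))"
proof -
  define K where "K = 1 / (L ^ 37 * s ^ 1)"
  have p: "0 < L" "0 < s" using s L by auto
  have K: "0 < K" using p by (simp add: K_def)
  have D: "1 / (L ^ (37 + j) * s ^ 1) \<le> K / 10 ^ j" for j unfolding K_def by (rule inv_pow_le)
  have s1: "1 \<le> s ^ j" and L1: "1 \<le> L ^ j" for j using s L by (auto intro!: one_le_power)
  have A: "4 * s\<^sup>2 * a3 \<le> K / 10 ^ 10"
  proof -
    have "4 * s\<^sup>2 * a3 = 4 * (1 / (L ^ (37 + 11) * s ^ 1))"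
      using p by (simp add: a3 field_simps power_numeral_reduce)
    thus ?thesis using D[of 11] K by simp
  qed
  have B: "a4 / 16 * (4 * lam * s\<^sup>2 + 5 * s * lam\<^sup>2 + 6 * lam\<^sup>2) \<le> K / 10 ^ 10"
  proof -
    have "4 * lam * s\<^sup>2 \<le> 36 * (s ^ 3 * L\<^sup>2)"
      using L1[of 1] p mult_left_mono[of 1 L "36 * (s ^ 3 * L)"] by (simp add: lam power_numeral_reduce algebra_simps)
    moreover have "6 * lam\<^sup>2 \<le> 486 * (s ^ 3 * L\<^sup>2)"
      using s1[of 1] p mult_left_mono[of 1 s "486 * (s\<^sup>2 * L\<^sup>2)"] by (simp add: lam power_numeral_reduce algebra_simps)
    moreover have "5 * s * lam\<^sup>2 = 405 * (s ^ 3 * L\<^sup>2)" by (simp add: lam power_numeral_reduce)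
    moreover have "0 \<le> s ^ 3 * L\<^sup>2" using p by simp
    ultimately have "4 * lam * s\<^sup>2 + 5 * s * lam\<^sup>2 + 6 * lam\<^sup>2 \<le> 960 * (s ^ 3 * L\<^sup>2)"
      by linarith
    hence "a4 / 16 * (4 * lam * s\<^sup>2 + 5 * s * lam\<^sup>2 + 6 * lam\<^sup>2) \<le> a4 / 16 * (960 * (s ^ 3 * L\<^sup>2))"
      using p by (intro mult_left_mono) (auto simp: a4)
    also have "\<dots> = 60 * (1 / (L ^ (37 + 17) * s ^ 1))"
      using p by (simp add: a4 field_simps power_numeral_reduce)
    finally show ?thesis using D[of 17] K by simp
  qed
  have C: "be * (a4 / 16 * (4 * lam ^ 3 + 4 * s * lam ^ 3 + 6 * s\<^sup>2 * lam\<^sup>2 + s * e)) \<le> K / 10 ^ 10"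
  proof -
    have "4 * lam ^ 3 \<le> 2916 * (s ^ 4 * L ^ 3)"
      using s1[of 1] p mult_left_mono[of 1 s "2916 * (s ^ 3 * L ^ 3)"] by (simp add: lam power_numeral_reduce algebra_simps)
    moreover have "4 * s * lam ^ 3 = 2916 * (s ^ 4 * L ^ 3)" by (simp add: lam power_numeral_reduce)
    moreover have "6 * s\<^sup>2 * lam\<^sup>2 \<le> 486 * (s ^ 4 * L ^ 3)"
      using L1[of 1] p mult_left_mono[of 1 L "486 * (s ^ 4 * L\<^sup>2)"] by (simp add: lam power_numeral_reduce algebra_simps)
    moreover have "s * e \<le> 8 * (s ^ 4 * L ^ 3)"
    proof -
      have "s * e \<le> s * (8 * s ^ 3 * L\<^sup>2)" using p e by (intro mult_left_mono) auto
      also have "\<dots> = (8 * (s ^ 4 * L\<^sup>2)) * 1" by (simp add: power_numeral_reduce)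
      also have "\<dots> \<le> (8 * (s ^ 4 * L\<^sup>2)) * L" using L p by (intro mult_left_mono) auto
      finally show ?thesis by (simp add: power_numeral_reduce algebra_simps)
    qed
    moreover have "0 \<le> s ^ 4 * L ^ 3" using p by simp
    ultimately have "4 * lam ^ 3 + 4 * s * lam ^ 3 + 6 * s\<^sup>2 * lam\<^sup>2 + s * e \<le> 6400 * (s ^ 4 * L ^ 3)"
      by linarith
    hence "be * (a4 / 16 * (4 * lam ^ 3 + 4 * s * lam ^ 3 + 6 * s\<^sup>2 * lam\<^sup>2 + s * e)) \<le> be * (a4 / 16 * (6400 * (s ^ 4 * L ^ 3)))"
      using p by (intro mult_left_mono) (auto simp: a4 be)
    also have "\<dots> = 4 * (1 / (L ^ (37 + 17) * s ^ 1))"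
      using p by (simp add: a4 be field_simps power_numeral_reduce)
    also have "\<dots> \<le> K / 10 ^ 10" using D[of 17] K by simp
    finally show ?thesis .
  qed
  have E: "K * (3 / 400) \<le> be * ((2 * (a2 - a3) - 4 * s\<^sup>2 * a4) * (s\<^sup>2 - 2)) + K / 10 ^ 10"
  proof -
    have s2: "s\<^sup>2 / 2 \<le> s\<^sup>2 - 2" using s mult_mono[of 2 s 2 s] by (simp add: power2_eq_square)
    have "a3 \<le> a2 / 10"
    proof -
      have "s\<^sup>2 \<le> s ^ 3" using s by (intro power_increasing) auto
      hence "a3 \<le> 1 / (L ^ (36 + 12) * s\<^sup>2)"
        unfolding a3 using p by (intro divide_left_mono) auto
      also have "\<dots> \<le> 1 / (L ^ 36 * s\<^sup>2) / 10 ^ 12" by (rule inv_pow_le)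
      also have "\<dots> \<le> a2 / 10" unfolding a2 using p by (intro divide_left_mono) auto
      finally show ?thesis .
    qed
    moreover have "4 * s\<^sup>2 * a4 \<le> a2 / 10"
    proof -
      have "4 * s\<^sup>2 * a4 = 4 * (1 / (L ^ (36 + 20) * s\<^sup>2))"
        using p by (simp add: a4 field_simps power_numeral_reduce)
      also have "\<dots> \<le> 1 / 10 * (1 / (L ^ 36 * s\<^sup>2))" by (rule inv_pow_le') simp_all
      also have "\<dots> = a2 / 10" by (simp add: a2)
      finally show ?thesis .
    qed
    moreover have "0 < a2" using p by (simp add: a2)
    moreover have "3 / 2 * a2 \<le> 2 * (a2 - a3) - x" if "a3 \<le> a2 / 10" "x \<le> a2 / 10" "0 < a2" for x
      using that by simp
    ultimately have "3 / 2 * a2 \<le> 2 * (a2 - a3) - 4 * s\<^sup>2 * a4" by blast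
    hence "(3 / 2 * a2) * (s\<^sup>2 / 2) \<le> (2 * (a2 - a3) - 4 * s\<^sup>2 * a4) * (s\<^sup>2 - 2)"
    proof (rule mult_mono[OF _ s2])
      have "0 < a2" using p by (simp add: a2)
      thus "0 \<le> 2 * (a2 - a3) - 4 * s\<^sup>2 * a4" using \<open>3 / 2 * a2 \<le> 2 * (a2 - a3) - 4 * s\<^sup>2 * a4\<close> by linarith
    qed simp
    hence "be * ((3 / 2 * a2) * (s\<^sup>2 / 2)) \<le> be * ((2 * (a2 - a3) - 4 * s\<^sup>2 * a4) * (s\<^sup>2 - 2))"
      using p by (intro mult_left_mono) (auto simp: be)
    also have "be * ((3 / 2 * a2) * (s\<^sup>2 / 2)) = K * (3 / 400)"
      using p by (simp add: be a2 K_def field_simps power_numeral_reduce)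
    finally show ?thesis using K by simp
  qed
  have a2p: "0 \<le> a2" using p by (simp add: a2)
  show ?thesis unfolding K_def[symmetric] right_diff_distrib[of be] using A B C E a2p K by simp
qed

text \<open>The noise \<open>a2 * lam\<close> is below \<open>a1\<close> by about
  \<open>L ^ 15\<close>, and \<open>a1\<^sup>2\<close> is below \<open>a2\<close> by \<gamma>, that
  is \<open>L ^ 4\<close>, which keeps the rank-one part of the singleton block positive.\<close>

lemma single_coeff_lower:
  assumes a1: "a1 = 1 / (L ^ 20 * s)" and a2: "a2 = 1 / (L ^ 36 * s\<^sup>2)" and lam: "lam = 9 * (s * L)"
  shows "a1 / 2 \<le> a1 - a2 / 2 - a2 / 2 * lam" "a2 / 4 \<le> a2 / 2 - a1\<^sup>2"
proof -
  have p: "0 < L" "0 < s" using s L by auto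
  have "1 \<le> s * L" using mult_mono[of 1 s 1 L] s L by simp
  hence "1 + lam \<le> 10 * (s * L)" unfolding lam by linarith
  hence "a2 / 2 * (1 + lam) \<le> a2 / 2 * (10 * (s * L))" using p by (intro mult_left_mono) (auto simp: a2)
  also have "\<dots> = 5 * (1 / (L ^ (20 + 15) * s ^ 1))"
    using p by (simp add: a2 field_simps power_numeral_reduce)
  also have "\<dots> \<le> 1 / 2 * (1 / (L ^ 20 * s ^ 1))" by (rule inv_pow_le') simp_all
  also have "\<dots> = a1 / 2" by (simp add: a1)
  finally show "a1 / 2 \<le> a1 - a2 / 2 - a2 / 2 * lam" by (simp add: algebra_simps)
  have "a1\<^sup>2 = 1 / (L ^ (36 + 4) * s\<^sup>2)" using p by (simp add: a1 power_divide power_mult_distrib flip: power_mult)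
  also have "\<dots> \<le> 1 / (L ^ 36 * s\<^sup>2) / 10 ^ 4" by (rule inv_pow_le)
  also have "\<dots> \<le> a2 / 4" unfolding a2 using p by (intro divide_left_mono) auto
  finally show "a2 / 4 \<le> a2 / 2 - a1\<^sup>2" by simp
qed

text \<open>The discriminant conditions for \<open>AM_GM_form\<close>, along the all-ones directions
  and for the remainder. In both the powers of \<open>s\<close> agree; the spare powers of
  \<open>L\<close> are 4 and 15.\<close>

lemma cross_coeff_upper:
  assumes a1: "a1 = 1 / (L ^ 20 * s)" and a2: "a2 = 1 / (L ^ 36 * s\<^sup>2)" and a3: "a3 = 1 / (L ^ 48 * s ^ 3)"
    and a4: "a4 = 1 / (L ^ 56 * s ^ 4)" and lam: "lam = 9 * (s * L)"
  shows "(a3 / 4 - a1 * a2)\<^sup>2 \<le> 4 * (a2 / 4) * (a4 / 128)"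
    "(a3 / 4 * (2 * lam * s + lam\<^sup>2) + 2 * a2 * s)\<^sup>2 \<le> 4 * (a1 / 2) * (1 / (L ^ 37 * s ^ 1) / 800)"
proof -
  have p: "0 < L" "0 < s" using s L by auto
  have "a1 * a2 = 1 / (L ^ (48 + 8) * s ^ 3)" using p by (simp add: a1 a2 field_simps power_numeral_reduce)
  also have "\<dots> \<le> 1 / (L ^ 48 * s ^ 3) / 10 ^ 8" by (rule inv_pow_le)
  also have "\<dots> \<le> a3 / 4" unfolding a3 using p by (intro divide_left_mono) auto
  finally have "a1 * a2 \<le> a3 / 4" .
  moreover have "0 \<le> a1 * a2" using p by (simp add: a1 a2)
  ultimately have "(a3 / 4 - a1 * a2)\<^sup>2 \<le> (a3 / 4)\<^sup>2" by (intro power_mono) auto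
  also have "\<dots> = 1 / 16 * (1 / (L ^ (92 + 4) * s ^ 6))"
    using p by (simp add: a3 power_divide power_mult_distrib flip: power_mult)
  also have "\<dots> \<le> 1 / 128 * (1 / (L ^ 92 * s ^ 6))" by (rule inv_pow_le') simp_all
  also have "\<dots> = 4 * (a2 / 4) * (a4 / 128)"
    using p by (simp add: a2 a4 field_simps power_numeral_reduce)
  finally show "(a3 / 4 - a1 * a2)\<^sup>2 \<le> 4 * (a2 / 4) * (a4 / 128)" .
  have "2 * lam * s \<le> 18 * (s\<^sup>2 * L\<^sup>2)"
    using L p mult_left_mono[of 1 L "18 * (s\<^sup>2 * L)"] by (simp add: lam power_numeral_reduce algebra_simps)
  moreover have "lam\<^sup>2 = 81 * (s\<^sup>2 * L\<^sup>2)" by (simp add: lam power_mult_distrib)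
  moreover have "0 \<le> s\<^sup>2 * L\<^sup>2" by simp
  ultimately have "2 * lam * s + lam\<^sup>2 \<le> 100 * (s\<^sup>2 * L\<^sup>2)" by linarith
  hence "a3 / 4 * (2 * lam * s + lam\<^sup>2) \<le> a3 / 4 * (100 * (s\<^sup>2 * L\<^sup>2))"
    using p by (intro mult_left_mono) (auto simp: a3)
  also have "\<dots> = 25 * (1 / (L ^ (36 + 10) * s ^ 1))" using p by (simp add: a3 field_simps power_numeral_reduce)
  also have "\<dots> \<le> 1 * (1 / (L ^ 36 * s ^ 1))" by (rule inv_pow_le') simp_all
  also have "\<dots> = 1 / (L ^ 36 * s ^ 1)" by simp
  finally have "a3 / 4 * (2 * lam * s + lam\<^sup>2) \<le> 1 / (L ^ 36 * s ^ 1)" .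
  moreover have "2 * a2 * s = 2 * (1 / (L ^ 36 * s ^ 1))" using p by (simp add: a2 field_simps power_numeral_reduce)
  ultimately have le: "a3 / 4 * (2 * lam * s + lam\<^sup>2) + 2 * a2 * s \<le> 3 * (1 / (L ^ 36 * s ^ 1))" by linarith
  have "0 \<le> a3 / 4 * (2 * lam * s + lam\<^sup>2) + 2 * a2 * s" using p by (simp add: a2 a3 lam)
  with le have "(a3 / 4 * (2 * lam * s + lam\<^sup>2) + 2 * a2 * s)\<^sup>2 \<le> (3 * (1 / (L ^ 36 * s ^ 1)))\<^sup>2"
    by (intro power_mono) auto
  also have "\<dots> = 9 * (1 / (L ^ (57 + 15) * s\<^sup>2))"
    using p by (simp add: power_divide power_mult_distrib flip: power_mult)
  also have "\<dots> \<le> 1 / 400 * (1 / (L ^ 57 * s\<^sup>2))" by (rule inv_pow_le') simp_all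
  also have "\<dots> = 4 * (a1 / 2) * (1 / (L ^ 37 * s ^ 1) / 800)"
    using p by (simp add: a1 field_simps power_numeral_reduce)
  finally show "(a3 / 4 * (2 * lam * s + lam\<^sup>2) + 2 * a2 * s)\<^sup>2 \<le> 4 * (a1 / 2) * (1 / (L ^ 37 * s ^ 1) / 800)" .
qed

lemma alpha_order:
  assumes a2: "a2 = 1 / (L ^ 36 * s\<^sup>2)" and a3: "a3 = 1 / (L ^ 48 * s ^ 3)" and a4: "a4 = 1 / (L ^ 56 * s ^ 4)"
  shows "a4 \<le> a3" "a3 \<le> a2" "32 * a2\<^sup>2 \<le> a4"
proof -
  have p: "0 < L" "0 < s" using s L by auto
  show "a4 \<le> a3" "a3 \<le> a2"
    unfolding a2 a3 a4 using p s L by (intro divide_left_mono mult_mono power_increasing; simp)+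
  have "32 * a2\<^sup>2 = 32 * (1 / (L ^ (56 + 16) * s ^ 4))"
    using p by (simp add: a2 power_divide power_mult_distrib flip: power_mult)
  also have "\<dots> \<le> 1 * (1 / (L ^ 56 * s ^ 4))" by (rule inv_pow_le') simp_all
  also have "\<dots> = a4" by (simp add: a4)
  finally show "32 * a2\<^sup>2 \<le> a4" .
qed

end

section \<open>Assembling the bounds\<close>

lemma Hmat_sym: "Hmat n \<alpha> k k G A B = Hmat n \<alpha> k k G B A"
proof -
  have "(\<Prod>i\<in>A - B. \<Prod>j\<in>B - A. edge_ind G i j) = (\<Prod>i\<in>B - A. \<Prod>j\<in>A - B. edge_ind G i j)"
    by (subst prod.swap) (simp add: edge_ind_sym)
  hence "Nmat \<alpha> G A B = Nmat \<alpha> G B A" unfolding Nmat_def by (simp add: Un_commute)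
  moreover have "Amat \<alpha> A B = Amat \<alpha> B A" by (simp add: Amat_def)
  ultimately show ?thesis unfolding Hmat_def submat_def by auto
qed

lemma H22'_sym:
  assumes "A \<in> ksubsets n 2" "B \<in> ksubsets n 2"
  shows "H22' n \<alpha> \<beta> G A B = H22' n \<alpha> \<beta> G B A"
proof -
  have "EH22 n \<alpha> A B = EH22 n \<alpha> B A" unfolding EH22_def by (subst Hmat_sym) (rule refl)
  hence "Mmat n \<alpha> G A B = Mmat n \<alpha> G B A"
    unfolding Mmat_eq by (simp add: Hmat_sym[of n \<alpha> 2 G A B] Int_commute)
  thus ?thesis using assms by (simp add: H22'_entry Hmat_sym[of n \<alpha> 2 G A B] mult_ac)
qed

lemma op_bounded_of_net:
  assumes n: "n \<ge> 1" and L: "1 \<le> L" and net: "net_bounded n (edge_sign G) (sqrt n * L)"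
  shows "op_bounded {1..n} (edge_sign G) (9 * (sqrt n * L))"
proof
  have t: "sqrt n \<le> sqrt n * L" using L mult_left_mono[of 1 L "sqrt n"] by simp
  show "edge_sign G i j = edge_sign G j i" for i j by (rule edge_sign_sym)
  show "\<bar>edge_sign G i j\<bar> \<le> 1" for i j by (rule edge_sign_abs_le)
  show "0 \<le> 9 * (sqrt n * L)" using L by simp
  show "(\<Sum>i\<in>{1..n}. (\<Sum>j\<in>{1..n}. edge_sign G i j * y j)\<^sup>2) \<le> (9 * (sqrt n * L))\<^sup>2 * (\<Sum>j\<in>{1..n}. (y j)\<^sup>2)" for y
  proof (rule op_bound_of_quad_form)
    show "\<bar>\<Sum>i\<in>{1..n}. \<Sum>j\<in>{1..n}. x i * edge_sign G i j * x j\<bar> \<le> 9 * (sqrt n * L) * (\<Sum>i\<in>{1..n}. (x i)\<^sup>2)" for x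
      by (rule quad_form_le_of_net[OF edge_sign_sym edge_sign_abs_le n t net])
  qed (use n L in \<open>auto intro: edge_sign_sym\<close>)
qed simp

text \<open>The cross term is split in two: total sums are paired with total sums, norms with norms.
  Since \<open>pair\<close> bounds four times the form of \<open>H22'\<close>, only a quarter of
  each of its coefficients may be spent, whence \<open>\<alpha> 4 / 128\<close> and
  \<open>c / 4\<close>.\<close>

lemma quasirandom_loewner:
  fixes n :: nat and L \<beta> :: real and \<alpha> :: "nat \<Rightarrow> real"
  assumes n: "4 \<le> n" and L: "10 \<le> L"
    and \<alpha>1: "\<alpha> 1 = 1 / (L ^ 20 * sqrt n)" and \<alpha>2: "\<alpha> 2 = 1 / (L ^ 36 * (sqrt n)\<^sup>2)"
    and \<alpha>3: "\<alpha> 3 = 1 / (L ^ 48 * sqrt n ^ 3)" and \<alpha>4: "\<alpha> 4 = 1 / (L ^ 56 * sqrt n ^ 4)"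
    and \<beta>: "\<beta> = 1 / (100 * sqrt n * L)"
    and net: "net_bounded n (edge_sign G) (sqrt n * L)" and qr: "quasirandom n (edge_sign G) L"
  shows "invertible_on (ksubsets n 1) (Hmat n \<alpha> 1 1 G)" (is ?inv)
    and "loewner_ge_on (ksubsets n 2) (H22' n \<alpha> \<beta> G)
          (mat_prod (ksubsets n 1) (mat_prod (ksubsets n 1) (mat_transpose (Hmat n \<alpha> 1 2 G))
             (inv_on (ksubsets n 1) (Hmat n \<alpha> 1 1 G))) (Hmat n \<alpha> 1 2 G))" (is ?ge)
proof -
  define s where "s = sqrt n"
  define lam where "lam = 9 * (s * L)"
  have s: "2 \<le> s" using real_sqrt_le_mono[of 4 n] n by (simp add: s_def)
  have ns: "real n = s\<^sup>2" by (simp add: s_def)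
  have p: "0 < s" "0 < L" using s L by auto
  note \<alpha> = \<alpha>1[folded s_def] \<alpha>2[folded s_def] \<alpha>3[folded s_def] \<alpha>4[folded s_def]
  have op: "op_bounded {1..n} (edge_sign G) lam"
    unfolding lam_def s_def using n L net by (intro op_bounded_of_net) auto
  have ord: "\<alpha> 4 \<le> \<alpha> 3" "\<alpha> 3 \<le> \<alpha> 2" "32 * (\<alpha> 2)\<^sup>2 \<le> \<alpha> 4"
    by (rule alpha_order[OF s L \<alpha>(2,3,4)])+
  have pos: "0 < \<alpha> 1" "0 < \<alpha> 2" "0 < \<alpha> 3" "0 < \<alpha> 4" "0 < \<beta>"
    using p unfolding \<alpha> \<beta> s_def[symmetric] by simp_all
  define c where "c = 1 / (L ^ 37 * s ^ 1) / 200"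
  define e where "e = sqrt (real n ^ 3 * L\<^sup>2 + n * ((2 * L\<^sup>2 + 3) * n * gram_bound n L + (real n)\<^sup>2))"
  have c0: "0 \<le> c" using p by (simp add: c_def)
  have e: "0 \<le> e" "e \<le> 8 * s ^ 3 * L\<^sup>2"
  proof -
    have "gram_bound n L = (s * L + 2)\<^sup>2 + s\<^sup>2" unfolding gram_bound_def s_def by simp
    hence "e = sqrt (s ^ 6 * L\<^sup>2 + s\<^sup>2 * ((2 * L\<^sup>2 + 3) * s\<^sup>2 * ((s * L + 2)\<^sup>2 + s\<^sup>2) + s ^ 4))"
      unfolding e_def ns by (simp flip: power_mult)
    thus "e \<le> 8 * s ^ 3 * L\<^sup>2" using gram_error_le[OF s L] by simp
    have "0 \<le> gram_bound n L" by (simp add: gram_bound_def)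
    thus "0 \<le> e" unfolding e_def by simp
  qed
  have pair: "(\<alpha> 4 / 32) * (\<Sum>i\<in>{1..n}. \<Sum>j\<in>{1..n}. offdiag w i j)\<^sup>2 + c * frob2 {1..n} (offdiag w)
    \<le> 4 * (\<Sum>A\<in>ksubsets n 2. \<Sum>B\<in>ksubsets n 2. w A * H22' n \<alpha> \<beta> G A B * w B)" for w
  proof -
    let ?u = "offdiag w"
    let ?T = "\<Sum>i\<in>{1..n}. \<Sum>j\<in>{1..n}. ?u i j"
    let ?N = "frob2 {1..n} ?u"
    define k1 where "k1 = 2 * \<alpha> 2 - 4 * s\<^sup>2 * \<alpha> 3 - \<alpha> 4 / 16 * (4 * lam * s\<^sup>2 + 5 * s * lam\<^sup>2 + 6 * lam\<^sup>2)"
    define k2 where "k2 = (2 * (\<alpha> 2 - \<alpha> 3) - 4 * s\<^sup>2 * \<alpha> 4) * (s\<^sup>2 - 2)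
      - \<alpha> 4 / 16 * (4 * lam ^ 3 + 4 * s * lam ^ 3 + 6 * s\<^sup>2 * lam\<^sup>2 + s * e)"
    have k: "c \<le> k1 + \<beta> * k2"
      unfolding c_def k1_def k2_def by (rule pair_coeff_lower[OF s L \<alpha>(2,3,4) \<beta>[folded s_def] lam_def e])
    have 1: "(\<alpha> 4 / 16 - (\<alpha> 2)\<^sup>2) * ?T\<^sup>2 + k1 * ?N \<le> quad {1..n} ?u (\<lambda>i j k l. Hmat n \<alpha> 2 2 G {i, j} {k, l})"
      using H22_quad_lower[OF op, of \<alpha> ?u] pos ord offdiag_sym offdiag_same
      unfolding k1_def ns[symmetric] s_def by simp
    have 2: "k2 * ?N \<le> (\<Sum>x\<in>{1..n}. quad {1..n} (\<lambda>i j. edge_sign G x i * ?u i j * edge_sign G x j)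
         (\<lambda>i j k l. Mmat n \<alpha> G {i, j} {k, l}))"
      using M_quad_sum_lower[OF op qr, of \<alpha> ?u] pos ord offdiag_sym offdiag_same
      unfolding k2_def ns[symmetric] s_def e_def by simp
    \<comment> \<open>The subtracted \<open>(\<alpha> 2)\<^sup>2\<close> uses up at most half of the
      all-ones coefficient, by \<open>32 * (\<alpha> 2)\<^sup>2 \<le> \<alpha> 4\<close>.\<close>
    have "(\<alpha> 4 / 32) * ?T\<^sup>2 \<le> (\<alpha> 4 / 16 - (\<alpha> 2)\<^sup>2) * ?T\<^sup>2"
      using ord by (intro mult_right_mono) auto
    moreover have "c * ?N \<le> (k1 + \<beta> * k2) * ?N" using k by (intro mult_right_mono) auto
    moreover have "\<beta> * (k2 * ?N) \<le> \<beta> * (\<Sum>x\<in>{1..n}. quad {1..n} (\<lambda>i j. edge_sign G x i * ?u i j * edge_sign G x j)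
         (\<lambda>i j k l. Mmat n \<alpha> G {i, j} {k, l}))"
      using 2 pos by (intro mult_left_mono) auto
    ultimately show ?thesis unfolding H22'_form using 1 by (simp add: distrib_right mult.assoc)
  qed
  have single: "\<alpha> 1 / 2 * (\<Sum>A\<in>ksubsets n 1. (z A)\<^sup>2) + \<alpha> 2 / 4 * (\<Sum>A\<in>ksubsets n 1. z A)\<^sup>2
    \<le> (\<Sum>A\<in>ksubsets n 1. \<Sum>B\<in>ksubsets n 1. z A * Hmat n \<alpha> 1 1 G A B * z B)" for z
  proof -
    note sc = single_coeff_lower[OF s L \<alpha>(1,2) lam_def]
    have "\<alpha> 1 / 2 * (\<Sum>A\<in>ksubsets n 1. (z A)\<^sup>2) + \<alpha> 2 / 4 * (\<Sum>A\<in>ksubsets n 1. z A)\<^sup>2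
      \<le> (\<alpha> 1 - \<alpha> 2 / 2 - \<alpha> 2 / 2 * lam) * (\<Sum>A\<in>ksubsets n 1. (z A)\<^sup>2)
        + (\<alpha> 2 / 2 - (\<alpha> 1)\<^sup>2) * (\<Sum>A\<in>ksubsets n 1. z A)\<^sup>2"
      by (intro add_mono mult_right_mono sc) (auto intro: sum_nonneg)
    also have "\<dots> \<le> (\<Sum>A\<in>ksubsets n 1. \<Sum>B\<in>ksubsets n 1. z A * Hmat n \<alpha> 1 1 G A B * z B)"
      by (rule H11_form_lower[OF op]) (use pos in simp)
    finally show ?thesis .
  qed
  show inv: ?inv
  proof (rule pos_def_invertible_on)
    show "\<alpha> 1 / 2 * (\<Sum>A\<in>ksubsets n 1. (z A)\<^sup>2)
      \<le> (\<Sum>A\<in>ksubsets n 1. \<Sum>B\<in>ksubsets n 1. z A * Hmat n \<alpha> 1 1 G A B * z B)" for z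
    proof -
      have "0 \<le> \<alpha> 2 / 4 * (\<Sum>A\<in>ksubsets n 1. z A)\<^sup>2" using pos by simp
      thus ?thesis using single[of z] by linarith
    qed
  qed (use pos in simp_all)
  show ?ge
  proof (rule schur_complement[OF _ _ inv])
    show "Hmat n \<alpha> 1 1 G A B = Hmat n \<alpha> 1 1 G B A" for A B by (rule Hmat_sym)
    show "H22' n \<alpha> \<beta> G A B = H22' n \<alpha> \<beta> G B A" if "A \<in> ksubsets n 2" "B \<in> ksubsets n 2" for A B
      using that by (rule H22'_sym)
    fix z w :: "nat set \<Rightarrow> real"
    define Z where "Z = (\<Sum>A\<in>ksubsets n 1. (z A)\<^sup>2)"
    define S where "S = (\<Sum>A\<in>ksubsets n 1. z A)"
    define T where "T = (\<Sum>i\<in>{1..n}. \<Sum>j\<in>{1..n}. offdiag w i j)"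
    define N where "N = frob2 {1..n} (offdiag w)"
    define m where "m = \<alpha> 3 / 4 - \<alpha> 1 * \<alpha> 2"
    define eta where "eta = \<alpha> 3 / 4 * (2 * lam * s + lam\<^sup>2) + 2 * \<alpha> 2 * s"
    note cc = cross_coeff_upper[OF s L \<alpha> lam_def]
    have Z0: "0 \<le> Z" and N0: "0 \<le> N" by (auto simp: Z_def N_def intro: sum_nonneg)
    have "\<bar>2 * (\<Sum>A\<in>ksubsets n 1. \<Sum>B\<in>ksubsets n 2. z A * Hmat n \<alpha> 1 2 G A B * w B) - m * S * T\<bar> \<le> eta * (sqrt Z * sqrt N)"
      unfolding m_def S_def T_def eta_def Z_def N_def s_def
      by (rule H12_form_approx[OF op]) (use pos ord in auto)
    hence "2 * (\<Sum>A\<in>ksubsets n 1. \<Sum>B\<in>ksubsets n 2. z A * Hmat n \<alpha> 1 2 G A B * w B) \<le> m * (S * T) + eta * (sqrt Z * sqrt N)"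
      by (simp add: abs_le_iff algebra_simps)
    also have "m * (S * T) \<le> \<alpha> 2 / 4 * S\<^sup>2 + \<alpha> 4 / 128 * T\<^sup>2"
      by (rule AM_GM_form) (use pos cc(1) in \<open>auto simp: m_def\<close>)
    also have "eta * (sqrt Z * sqrt N) \<le> \<alpha> 1 / 2 * (sqrt Z)\<^sup>2 + c / 4 * (sqrt N)\<^sup>2"
      by (rule AM_GM_form) (use pos c0 cc(2) in \<open>auto simp: eta_def c_def\<close>)
    also have "\<alpha> 2 / 4 * S\<^sup>2 + \<alpha> 4 / 128 * T\<^sup>2 + (\<alpha> 1 / 2 * (sqrt Z)\<^sup>2 + c / 4 * (sqrt N)\<^sup>2)
      \<le> (\<Sum>A\<in>ksubsets n 1. \<Sum>B\<in>ksubsets n 1. z A * Hmat n \<alpha> 1 1 G A B * z B)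
        + (\<Sum>A\<in>ksubsets n 2. \<Sum>B\<in>ksubsets n 2. w A * H22' n \<alpha> \<beta> G A B * w B)"
      using single[of z] pair[of w] Z0 N0 unfolding Z_def[symmetric] S_def[symmetric] T_def[symmetric] N_def[symmetric]
      by simp
    finally show "2 * (\<Sum>A\<in>ksubsets n 1. \<Sum>B\<in>ksubsets n 2. z A * Hmat n \<alpha> 1 2 G A B * w B)
      \<le> (\<Sum>A\<in>ksubsets n 1. \<Sum>B\<in>ksubsets n 1. z A * Hmat n \<alpha> 1 1 G A B * z B)
        + (\<Sum>A\<in>ksubsets n 2. \<Sum>B\<in>ksubsets n 2. w A * H22' n \<alpha> \<beta> G A B * w B)"
      by simp
  qed simp_all
qed

theorem theorem3p6:
  fixes \<alpha> :: "nat \<Rightarrow> nat \<Rightarrow> real" and \<beta> \<gamma> \<rho> :: "nat \<Rightarrow> real"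
  assumes "\<And>n. \<beta> n = 1 / (100 * sqrt (real n) * ln (real n))"
    and "\<And>n. \<gamma> n = ln (real n) ^ 4"
    and "\<And>n. \<rho> n = 1 / ln (real n) ^ 20"
    and "\<And>n. \<alpha> n 0 = 1"
    and "\<And>n. \<alpha> n 1 = \<rho> n / sqrt (real n)"
    and "\<And>n. \<alpha> n 2 = \<gamma> n * \<rho> n ^ 2 / real n"
    and "\<And>n. \<alpha> n 3 = \<gamma> n ^ 3 * \<rho> n ^ 3 / real n powr (3/2)"
    and "\<And>n. \<alpha> n 4 = \<gamma> n ^ 6 * \<rho> n ^ 4 / real n ^ 2"
  shows "(\<lambda>n. 1 - measure_pmf.prob (gnp n (1/2))
            {G. invertible_on (ksubsets n 1) (Hmat n (\<alpha> n) 1 1 G) \<and>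
                loewner_ge_on (ksubsets n 2)
                  (H22' n (\<alpha> n) (\<beta> n) G)
                  (mat_prod (ksubsets n 1)
                     (mat_prod (ksubsets n 1)
                        (mat_transpose (Hmat n (\<alpha> n) 1 2 G))
                        (inv_on (ksubsets n 1) (Hmat n (\<alpha> n) 1 1 G)))
                     (Hmat n (\<alpha> n) 1 2 G))})
         \<in> O(\<lambda>n. 1 / real n ^ 4)"
    (is "(\<lambda>n. 1 - measure_pmf.prob (gnp n (1/2)) (?good n)) \<in> _")
proof -
  let ?f = "\<lambda>n. (2 * real n + 1) ^ n * (2 * exp (- (real n * (ln (real n))\<^sup>2 / 4)))
      + 8 * real n ^ 4 * exp (- ((ln (real n))\<^sup>2 / 2))"
  \<comment> \<open>The thresholds supply \<open>2 \<le> sqrt n\<close> and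
    \<open>10 \<le> L\<close>, which the numerical estimates use in place of asymptotics.\<close>
  have bound: "1 - measure_pmf.prob (gnp n (1/2)) (?good n) \<le> ?f n"
    if n: "4 \<le> n" and L: "10 \<le> ln (real n)" for n
  proof -
    let ?L = "ln (real n)"
    have pos: "0 < real n" "0 < ?L" using n L by auto
    have pw: "real n powr (3/2) = sqrt n ^ 3"
      using pos by (simp add: powr_half_sqrt[symmetric] powr_power)
    have al: "\<alpha> n 1 = 1 / (?L ^ 20 * sqrt n)" "\<alpha> n 2 = 1 / (?L ^ 36 * (sqrt n)\<^sup>2)"
      "\<alpha> n 3 = 1 / (?L ^ 48 * sqrt n ^ 3)" "\<alpha> n 4 = 1 / (?L ^ 56 * sqrt n ^ 4)"
    proof -
      show "\<alpha> n 1 = 1 / (?L ^ 20 * sqrt n)" unfolding assms by simp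
      show "\<alpha> n 2 = 1 / (?L ^ 36 * (sqrt n)\<^sup>2)" unfolding assms
        using pos by (simp add: power_divide field_simps flip: power_mult power_add)
      show "\<alpha> n 3 = 1 / (?L ^ 48 * sqrt n ^ 3)" unfolding assms pw
        using pos by (simp add: power_divide field_simps flip: power_mult power_add)
      have "sqrt n ^ 4 = real n ^ 2" using power_mult[of "sqrt n" 2 2] by simp
      thus "\<alpha> n 4 = 1 / (?L ^ 56 * sqrt n ^ 4)" unfolding assms
        using pos by (simp add: power_divide field_simps flip: power_mult power_add)
    qed
    let ?bad = "{G. \<not> (net_bounded n (edge_sign G) (sqrt n * ?L) \<and> quasirandom n (edge_sign G) ?L)}"
    have sub: "- ?good n \<subseteq> ?bad"
    proof
      fix G assume "G \<in> - ?good n"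
      thus "G \<in> ?bad"
        using quasirandom_loewner[where \<alpha> = "\<alpha> n" and \<beta> = "\<beta> n" and G = G, OF n L al assms(1)[of n]] by blast
    qed
    have "1 - measure_pmf.prob (gnp n (1/2)) (?good n) = measure_pmf.prob (gnp n (1/2)) (- ?good n)"
      using measure_pmf.prob_compl[of "?good n" "gnp n (1/2)"] by (simp add: Compl_eq_Diff_UNIV)
    also have "\<dots> \<le> measure_pmf.prob (gnp n (1/2)) ?bad"
      by (rule measure_pmf.finite_measure_mono[OF sub]) simp
    also have "\<dots> \<le> ?f n"
      unfolding gnp_half using prob_not_quasirandom[of n ?L] n pos by (simp add: add.commute)
    finally show ?thesis .
  qed
  have ev: "eventually (\<lambda>n. 4 \<le> n \<and> 10 \<le> ln (real n)) sequentially"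
    by (intro eventually_conj eventually_ge_at_top) real_asymp
  have "(\<lambda>n. 1 - measure_pmf.prob (gnp n (1/2)) (?good n)) \<in> O(?f)"
  proof (rule landau_o.big_mono)
    show "eventually (\<lambda>n. norm (1 - measure_pmf.prob (gnp n (1/2)) (?good n)) \<le> norm (?f n)) sequentially"
      using ev
    proof eventually_elim
      case (elim n)
      have "0 \<le> 1 - measure_pmf.prob (gnp n (1/2)) (?good n)" by simp
      moreover have "1 - measure_pmf.prob (gnp n (1/2)) (?good n) \<le> ?f n" using elim by (intro bound) auto
      ultimately show ?case by (simp only: real_norm_def)
    qed
  qed
  thus ?thesis using tail_bound_bigo by (rule landau_o.big_trans)
qed

end
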